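(* (a) Let $\mathrm g\in\mathscr G(\theta,\Phi)$ be a Gibbs measure on the configuration space $\Gamma_X$, and let $\hat{\mathrm g}$ be the corresponding probability measure on the configuration space $\Gamma_{\mathcal Z}$, obtained by attaching i.i.d. $\eta$-distributed vectors to the points of a $\mathrm g$-distributed configuration. Then $\hat{\mathrm g}\in\mathscr G(\sigma,\hat\Phi)$, i.e. $\hat{\mathrm g}$ is a Gibbs measure on $\Gamma_{\mathcal Z}$ with the reference measure $\sigma:=\theta\otimes\eta$ and the interaction potential $\hat\Phi:\Gamma^0_{\mathcal Z}\to\mathbb R\cup\{+\infty\}$ given by $\hat\Phi(\hat\gamma):=\Phi(p_X(\hat\gamma))$ if $p_X(\hat\gamma)\in\Gamma_X$ and $\hat\Phi(\hat\gamma):=+\infty$ otherwise. (b) If the measure $\mathrm g\in\mathscr G(\theta,\Phi)$ has a finite correlation function $\kappa^n_{\mathrm g}$ of some order $n\in\mathbb N$, then the correlation function $\kappa^n_{\hat{\mathrm g}}$ of the measure $\hat{\mathrm g}\in\mathscr G(\sigma,\hat\Phi)$ is given by $$\kappa^n_{\hat{\mathrm g}}(z_1,\dots,z_n)=\kappa^n_{\mathrm g}\bigl(p_X(z_1),\dots,p_X(z_n)\bigr),\qquad z_1,\dots,z_n\in\mathcal Z.$$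
   Context: $X$ is a Polish space which is also a linear space (e.g. $X=\mathbb R^d$). $\mathfrak X:=\bigsqcup_{n\in\mathbb Z_+\cup\{\infty\}}X^n$ with the disjoint union topology ($X^0=\{\emptyset\}$, $X^\infty$ is the space of infinite sequences), $\mathcal Z:=X\times\mathfrak X$, $p_X(x,\bar y):=x$. $\eta$ is a probability measure on $\mathfrak X$ symmetric with respect to permutations of coordinates. For a Polish space $Y$, a generalized configuration is a countable aggregate of points of $Y$ (possibly with multiplicities), identified with the measure $\gamma=\sum_i\delta_{y_i}$. $\Gamma_Y$ is the set of proper configurations, i.e. those with $\gamma(B)<\infty$ for every compact $B$ and $\gamma(\{y\})\le1$ for every $y$, with the $\sigma$-algebra generated by the sets $\{\gamma:\gamma(B)=n\}$ ($B$ Borel, $n\in\mathbb Z_+$); $\Gamma_Y^0:=\{\gamma\in\Gamma_Y:\gamma(Y)<\infty\}$. The map $p_X$ is lifted to configurations by $p_X(\hat\gamma):=\bigsqcup_{z\in\hat\gamma}\{p_X(z)\}$ (with multiplicities). Gibbs measures on $\Gamma_Y$ are specified by a reference measure $\theta$ on $Y$ and an interaction potential, i.e. a measurable $\Phi:\Gamma_Y^0\to\mathbb R\cup\{+\infty\}$ with $\Phi(\emptyset)=0$. The interaction energy between $\xi\in\Gamma_Y^0$ and $\gamma\in\Gamma_Y$ is $E(\xi,\gamma):=\sum_{\gamma'\subset\gamma,\ \gamma'\in\Gamma_Y^0}\Phi(\xi\cup\gamma')$ if this sum converges absolutely, and $E(\xi,\gamma):=+\infty$ otherwise. $\mathscr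 G(\theta,\Phi)$ is the class of grand canonical Gibbs measures, i.e. the probability measures on $\Gamma_Y$ satisfying the Dobrushin–Lanford–Ruelle equation; it is used through the equivalent Nguyen–Zessin characterization: for every measurable $H:Y\times\Gamma_Y\to[0,\infty)$, $$\int_{\Gamma_Y}\sum_{y\in\gamma}H(y,\gamma)\,\mathrm g(d\gamma)=\int_{\Gamma_Y}\Bigl(\int_YH(y,\gamma\cup\{y\})\,e^{-E(\{y\},\gamma)}\,\theta(dy)\Bigr)\mathrm g(d\gamma).$$ The $n$-th order correlation function $\kappa^n_{\mathrm g}:Y^n\to[0,\infty)$ of a Gibbs measure $\mathrm g\in\mathscr G(\theta,\Phi)$ is defined by the property that for any symmetric $\phi\in C_0(Y^n)$, $$\int_{\Gamma_Y}\sum_{\{y_1,\dots,y_n\}\subset\gamma}\phi(y_1,\dots,y_n)\,\mathrm g(d\gamma)=\frac1{n!}\int_{Y^n}\phi(y_1,\dots,y_n)\,\kappa^n_{\mathrm g}(y_1,\dots,y_n)\,\theta(dy_1)\cdots\theta(dy_n),$$ where $C_0$ denotes continuous functions with compact support. $\hat{\mathrm g}$ is the distribution of $\hat\gamma=\bigcup_{x\in\gamma}\{(x,\bar y_x)\}$, where $\gamma$ has distribution $\mathrm g$ and, given $\gamma$, the vectors $\bar y_x$ ($x\in\gamma$) are i.i.d. with distribution $\eta$; it is concentrated on $\{\hat\gamma\in\Gamma_{\mathcal Z}:p_X(\hat\gamma)\in\Gamma_X\}$.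
   Formalization: The reference measure θ is additionally assumed sigma-finite and without atoms; without the latter (a) fails for the Nguyen–Zessin equation, e.g. θ=δ_0, Φ=0, g concentrated on the configuration {0}, and η non-atomic. *)

theory Defs
  imports "HOL-Probability.Probability" "HOL-Library.Extended_Nat" "HOL-Analysis.Sum_Topology"
begin

section \<open>The space of finite and infinite sequences\<close>

text \<open>
  The disjoint union of all powers \<open>X\<^sup>n\<close>, \<open>n \<in> {0, 1, ..., \<infinity>}\<close>. A point of \<open>X\<^sup>n\<close> is a pair
  \<open>(n, f)\<close> where \<open>f\<close> is extensional on \<open>{i. i < n}\<close>, so \<open>X\<^sup>0\<close> is a singleton.
\<close>

typedef 'a seqs = "{(n :: enat, f :: nat \<Rightarrow> 'a). f \<in> extensional {i. enat i < n}}"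
  morphisms rep_seqs Abs_seqs
  by (rule exI[of _ "(0, \<lambda>_. undefined)"]) (auto simp: extensional_def)

definition seq_len :: "'a seqs \<Rightarrow> enat" where
  "seq_len w = fst (rep_seqs w)"

definition seq_coord :: "'a seqs \<Rightarrow> nat \<Rightarrow> 'a" where
  "seq_coord w = snd (rep_seqs w)"

abbreviation seqs_topology :: "(enat \<times> (nat \<Rightarrow> 'a::topological_space)) topology" where
  "seqs_topology \<equiv> sum_topology (\<lambda>n. product_topology (\<lambda>_. euclidean) {i. enat i < n}) UNIV"

lemma range_rep_seqs: "range rep_seqs = (topspace seqs_topology :: (enat \<times> (nat \<Rightarrow> 'a::topological_space)) set)"
  unfolding type_definition.Rep_range[OF type_definition_seqs]
  by (auto simp: PiE_def)

lemma rep_seqs_eq: "rep_seqs w = (seq_len w, seq_coord w)"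
  by (simp add: seq_len_def seq_coord_def)

lemma seq_coord_extensional: "seq_coord w \<in> extensional {i. enat i < seq_len w}"
  using rep_seqs[of w] by (simp add: rep_seqs_eq)

lemma seqs_eqI: "seq_len v = seq_len w \<Longrightarrow> seq_coord v = seq_coord w \<Longrightarrow> v = w"
  by (metis rep_seqs_eq rep_seqs_inject)

lemma seqs_Abs:
  assumes "f \<in> extensional {i. enat i < n}"
  shows "seq_len (Abs_seqs (n, f)) = n" "seq_coord (Abs_seqs (n, f)) = f"
  using assms by (simp_all add: seq_len_def seq_coord_def Abs_seqs_inverse)

lemma openin_product_extensional:
  fixes S :: "(nat \<Rightarrow> 'a::topological_space) set"
  shows "openin (product_topology (\<lambda>_. euclidean) I) S \<longleftrightarrow>
    (\<exists>T. open T \<and> S = T \<inter> extensional I)"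
proof
  assume S: "openin (product_topology (\<lambda>_. euclidean) I) S"
  have sub: "S \<subseteq> extensional I"
    using openin_subset[OF S] by (auto simp: PiE_def)
  have cm: "continuous_map (top_of_set (extensional I)) (product_topology (\<lambda>_. euclidean) I)
      (\<lambda>f :: nat \<Rightarrow> 'a. f)"
    by (auto simp: continuous_map_componentwise intro: continuous_on_subset[OF continuous_on_product_coordinates])
  have "openin (top_of_set (extensional I)) {f \<in> extensional I. f \<in> S}"
    using openin_continuous_map_preimage[OF cm S] by simp
  moreover have "{f \<in> extensional I. f \<in> S} = S"
    using sub by auto
  ultimately show "\<exists>T. open T \<and> S = T \<inter> extensional I"
    by (auto simp: openin_open)
next
  assume "\<exists>T. open T \<and> S = T \<inter> extensional I"
  then obtain T where T: "open T" "S = T \<inter> extensional I"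
    by blast
  have "continuous_map (product_topology (\<lambda>_. euclidean) I) (product_topology (\<lambda>_. euclidean) UNIV)
      (\<lambda>f :: nat \<Rightarrow> 'a. f)"
  proof (subst continuous_map_componentwise_UNIV, rule allI)
    fix i
    show "continuous_map (product_topology (\<lambda>_. euclidean) I) euclidean (\<lambda>f :: nat \<Rightarrow> 'a. f i)"
    proof (cases "i \<in> I")
      case True
      then show ?thesis by (rule continuous_map_product_projection)
    next
      case False
      show ?thesis
        by (rule continuous_map_eq[of _ _ "\<lambda>_. undefined"])
          (use False in \<open>auto simp: PiE_def extensional_def\<close>)
    qed
  qed
  then have cm: "continuous_map (product_topology (\<lambda>_. euclidean) I) euclidean (\<lambda>f :: nat \<Rightarrow> 'a. f)"
    by (simp add: euclidean_product_topology)
  have "openin (product_topology (\<lambda>_. euclidean) I)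
      {f \<in> topspace (product_topology (\<lambda>_. euclidean) I). f \<in> T}"
    using openin_continuous_map_preimage[OF cm, of T] T by simp
  also have "{f \<in> topspace (product_topology (\<lambda>_. euclidean) I). f \<in> T} = S"
    using T by (auto simp: PiE_def)
  finally show "openin (product_topology (\<lambda>_. euclidean) I) S" .
qed

instantiation seqs :: (topological_space) topological_space
begin

definition open_seqs :: "'a seqs set \<Rightarrow> bool" where
  "open_seqs U \<longleftrightarrow> openin seqs_topology (rep_seqs ` U)"

instance
proof
  show "open (UNIV :: 'a seqs set)"
    unfolding open_seqs_def range_rep_seqs by (rule openin_topspace)
next
  fix S T :: "'a seqs set"
  assume "open S" "open T"
  then show "open (S \<inter> T)"
    unfolding open_seqs_def
    by (subst image_Int) (auto intro: injI simp: rep_seqs_inject)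
next
  fix K :: "'a seqs set set"
  assume "\<forall>S\<in>K. open S"
  then show "open (\<Union>K)"
    unfolding open_seqs_def by (subst image_Union) (auto intro!: openin_Union)
qed

end

lemma open_seqs_iff:
  fixes U :: "'a::topological_space seqs set"
  shows "open U \<longleftrightarrow> (\<forall>n. \<exists>T. open T \<and> (\<forall>w. seq_len w = n \<longrightarrow> (w \<in> U \<longleftrightarrow> seq_coord w \<in> T)))"
proof -
  have "open U \<longleftrightarrow> (\<forall>n. openin (product_topology (\<lambda>_. euclidean) {i. enat i < n})
      {f. (n, f) \<in> rep_seqs ` U})"
    unfolding open_seqs_def openin_sum_topology using range_rep_seqs by fastforce
  also have "\<dots> \<longleftrightarrow> (\<forall>n. \<exists>T. open T \<and> {f. (n, f) \<in> rep_seqs ` U} = T \<inter> extensional {i. enat i < n})"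
    by (simp add: openin_product_extensional)
  also have "\<dots> \<longleftrightarrow> (\<forall>n. \<exists>T. open T \<and> (\<forall>w. seq_len w = n \<longrightarrow> (w \<in> U \<longleftrightarrow> seq_coord w \<in> T)))"
  proof -
    have "{f. (n, f) \<in> rep_seqs ` U} = T \<inter> extensional {i. enat i < n} \<longleftrightarrow>
        (\<forall>w. seq_len w = n \<longrightarrow> (w \<in> U \<longleftrightarrow> seq_coord w \<in> T))" (is "?L \<longleftrightarrow> ?R") for n T
    proof
      assume L: ?L
      show ?R
      proof (intro allI impI)
        fix w :: "'a seqs"
        assume n: "seq_len w = n"
        have "w \<in> U \<longleftrightarrow> (n, seq_coord w) \<in> rep_seqs ` U"
          using n by (metis image_eqI rep_seqs_eq rep_seqs_inject image_iff)
        also have "\<dots> \<longleftrightarrow> seq_coord w \<in> T"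
          using L seq_coord_extensional[of w] n by blast
        finally show "w \<in> U \<longleftrightarrow> seq_coord w \<in> T" .
      qed
    next
      assume R: ?R
      show ?L
      proof (intro equalityI subsetI)
        fix f assume "f \<in> {f. (n, f) \<in> rep_seqs ` U}"
        then obtain w where "w \<in> U" "rep_seqs w = (n, f)" by force
        then show "f \<in> T \<inter> extensional {i. enat i < n}"
          using R seq_coord_extensional[of w] by (auto simp: rep_seqs_eq)
      next
        fix f assume f: "f \<in> T \<inter> extensional {i. enat i < n}"
        then have "Abs_seqs (n, f) \<in> U" "rep_seqs (Abs_seqs (n, f)) = (n, f)"
          using R by (auto simp: seqs_Abs rep_seqs_eq)
        then show "f \<in> {f. (n, f) \<in> rep_seqs ` U}"
          by (metis image_eqI mem_Collect_eq)
      qed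
    qed
    then show ?thesis by simp
  qed
  finally show ?thesis .
qed

text \<open>A complete metric for the disjoint union topology.\<close>

instantiation seqs :: (metric_space) metric_space
begin

definition dist_seqs :: "'a seqs \<Rightarrow> 'a seqs \<Rightarrow> real" where
  "dist_seqs v w =
    (if seq_len v = seq_len w then min 1 (dist (seq_coord v) (seq_coord w)) else 1)"

definition uniformity_seqs :: "('a seqs \<times> 'a seqs) filter" where
  "uniformity_seqs = (INF e\<in>{0<..}. principal {(x, y). dist x y < e})"

instance
proof
  show "(uniformity :: ('a seqs \<times> 'a seqs) filter) =
      (INF e\<in>{0<..}. principal {(x, y). dist x y < e})"
    by (rule uniformity_seqs_def)
next
  fix x y :: "'a seqs"
  show "dist x y = 0 \<longleftrightarrow> x = y"
    by (auto simp: dist_seqs_def min_def intro: seqs_eqI)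
next
  fix x y z :: "'a seqs"
  show "dist x y \<le> dist x z + dist y z"
    using dist_triangle2[of "seq_coord x" "seq_coord y" "seq_coord z"]
      zero_le_dist[of "seq_coord x" "seq_coord z"] zero_le_dist[of "seq_coord y" "seq_coord z"]
    unfolding dist_seqs_def min_def by (smt (verit))
next
  fix U :: "'a seqs set"
  have ev: "(\<forall>\<^sub>F (x', y) in uniformity. x' = x \<longrightarrow> y \<in> U) \<longleftrightarrow>
      (\<exists>e>0. \<forall>y. dist y x < e \<longrightarrow> y \<in> U)" for x
  proof -
    have "(\<forall>\<^sub>F (x', y) in uniformity. x' = x \<longrightarrow> y \<in> U) \<longleftrightarrow>
        (\<exists>e>0. \<forall>x' y. dist x' y < e \<longrightarrow> x' = x \<longrightarrow> y \<in> U)"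
      unfolding uniformity_seqs_def
    proof (subst eventually_INF_base)
      show "({0<..} :: real set) \<noteq> {}" by (auto intro: exI[of _ 1])
    next
      fix a b :: real
      assume "a \<in> {0<..}" "b \<in> {0<..}"
      then show "\<exists>c\<in>{0<..}. principal {(x :: 'a seqs, y). dist x y < c} \<le>
          inf (principal {(x, y). dist x y < a}) (principal {(x, y). dist x y < b})"
        by (intro bexI[of _ "min a b"]) auto
    qed (auto simp: eventually_principal)
    moreover have "dist y x = dist x y" for x y :: "'a seqs"
      by (auto simp: dist_seqs_def dist_commute)
    ultimately show ?thesis by metis
  qed
  have "open U \<longleftrightarrow> (\<forall>x\<in>U. \<exists>e>0. \<forall>y. dist y x < e \<longrightarrow> y \<in> U)"
  proof
    assume U: "open U"
    show "\<forall>x\<in>U. \<exists>e>0. \<forall>y. dist y x < e \<longrightarrow> y \<in> U"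
    proof
      fix x assume x: "x \<in> U"
      obtain T where T: "open T" "\<forall>w. seq_len w = seq_len x \<longrightarrow> (w \<in> U \<longleftrightarrow> seq_coord w \<in> T)"
        using U unfolding open_seqs_iff by blast
      then obtain e where e: "e > 0" "\<forall>f. dist f (seq_coord x) < e \<longrightarrow> f \<in> T"
        using x unfolding open_dist by blast
      show "\<exists>e>0. \<forall>y. dist y x < e \<longrightarrow> y \<in> U"
        using e T by (intro exI[of _ "min 1 e"]) (auto simp: dist_seqs_def min_def split: if_splits)
    qed
  next
    assume *: "\<forall>x\<in>U. \<exists>e>0. \<forall>y. dist y x < e \<longrightarrow> y \<in> U"
    show "open U"
      unfolding open_seqs_iff
    proof
      fix n
      define T where "T = \<Union>{ball f e | f e. 0 < e \<and> e \<le> 1 \<and>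
        (\<exists>x\<in>U. seq_len x = n \<and> seq_coord x = f \<and> (\<forall>y. dist y x < e \<longrightarrow> y \<in> U))}"
      have "open T" unfolding T_def by auto
      moreover have "w \<in> U \<longleftrightarrow> seq_coord w \<in> T" if w: "seq_len w = n" for w
      proof
        assume "w \<in> U"
        then obtain e where e: "e > 0" "\<forall>y. dist y w < e \<longrightarrow> y \<in> U" using * by blast
        have "seq_coord w \<in> ball (seq_coord w) (min 1 e)" using e by simp
        moreover have "0 < min 1 e \<and> min 1 e \<le> 1 \<and> (\<exists>x\<in>U. seq_len x = n \<and>
            seq_coord x = seq_coord w \<and> (\<forall>y. dist y x < min 1 e \<longrightarrow> y \<in> U))"
          using e w \<open>w \<in> U\<close> by auto
        ultimately show "seq_coord w \<in> T" unfolding T_def by blast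
      next
        assume "seq_coord w \<in> T"
        then obtain e x where e: "0 < e" "e \<le> 1" "x \<in> U" "seq_len x = n"
          "\<forall>y. dist y x < e \<longrightarrow> y \<in> U" "dist (seq_coord x) (seq_coord w) < e"
          unfolding T_def by auto
        then have "dist w x < e" using w by (auto simp: dist_seqs_def dist_commute)
        then show "w \<in> U" using e by blast
      qed
      ultimately show "\<exists>T. open T \<and> (\<forall>w. seq_len w = n \<longrightarrow> (w \<in> U \<longleftrightarrow> seq_coord w \<in> T))"
        by blast
    qed
  qed
  then show "open U \<longleftrightarrow> (\<forall>x\<in>U. \<forall>\<^sub>F (x', y) in uniformity. x' = x \<longrightarrow> y \<in> U)"
    by (simp add: ev)
qed

end

instance seqs :: (complete_space) complete_space
proof
  fix s :: "nat \<Rightarrow> 'a seqs"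
  assume s: "Cauchy s"
  obtain N where N: "\<And>m. m \<ge> N \<Longrightarrow> dist (s m) (s N) < 1"
    using s unfolding Cauchy_altdef2 by (meson zero_less_one)
  define n where "n = seq_len (s N)"
  have len: "seq_len (s m) = n" if "m \<ge> N" for m
    using N[OF that] by (auto simp: dist_seqs_def n_def split: if_splits)
  define f where "f k = seq_coord (s (k + N))" for k
  have ext: "f k \<in> extensional {i. enat i < n}" for k
    using seq_coord_extensional[of "s (k + N)"] len[of "k + N"] by (simp add: f_def)
  have dist_f: "dist (s (k + N)) (s (l + N)) = min 1 (dist (f k) (f l))" for k l
    using len[of "k + N"] len[of "l + N"] by (simp add: dist_seqs_def f_def)
  have "Cauchy f"
    unfolding Cauchy_def
  proof (intro allI impI)
    fix e :: real assume "e > 0"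
    then have "min 1 e > 0" by simp
    then obtain M where M: "\<forall>m\<ge>M. \<forall>k\<ge>M. dist (s m) (s k) < min 1 e"
      using s unfolding Cauchy_def by blast
    have "dist (f m) (f k) < e" if "m \<ge> M" "k \<ge> M" for m k
    proof -
      have "dist (s (m + N)) (s (k + N)) < min 1 e" using M that by simp
      then show ?thesis by (auto simp: dist_f)
    qed
    then show "\<exists>M. \<forall>m\<ge>M. \<forall>k\<ge>M. dist (f m) (f k) < e" by blast
  qed
  then obtain g where g: "f \<longlonglongrightarrow> g"
    using Cauchy_convergent convergent_def by blast
  have ext_g: "g \<in> extensional {i. enat i < n}"
    unfolding extensional_def
  proof (intro CollectI allI impI)
    fix i assume i: "i \<notin> {i. enat i < n}"
    have "isCont (\<lambda>h :: nat \<Rightarrow> 'a. h i) g"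
      by (rule continuous_on_interior[OF continuous_on_product_coordinates]) simp
    then have "(\<lambda>k. f k i) \<longlonglongrightarrow> g i"
      using g by (rule isCont_tendsto_compose)
    moreover have "(\<lambda>k. f k i) = (\<lambda>_. undefined)"
      using ext i by (auto simp: extensional_def)
    ultimately show "g i = undefined"
      using LIMSEQ_unique tendsto_const by metis
  qed
  have "(\<lambda>k. s (k + N)) \<longlonglongrightarrow> Abs_seqs (n, g)"
    unfolding tendsto_iff
  proof (intro allI impI)
    fix e :: real assume "e > 0"
    then have "\<forall>\<^sub>F k in sequentially. dist (f k) g < e"
      using g by (simp add: tendsto_iff)
    then show "\<forall>\<^sub>F k in sequentially. dist (s (k + N)) (Abs_seqs (n, g)) < e"
    proof eventually_elim
      case (elim k)
      then show ?case
        using len[of "k + N"] ext_g by (auto simp: dist_seqs_def seqs_Abs f_def)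
    qed
  qed
  then have "s \<longlonglongrightarrow> Abs_seqs (n, g)"
    by (rule LIMSEQ_offset)
  then show "convergent s" by (auto simp: convergent_def)
qed

instance seqs :: ("{metric_space, second_countable_topology}") second_countable_topology
proof
  obtain C :: "(nat \<Rightarrow> 'a) set set" where C: "countable C" "topological_basis C"
    using ex_countable_basis by blast
  define V where "V n c = {w :: 'a seqs. seq_len w = n \<and> seq_coord w \<in> c}" for n c
  define B where "B = (\<lambda>(n, c). V n c) ` (UNIV \<times> C)"
  have "countable (UNIV :: enat set)"
    by (rule countableI_type)
  then have "countable B"
    unfolding B_def using C by (intro countable_image countable_SIGMA) auto
  moreover have "topological_basis B"
  proof (rule topological_basisI)
    fix b assume "b \<in> B"
    then obtain n c where b: "b = V n c" "c \<in> C" unfolding B_def by auto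
    then have "open c" using C topological_basis_open by blast
    then have "\<exists>T. open T \<and> (\<forall>w. seq_len w = m \<longrightarrow> (w \<in> b \<longleftrightarrow> seq_coord w \<in> T))" for m
      by (intro exI[of _ "if m = n then c else {}"]) (auto simp: b V_def)
    then show "open b" by (simp add: open_seqs_iff)
  next
    fix U :: "'a seqs set" and w
    assume "open U" "w \<in> U"
    then obtain T where T: "open T" "\<forall>v. seq_len v = seq_len w \<longrightarrow> (v \<in> U \<longleftrightarrow> seq_coord v \<in> T)"
      unfolding open_seqs_iff by blast
    then obtain c where c: "c \<in> C" "seq_coord w \<in> c" "c \<subseteq> T"
      using C \<open>w \<in> U\<close> by (metis topological_basisE)
    then have "V (seq_len w) c \<in> B" "w \<in> V (seq_len w) c" "V (seq_len w) c \<subseteq> U"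
      using T by (auto simp: B_def V_def)
    then show "\<exists>B'\<in>B. w \<in> B' \<and> B' \<subseteq> U" by blast
  qed
  ultimately show "\<exists>B :: 'a seqs set set. countable B \<and> open = generate_topology B"
    using topological_basis_imp_subbasis by blast
qed

instance seqs :: (polish_space) polish_space ..

instance prod :: (polish_space, polish_space) polish_space ..

text \<open>Action of a permutation of the coordinates on the component \<open>X\<^sup>n\<close>; the other components are fixed.\<close>

definition permute_coords :: "enat \<Rightarrow> (nat \<Rightarrow> nat) \<Rightarrow> 'a seqs \<Rightarrow> 'a seqs" where
  "permute_coords n \<pi> w = (if seq_len w = n then Abs_seqs (n, seq_coord w \<circ> \<pi>) else w)"

definition symmetric_measure :: "'a::polish_space seqs measure \<Rightarrow> bool" where
  "symmetric_measure \<eta> \<longleftrightarrow>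
    (\<forall>n \<pi>. \<pi> permutes {i. enat i < n} \<longrightarrow> distr \<eta> \<eta> (permute_coords n \<pi>) = \<eta>)"


section \<open>Configurations\<close>

text \<open>
  A generalized configuration is given as a countable family \<open>(y i)\<close>, \<open>i \<in> I\<close>, of points, so
  that multiplicities are retained. It is proper iff it is locally finite and no point has
  multiplicity greater than one, i.e. the family is injective. Proper configurations are
  identified with their sets of points.
\<close>

definition proper_family :: "'i set \<Rightarrow> ('i \<Rightarrow> 'y::polish_space) \<Rightarrow> bool" where
  "proper_family I y \<longleftrightarrow>
    countable I \<and> (\<forall>K. compact K \<longrightarrow> finite {i \<in> I. y i \<in> K}) \<and> inj_on y I"

definition configs :: "'y::polish_space set set" where
  "configs = {\<gamma>. proper_family \<gamma> (\<lambda>y. y)}"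

definition finite_configs :: "'y::polish_space set set" where
  "finite_configs = {\<gamma> \<in> configs. finite \<gamma>}"

definition config_space :: "'y::polish_space set measure" where
  "config_space = sigma configs
    {{\<gamma> \<in> configs. finite (\<gamma> \<inter> B) \<and> card (\<gamma> \<inter> B) = n} | B n. B \<in> sets borel}"


section \<open>Gibbs measures\<close>

definition interaction_potential :: "('y::polish_space set \<Rightarrow> ereal) \<Rightarrow> bool" where
  "interaction_potential \<Phi> \<longleftrightarrow>
    \<Phi> \<in> borel_measurable (restrict_space config_space finite_configs) \<and>
    (\<forall>\<gamma>\<in>finite_configs. \<Phi> \<gamma> \<noteq> -\<infinity>) \<and> \<Phi> {} = 0"

text \<open>
  Reference measures have no atoms: for configurations without multiple points, \<open>\<gamma> \<union> {y}\<close> in the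
  Nguyen--Zessin equation adds a new point only if \<open>y \<notin> \<gamma>\<close>, and so the equation (and the Poisson
  measure on proper configurations behind the DLR equation) is meaningful only if almost
  all \<open>y\<close> have this property. Sigma-finiteness makes product measures available.
\<close>

definition reference_measure :: "'y::polish_space measure \<Rightarrow> bool" where
  "reference_measure \<theta> \<longleftrightarrow>
    sets \<theta> = sets borel \<and> sigma_finite_measure \<theta> \<and> (\<forall>y. emeasure \<theta> {y} = 0)"

text \<open>If one of the terms equals \<open>\<infinity>\<close>, the sum does not converge absolutely.\<close>

definition energy :: "('y::polish_space set \<Rightarrow> ereal) \<Rightarrow> 'y set \<Rightarrow> 'y set \<Rightarrow> ereal" where
  "energy \<Phi> \<xi> \<gamma> =
    (let F = {\<gamma>' \<in> finite_configs. \<gamma>' \<subseteq> \<gamma>} in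
      if (\<forall>\<gamma>'\<in>F. \<bar>\<Phi> (\<xi> \<union> \<gamma>')\<bar> \<noteq> \<infinity>) \<and>
         (\<lambda>\<gamma>'. \<bar>real_of_ereal (\<Phi> (\<xi> \<union> \<gamma>'))\<bar>) summable_on F
      then ereal (\<Sum>\<^sub>\<infinity>\<gamma>'\<in>F. real_of_ereal (\<Phi> (\<xi> \<union> \<gamma>')))
      else \<infinity>)"

text \<open>\<open>exp (- e)\<close> for \<open>e > -\<infinity>\<close>, with \<open>exp (- \<infinity>) = 0\<close>.\<close>

definition exp_neg :: "ereal \<Rightarrow> ennreal" where
  "exp_neg e = (if e = \<infinity> then 0 else ennreal (exp (- real_of_ereal e)))"

text \<open>The integral with respect to \<open>count_space \<gamma>\<close> is the sum over the points of \<open>\<gamma>\<close>.\<close>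

definition nguyen_zessin ::
  "'y::polish_space measure \<Rightarrow> ('y set \<Rightarrow> ereal) \<Rightarrow> 'y set measure \<Rightarrow> bool" where
  "nguyen_zessin \<theta> \<Phi> g \<longleftrightarrow>
    (\<forall>H :: 'y \<times> 'y set \<Rightarrow> real.
      H \<in> borel_measurable (borel \<Otimes>\<^sub>M config_space) \<longrightarrow>
      (\<forall>y. \<forall>\<gamma>\<in>configs. 0 \<le> H (y, \<gamma>)) \<longrightarrow>
      (\<integral>\<^sup>+\<gamma>. (\<integral>\<^sup>+y. ennreal (H (y, \<gamma>)) \<partial>count_space \<gamma>) \<partial>g) =
      (\<integral>\<^sup>+\<gamma>. (\<integral>\<^sup>+y. ennreal (H (y, \<gamma> \<union> {y})) * exp_neg (energy \<Phi> {y} \<gamma>) \<partial>\<theta>) \<partial>g))"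

definition gibbs_measures ::
  "'y::polish_space measure \<Rightarrow> ('y set \<Rightarrow> ereal) \<Rightarrow> 'y set measure set" where
  "gibbs_measures \<theta> \<Phi> =
    {g. reference_measure \<theta> \<and> interaction_potential \<Phi> \<and>
        prob_space g \<and> sets g = sets config_space \<and> nguyen_zessin \<theta> \<Phi> g}"


section \<open>Correlation functions\<close>

text \<open>Points of \<open>Y\<^sup>n\<close> are extensional functions on \<open>{..<n}\<close>.\<close>

abbreviation power_topology :: "nat \<Rightarrow> (nat \<Rightarrow> 'y::topological_space) topology" where
  "power_topology n \<equiv> product_topology (\<lambda>_. euclidean) {..<n}"

definition symmetric_C0 :: "nat \<Rightarrow> ((nat \<Rightarrow> 'y::polish_space) \<Rightarrow> real) set" where
  "symmetric_C0 n = {\<phi>.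
    continuous_map (power_topology n) euclidean \<phi> \<and>
    compactin (power_topology n)
      (power_topology n closure_of {y \<in> topspace (power_topology n). \<phi> y \<noteq> 0}) \<and>
    (\<forall>\<pi>. \<pi> permutes {..<n} \<longrightarrow> (\<forall>y\<in>topspace (power_topology n). \<phi> (y \<circ> \<pi>) = \<phi> y))}"

definition enumeration :: "nat \<Rightarrow> 'y set \<Rightarrow> nat \<Rightarrow> 'y" where
  "enumeration n \<xi> = (SOME y. y \<in> extensional {..<n} \<and> bij_betw y {..<n} \<xi>)"

text \<open>
  For symmetric \<open>\<phi>\<close> the choice of the enumeration is immaterial; for compactly supported
  \<open>\<phi>\<close> and \<open>\<gamma> \<in> configs\<close> only finitely many terms of the sum are nonzero.
\<close>

definition sum_over_subsets :: "nat \<Rightarrow> ((nat \<Rightarrow> 'y) \<Rightarrow> real) \<Rightarrow> 'y set \<Rightarrow> real" where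
  "sum_over_subsets n \<phi> \<gamma> =
    (\<Sum>\<^sub>\<infinity>\<xi>\<in>{\<xi>. \<xi> \<subseteq> \<gamma> \<and> finite \<xi> \<and> card \<xi> = n}. \<phi> (enumeration n \<xi>))"

text \<open>
  Correlation functions are determined only through the defining property (at best up to null
  sets), hence a predicate. Existence of both integrals is part of the property.
\<close>

definition is_correlation_function ::
  "nat \<Rightarrow> 'y::polish_space measure \<Rightarrow> 'y set measure \<Rightarrow> ((nat \<Rightarrow> 'y) \<Rightarrow> real) \<Rightarrow> bool" where
  "is_correlation_function n \<theta> g \<kappa> \<longleftrightarrow>
    (let \<theta>n = (\<Pi>\<^sub>M i\<in>{..<n}. \<theta>) in
      \<kappa> \<in> borel_measurable \<theta>n \<and> (\<forall>y\<in>space \<theta>n. 0 \<le> \<kappa> y) \<and>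
      (\<forall>\<phi>\<in>symmetric_C0 n.
        integrable g (sum_over_subsets n \<phi>) \<and> integrable \<theta>n (\<lambda>y. \<phi> y * \<kappa> y) \<and>
        (\<integral>\<gamma>. sum_over_subsets n \<phi> \<gamma> \<partial>g) = 1 / fact n * (\<integral>y. \<phi> y * \<kappa> y \<partial>\<theta>n)))"


section \<open>Marked configurations\<close>

text \<open>
  Given \<open>\<gamma>\<close>, the marks \<open>y x\<close>, \<open>x \<in> \<gamma>\<close>, are distributed according to the product of copies of \<open>\<eta>\<close>;
  \<open>bind\<close> mixes the resulting conditional distributions over \<open>g\<close>.
\<close>

definition marked_measure ::
  "'x::polish_space seqs measure \<Rightarrow> 'x set measure \<Rightarrow> ('x \<times> 'x seqs) set measure" where
  "marked_measure \<eta> g =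
    bind g (\<lambda>\<gamma>. distr (\<Pi>\<^sub>M x\<in>\<gamma>. \<eta>) config_space (\<lambda>y. (\<lambda>x. (x, y x)) ` \<gamma>))"

definition lifted_potential ::
  "('x::polish_space set \<Rightarrow> ereal) \<Rightarrow> ('x \<times> 'x seqs) set \<Rightarrow> ereal" where
  "lifted_potential \<Phi> \<gamma> = (if proper_family \<gamma> fst then \<Phi> (fst ` \<gamma>) else \<infinity>)"

end

theory Submission
  imports Defs
begin

text \<open>
  Every configuration is a closed discrete set, so a countable base of the topology labels its points
  measurably by natural numbers. Attaching i.i.d. marks to the labels shows that the conditional law
  of the marked configuration given \<open>\<gamma>\<close> is a probability kernel. Averaging a function over the marks
  turns the Nguyen--Zessin equation for the marked measure into the one for \<open>g\<close>: the marks of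
  different points are independent, and the energy of a marked point does not see the marks as long
  as its position is not occupied, which holds almost surely because the reference measure has no atoms.
  In the same way, averaging a symmetric test function over the marks gives a symmetric continuous
  test function with compact support on \<open>X\<^sup>n\<close>, to which the correlation function of \<open>g\<close> applies.
\<close>

section \<open>Measurable labelling of configurations\<close>

text \<open>The obstacle is measurability. The sigma-algebra on configurations knows only the counts
  in Borel sets, whereas sums over points, the energy and the product law of the marks are all
  indexed by the configuration itself. A label is a natural number determined by such counts; after
  relabelling, sums over points or over finite subsets become series over a fixed countable set, and
  the marks become one random sequence.

  The averaged function is the mean of H when a point \<open>x\<close> with its own independent mark
  is added to the marked configuration. It is evaluated at \<open>\<gamma> - {x}\<close> if
  \<open>x\<close> already belongs to \<open>\<gamma>\<close>, so that a single function serves both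
  sides of the Nguyen--Zessin equation. Its values may be infinite, which is why the equation is
  first extended to functions with values in [0, \<infinity>].

  Sums and integrals of nonnegative terms are handled with extended values, where they may be
  exchanged without integrability; signed test functions are recovered from their positive and
  negative parts.\<close>

lemma configs_iff:
  "\<gamma> \<in> configs \<longleftrightarrow> countable \<gamma> \<and> (\<forall>K. compact K \<longrightarrow> finite (\<gamma> \<inter> K))"
proof -
  have "{i \<in> \<gamma>. i \<in> K} = \<gamma> \<inter> K" for K by auto
  then show ?thesis by (simp add: configs_def proper_family_def)
qed

lemma countable_configs: "\<gamma> \<in> configs \<Longrightarrow> countable \<gamma>"
  by (simp add: configs_iff)

lemma configs_subset: "\<gamma> \<in> configs \<Longrightarrow> \<gamma>' \<subseteq> \<gamma> \<Longrightarrow> \<gamma>' \<in> configs"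
  unfolding configs_iff by (meson Int_mono countable_subset finite_subset order_refl)

lemma finite_imp_configs: "finite \<gamma> \<Longrightarrow> \<gamma> \<in> configs"
  by (simp add: configs_iff countable_finite)

lemma configs_insert: "\<gamma> \<in> configs \<Longrightarrow> insert y \<gamma> \<in> configs"
  by (simp add: configs_iff Int_insert_left)

lemma finite_configs_iff: "\<gamma> \<in> finite_configs \<longleftrightarrow> finite \<gamma>"
  by (auto simp: finite_configs_def finite_imp_configs)

text \<open>A convergent sequence together with its limit is compact, so a configuration contains
  only finitely many of its points. A finite range is closed and would contain the limit. The
  argument uses sequences because a Polish space need not be locally compact, so finiteness on
  compact sets says nothing directly about neighbourhoods.\<close>

lemma configs_not_islimpt:
  assumes "\<gamma> \<in> configs"
  shows "\<not> x islimpt \<gamma>"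
proof
  assume "x islimpt \<gamma>"
  then obtain f where f: "\<And>n. f n \<in> \<gamma> - {x}" "f \<longlonglongrightarrow> x"
    unfolding islimpt_sequential by blast
  have "compact (insert x (range f))"
    using compactin_sequence_with_limit[of euclidean f x "range f"] f(2) by simp
  then have "finite (\<gamma> \<inter> insert x (range f))"
    using assms by (simp add: configs_iff)
  moreover have "range f \<subseteq> \<gamma> \<inter> insert x (range f)" using f(1) by auto
  ultimately have "closed (range f)"
    by (meson finite_imp_closed finite_subset)
  then have "x \<in> range f"
    using f(2) closed_sequentially[of "range f" f x] by blast
  then show False using f(1) by auto
qed

text \<open>The base is fixed once for all configurations, so whether an index is a label of
  \<open>\<gamma>\<close> is decided by the counts of \<open>\<gamma>\<close> in fixed Borel
  sets.\<close>

definition base_seq :: "nat \<Rightarrow> 'y::second_countable_topology set" where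
  "base_seq = (SOME U. topological_basis (range U))"

lemma topological_basis_base_seq:
  "topological_basis (range (base_seq :: nat \<Rightarrow> 'y::second_countable_topology set))"
  unfolding base_seq_def
proof (rule someI_ex[where P = "\<lambda>U. topological_basis (range U)"])
  obtain B :: "'y set set" where B: "countable B" "topological_basis B"
    using ex_countable_basis by blast
  have "B \<noteq> {}"
    using topological_basisE[OF B(2) open_UNIV UNIV_I] by blast
  then have "range (from_nat_into B) = B" using B(1) by (rule range_from_nat_into)
  then show "\<exists>U :: nat \<Rightarrow> 'y set. topological_basis (range U)"
    using B(2) by metis
qed

lemma sets_base_seq [measurable]: "base_seq m \<in> sets borel"
  by (rule borel_open) (metis rangeI topological_basis_base_seq topological_basis_open)

lemma configs_isolate:
  assumes "\<gamma> \<in> configs" "x \<in> \<gamma>"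
  shows "\<exists>m. \<gamma> \<inter> base_seq m = {x}"
proof -
  obtain T where T: "open T" "x \<in> T" "\<And>y. y \<in> \<gamma> \<Longrightarrow> y \<in> T \<Longrightarrow> y = x"
    using configs_not_islimpt[OF assms(1), of x] unfolding islimpt_def by blast
  then obtain m where "x \<in> base_seq m" "base_seq m \<subseteq> T"
    using topological_basisE[OF topological_basis_base_seq T(1,2)] by blast
  then show ?thesis using T(3) assms(2) by blast
qed

text \<open>
  Every point of a configuration is isolated in it. It is labelled by the index of the first basic
  open set that contains it and no other point of the configuration.
\<close>

definition labels :: "'y::second_countable_topology set \<Rightarrow> nat set" where
  "labels \<gamma> = {m. (\<exists>x. \<gamma> \<inter> base_seq m = {x}) \<and> (\<forall>k<m. \<gamma> \<inter> base_seq k \<noteq> \<gamma> \<inter> base_seq m)}"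

text \<open>A value is assigned to every index whose base set isolates a point, least or not. Hence
  membership of the value in a Borel set \<open>B\<close> depends only on the counts in
  \<open>base_seq m\<close> and \<open>base_seq m \<inter> B\<close>.\<close>

definition point :: "'y::second_countable_topology set \<Rightarrow> nat \<Rightarrow> 'y" where
  "point \<gamma> m = (if \<exists>x. \<gamma> \<inter> base_seq m = {x} then THE x. \<gamma> \<inter> base_seq m = {x} else undefined)"

lemma point_eq: "\<gamma> \<inter> base_seq m = {x} \<Longrightarrow> point \<gamma> m = x"
  unfolding point_def by auto

lemma Int_base_seq_label: "m \<in> labels \<gamma> \<Longrightarrow> \<gamma> \<inter> base_seq m = {point \<gamma> m}"
  by (auto simp: labels_def point_eq)

text \<open>Injectivity comes from the minimality clause in \<open>labels\<close>: two labels of one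
  point cut out the same trace on \<open>\<gamma>\<close>. Surjectivity is isolation of points
  together with the choice of the least isolating index.\<close>

lemma bij_betw_point:
  assumes "\<gamma> \<in> configs"
  shows "bij_betw (point \<gamma>) (labels \<gamma>) \<gamma>"
  unfolding bij_betw_def
proof
  show "inj_on (point \<gamma>) (labels \<gamma>)"
  proof (rule inj_onI)
    fix m k assume *: "m \<in> labels \<gamma>" "k \<in> labels \<gamma>" "point \<gamma> m = point \<gamma> k"
    then have "\<gamma> \<inter> base_seq m = \<gamma> \<inter> base_seq k"
      by (simp add: Int_base_seq_label)
    then show "m = k"
      using *(1,2) unfolding labels_def by (metis (mono_tags, lifting) linorder_neqE_nat mem_Collect_eq)
  qed
  show "point \<gamma> ` labels \<gamma> = \<gamma>"
  proof (intro equalityI subsetI)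
    fix x assume x: "x \<in> \<gamma>"
    define m where "m = (LEAST m. \<gamma> \<inter> base_seq m = {x})"
    have m: "\<gamma> \<inter> base_seq m = {x}"
      unfolding m_def using configs_isolate[OF assms x] by (rule LeastI_ex)
    have "\<gamma> \<inter> base_seq k \<noteq> {x}" if "k < m" for k
      using that unfolding m_def by (rule not_less_Least)
    then have "m \<in> labels \<gamma>" using m by (auto simp: labels_def)
    then show "x \<in> point \<gamma> ` labels \<gamma>" using point_eq[OF m] by blast
  qed (use Int_base_seq_label in blast)
qed

lemma image_point: "\<gamma> \<in> configs \<Longrightarrow> point \<gamma> ` labels \<gamma> = \<gamma>"
  using bij_betw_point by (auto simp: bij_betw_def)

lemma inj_on_point: "\<gamma> \<in> configs \<Longrightarrow> inj_on (point \<gamma>) (labels \<gamma>)"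
  using bij_betw_point by (auto simp: bij_betw_def)

section \<open>Counting variables and measurable maps into the space of configurations\<close>

abbreviation num_points :: "'y set \<Rightarrow> 'y set \<Rightarrow> ennreal" where
  "num_points B \<gamma> \<equiv> emeasure (count_space UNIV) (\<gamma> \<inter> B)"

lemma emeasure_count_space_eq_of_nat:
  "emeasure (count_space UNIV) A = of_nat n \<longleftrightarrow> finite A \<and> card A = n"
  by (auto simp: emeasure_count_space)

lemma emeasure_count_space_eq_1:
  "emeasure (count_space UNIV) A = 1 \<longleftrightarrow> (\<exists>x. A = {x})"
  using emeasure_count_space_eq_of_nat[of A 1] by (auto simp: card_1_singleton_iff)

lemma space_config_space [simp]: "space config_space = configs"
  unfolding config_space_def by (rule space_measure_of) auto

lemma sets_config_space_card:
  assumes "B \<in> sets borel"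
  shows "{\<gamma> \<in> configs. finite (\<gamma> \<inter> B) \<and> card (\<gamma> \<inter> B) = n} \<in> sets config_space"
  unfolding config_space_def using assms by (intro in_measure_of) auto

lemma measurable_num_points [measurable]:
  assumes "B \<in> sets (borel :: 'y::polish_space measure)"
  shows "num_points B \<in> borel_measurable config_space"
proof -
  define e :: "'y set \<Rightarrow> enat" where "e \<gamma> = (if finite (\<gamma> \<inter> B) then enat (card (\<gamma> \<inter> B)) else \<infinity>)" for \<gamma>
  let ?C = "\<lambda>n. {\<gamma> \<in> configs. finite (\<gamma> \<inter> B) \<and> card (\<gamma> \<inter> B) = n}"
  have "e \<in> config_space \<rightarrow>\<^sub>M count_space UNIV"
  proof (subst measurable_count_space_eq2_countable)
    have "e -` {a} \<inter> space config_space \<in> sets config_space" for a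
    proof (cases a)
      case (enat n)
      then have "e -` {a} \<inter> space config_space = ?C n"
        by (auto simp: e_def split: if_splits)
      then show ?thesis using sets_config_space_card[OF assms] by simp
    next
      case infinity
      \<comment> \<open>The generating events prescribe finite counts only. An infinite count is the
        complement of countably many of them.\<close>
      have "e -` {a} \<inter> space config_space = space config_space - (\<Union>n. ?C n)"
        by (auto simp: e_def infinity)
      also have "\<dots> \<in> sets config_space"
        using sets_config_space_card[OF assms] by (intro sets.Diff sets.top sets.countable_UN) auto
      finally show ?thesis .
    qed
    then show "e \<in> space config_space \<rightarrow> UNIV \<and>
        (\<forall>a\<in>UNIV. e -` {a} \<inter> space config_space \<in> sets config_space)" by simp
  qed
  then have "(\<lambda>\<gamma>. ennreal_of_enat (e \<gamma>)) \<in> borel_measurable config_space"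
    by (rule measurable_compose) simp
  also have "(\<lambda>\<gamma>. ennreal_of_enat (e \<gamma>)) = num_points B"
    by (auto simp: e_def emeasure_count_space fun_eq_iff)
  finally show ?thesis .
qed

lemma measurable_config_spaceI:
  fixes f :: "'a \<Rightarrow> 'y::polish_space set"
  assumes "\<And>\<omega>. \<omega> \<in> space M \<Longrightarrow> f \<omega> \<in> configs"
    and "\<And>B. B \<in> sets borel \<Longrightarrow> (\<lambda>\<omega>. num_points B (f \<omega>)) \<in> borel_measurable M"
  shows "f \<in> M \<rightarrow>\<^sub>M config_space"
  unfolding config_space_def
proof (rule measurable_measure_of)
  fix S :: "'y set set" assume "S \<in> {{\<gamma> \<in> configs. finite (\<gamma> \<inter> B) \<and> card (\<gamma> \<inter> B) = n} |B n. B \<in> sets borel}"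
  then obtain B n where B: "B \<in> sets borel" "S = {\<gamma> \<in> configs. num_points B \<gamma> = of_nat n}"
    by (auto simp: emeasure_count_space_eq_of_nat)
  have "f -` S \<inter> space M = {\<omega> \<in> space M. num_points B (f \<omega>) = of_nat n}"
    using assms(1) by (auto simp: B)
  also have "\<dots> \<in> sets M"
    using assms(2)[OF B(1)] by measurable
  finally show "f -` S \<inter> space M \<in> sets M" .
qed (use assms in auto)

text \<open>The common device for building measurable configurations. Injectivity excludes
  coinciding points, so each count is a series of indicators over the fixed index set of natural
  numbers.\<close>

lemma measurable_config_space_image:
  fixes p :: "'a \<Rightarrow> nat \<Rightarrow> 'y::polish_space"
  assumes "\<And>\<omega>. \<omega> \<in> space M \<Longrightarrow> p \<omega> ` L \<omega> \<in> configs"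
    and inj: "\<And>\<omega>. \<omega> \<in> space M \<Longrightarrow> inj_on (p \<omega>) (L \<omega>)"
    and p [measurable]: "\<And>m. (\<lambda>\<omega>. p \<omega> m) \<in> borel_measurable M"
    and L [measurable]: "\<And>m. Measurable.pred M (\<lambda>\<omega>. m \<in> L \<omega>)"
  shows "(\<lambda>\<omega>. p \<omega> ` L \<omega>) \<in> M \<rightarrow>\<^sub>M config_space"
proof (rule measurable_config_spaceI)
  fix B :: "'y set" assume B [measurable]: "B \<in> sets borel"
  have "num_points B (p \<omega> ` L \<omega>) = (\<Sum>m. if m \<in> L \<omega> \<and> p \<omega> m \<in> B then 1 else 0)"
    if "\<omega> \<in> space M" for \<omega>
  proof -
    have "p \<omega> ` L \<omega> \<inter> B = p \<omega> ` {m \<in> L \<omega>. p \<omega> m \<in> B}" by auto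
    moreover have "inj_on (p \<omega>) {m \<in> L \<omega>. p \<omega> m \<in> B}"
      using inj[OF that] by (rule inj_on_subset) auto
    ultimately have "num_points B (p \<omega> ` L \<omega>) =
        emeasure (count_space UNIV) {m \<in> L \<omega>. p \<omega> m \<in> B}"
      by (simp add: emeasure_count_space card_image finite_image_iff)
    also have "\<dots> = (\<integral>\<^sup>+m. indicator {m \<in> L \<omega>. p \<omega> m \<in> B} m \<partial>count_space UNIV)"
      by simp
    also have "\<dots> = (\<Sum>m. if m \<in> L \<omega> \<and> p \<omega> m \<in> B then 1 else 0)"
      by (subst nn_integral_count_space_nat) (auto simp: indicator_def intro!: arg_cong[where f=suminf])
    finally show ?thesis .
  qed
  moreover have "(\<lambda>\<omega>. \<Sum>m. if m \<in> L \<omega> \<and> p \<omega> m \<in> B then 1 else 0 :: ennreal) \<in> borel_measurable M"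
    by measurable
  ultimately show "(\<lambda>\<omega>. num_points B (p \<omega> ` L \<omega>)) \<in> borel_measurable M"
    by (simp cong: measurable_cong)
qed (use assms in auto)

lemma pred_labels [measurable]:
  "Measurable.pred (config_space :: 'y::polish_space set measure) (\<lambda>\<gamma>. m \<in> labels \<gamma>)"
proof -
  \<comment> \<open>Two base sets have different traces on \<open>\<gamma>\<close> exactly if their
    symmetric difference contains a point of \<open>\<gamma>\<close>, which is a statement about a
    count.\<close>
  let ?D = "\<lambda>k. (base_seq k - base_seq m) \<union> (base_seq m - base_seq k) :: 'y set"
  have "m \<in> labels \<gamma> \<longleftrightarrow> num_points (base_seq m) \<gamma> = 1 \<and> (\<forall>k\<in>{..<m}. num_points (?D k) \<gamma> \<noteq> 0)"
    for \<gamma> :: "'y set"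
  proof -
    have "\<gamma> \<inter> base_seq k \<noteq> \<gamma> \<inter> base_seq m \<longleftrightarrow> num_points (?D k) \<gamma> \<noteq> 0" for k
      by (subst emeasure_count_space_eq_0) auto
    then show ?thesis
      unfolding labels_def emeasure_count_space_eq_1 by auto
  qed
  moreover have "Measurable.pred config_space
    (\<lambda>\<gamma> :: 'y set. num_points (base_seq m) \<gamma> = 1 \<and> (\<forall>k\<in>{..<m}. num_points (?D k) \<gamma> \<noteq> 0))"
    by measurable
  ultimately show ?thesis by simp
qed

lemma measurable_point [measurable]:
  "(\<lambda>\<gamma>. point \<gamma> m) \<in> borel_measurable (config_space :: 'y::polish_space set measure)"
proof (rule measurableI)
  fix B :: "'y set" assume B [measurable]: "B \<in> sets borel"
  \<comment> \<open>If \<open>base_seq m\<close> isolates one point, that point lies in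
    \<open>B\<close> iff the part of the base set inside \<open>B\<close> is occupied. Otherwise the
    value is the constant default.\<close>
  have "point \<gamma> m \<in> B \<longleftrightarrow>
      (if num_points (base_seq m) \<gamma> = 1 then num_points (base_seq m \<inter> B) \<gamma> \<noteq> 0 else undefined \<in> B)"
    for \<gamma>
  proof (cases "\<exists>x. \<gamma> \<inter> base_seq m = {x}")
    case True
    then obtain x where x: "\<gamma> \<inter> base_seq m = {x}" by blast
    then have "num_points (base_seq m) \<gamma> = 1" by (simp add: emeasure_count_space_eq_1)
    moreover have "num_points (base_seq m \<inter> B) \<gamma> \<noteq> 0 \<longleftrightarrow> x \<in> B"
      using x by (subst emeasure_count_space_eq_0) auto
    ultimately show ?thesis using point_eq[OF x] by simp
  next
    case False
    then show ?thesis by (simp add: emeasure_count_space_eq_1 point_def)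
  qed
  then have "(\<lambda>\<gamma>. point \<gamma> m) -` B \<inter> space config_space = {\<gamma> \<in> space config_space.
      if num_points (base_seq m) \<gamma> = 1 then num_points (base_seq m \<inter> B) \<gamma> \<noteq> 0 else undefined \<in> B}"
    by auto
  also have "\<dots> \<in> sets config_space" by measurable
  finally show "(\<lambda>\<gamma>. point \<gamma> m) -` B \<inter> space config_space \<in> sets config_space" .
qed auto

text \<open>Replaces the index set that moves with \<open>\<gamma>\<close> by the natural numbers,
  so that sums over points are measurable as countable series.\<close>

lemma nn_integral_count_space_labels:
  assumes "\<gamma> \<in> configs"
  shows "(\<integral>\<^sup>+y. f y \<partial>count_space \<gamma>) = (\<Sum>m. if m \<in> labels \<gamma> then f (point \<gamma> m) else 0)"
proof -
  have "(\<integral>\<^sup>+y. f y \<partial>count_space \<gamma>) = (\<integral>\<^sup>+m. f (point \<gamma> m) \<partial>count_space (labels \<gamma>))"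
    by (rule nn_integral_bij_count_space[OF bij_betw_point[OF assms], symmetric])
  also have "\<dots> = (\<integral>\<^sup>+m. f (point \<gamma> m) * indicator (labels \<gamma>) m \<partial>count_space UNIV)"
    by (rule nn_integral_count_space_indicator) simp
  also have "\<dots> = (\<Sum>m. f (point \<gamma> m) * indicator (labels \<gamma>) m)"
    by (rule nn_integral_count_space_nat)
  also have "\<dots> = (\<Sum>m. if m \<in> labels \<gamma> then f (point \<gamma> m) else 0)"
    by (intro arg_cong[where f=suminf] ext) simp
  finally show ?thesis .
qed

lemma measurable_sum_points:
  assumes [measurable]: "H \<in> borel_measurable (borel \<Otimes>\<^sub>M config_space)"
  shows "(\<lambda>\<gamma>. \<integral>\<^sup>+y. H (y, \<gamma>) \<partial>count_space \<gamma>) \<in> borel_measurable config_space"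
proof -
  have "(\<lambda>\<gamma>. \<Sum>m. if m \<in> labels \<gamma> then H (point \<gamma> m, \<gamma>) else 0) \<in> borel_measurable config_space"
    by measurable
  then show ?thesis
    by (rule measurable_cong[THEN iffD1, rotated]) (simp add: nn_integral_count_space_labels)
qed

lemma pred_mem_config [measurable]:
  "Measurable.pred (borel \<Otimes>\<^sub>M config_space) (\<lambda>(y :: 'y::polish_space, \<gamma>). y \<in> \<gamma>)"
proof -
  have *: "Measurable.pred (borel \<Otimes>\<^sub>M config_space)
      (\<lambda>(y :: 'y, \<gamma>). \<exists>m. m \<in> labels \<gamma> \<and> y = point \<gamma> m)"
    by measurable
  have "y \<in> \<gamma> \<longleftrightarrow> (\<exists>m. m \<in> labels \<gamma> \<and> y = point \<gamma> m)" if "\<gamma> \<in> configs" for y :: 'y and \<gamma>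
    using image_point[OF that] by auto
  then show ?thesis
    by (intro measurable_cong[THEN iffD1, OF _ *]) (auto simp: space_pair_measure)
qed

lemma measurable_insert_config [measurable]:
  "(\<lambda>(y :: 'y::polish_space, \<gamma>). insert y \<gamma>) \<in> borel \<Otimes>\<^sub>M config_space \<rightarrow>\<^sub>M config_space"
proof (rule measurable_config_spaceI)
  fix B :: "'y set" assume [measurable]: "B \<in> sets borel"
  \<comment> \<open>The count increases only for a new point; this is why measurability of the
    membership relation has to be available first.\<close>
  have "num_points B (insert y \<gamma>) =
      (if y \<in> \<gamma> then num_points B \<gamma> else num_points B \<gamma> + indicator B y)" for y \<gamma>
  proof (cases "y \<in> \<gamma> \<or> y \<notin> B")
    case True
    then show ?thesis by (auto simp: insert_absorb)
  next
    case False
    then show ?thesis by (simp add: Int_insert_left emeasure_count_space add.commute)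
  qed
  moreover have "(\<lambda>(y, \<gamma>). if y \<in> \<gamma> then num_points B \<gamma> else num_points B \<gamma> + indicator B y)
      \<in> borel_measurable (borel \<Otimes>\<^sub>M config_space)"
    by measurable
  ultimately show "(\<lambda>\<omega>. num_points B (case \<omega> of (y, \<gamma>) \<Rightarrow> insert y \<gamma>))
      \<in> borel_measurable (borel \<Otimes>\<^sub>M config_space)"
    by (simp add: split_beta')
qed (auto simp: space_pair_measure configs_insert)

lemma measurable_remove_config [measurable]:
  "(\<lambda>(y :: 'y::polish_space, \<gamma>). \<gamma> - {y}) \<in> borel \<Otimes>\<^sub>M config_space \<rightarrow>\<^sub>M config_space"
proof -
  \<comment> \<open>The surviving points keep the labels that they have in the full
    configuration.\<close>
  let ?L = "\<lambda>(y :: 'y, \<gamma>). {m \<in> labels \<gamma>. point \<gamma> m \<noteq> y}"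
  have eq: "point \<gamma> ` ?L (y, \<gamma>) = \<gamma> - {y}" if "\<gamma> \<in> configs" for y \<gamma>
    using image_point[OF that] by auto
  have *: "(\<lambda>\<omega>. point (snd \<omega>) ` ?L \<omega>) \<in> borel \<Otimes>\<^sub>M config_space \<rightarrow>\<^sub>M config_space"
  proof (rule measurable_config_space_image)
    fix \<omega> :: "'y \<times> 'y set" assume \<omega>: "\<omega> \<in> space (borel \<Otimes>\<^sub>M config_space)"
    then have \<gamma>: "snd \<omega> \<in> configs" by (auto simp: space_pair_measure)
    show "point (snd \<omega>) ` ?L \<omega> \<in> configs"
      using eq[OF \<gamma>, of "fst \<omega>"] configs_subset[OF \<gamma>, of "snd \<omega> - {fst \<omega>}"] by auto
    show "inj_on (point (snd \<omega>)) (?L \<omega>)"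
      by (rule inj_on_subset[OF inj_on_point[OF \<gamma>]]) auto
  next
    fix m
    have "(\<lambda>\<omega>. m \<in> (case \<omega> of (y :: 'y, \<gamma>) \<Rightarrow> {m \<in> labels \<gamma>. point \<gamma> m \<noteq> y})) =
      (\<lambda>\<omega>. m \<in> labels (snd \<omega>) \<and> point (snd \<omega>) m \<noteq> fst \<omega>)" by auto
    then show "Measurable.pred (borel \<Otimes>\<^sub>M config_space) (\<lambda>\<omega> :: 'y \<times> 'y set. m \<in> ?L \<omega>)"
      by simp
  qed measurable
  have "point (snd \<omega>) ` ?L \<omega> = (\<lambda>(y, \<gamma>). \<gamma> - {y}) \<omega>"
    if "\<omega> \<in> space (borel \<Otimes>\<^sub>M config_space)" for \<omega>
    using that eq[of "snd \<omega>" "fst \<omega>"] by (cases \<omega>) (simp add: space_pair_measure)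
  then show ?thesis
    by (rule measurable_cong[THEN iffD1, OF _ *])
qed

section \<open>Measurability of the interaction energy\<close>

lemma bij_betw_image_finite_configs:
  fixes f :: "'i \<Rightarrow> 'y::polish_space"
  assumes "bij_betw f L \<gamma>"
  shows "bij_betw ((`) f) (Fpow L) {\<gamma>' \<in> finite_configs. \<gamma>' \<subseteq> \<gamma>}"
proof -
  have "inj_on ((`) f) (Fpow L)"
    by (rule inj_on_subset[OF inj_on_image_Pow]) (use assms in \<open>auto simp: Fpow_def bij_betw_def\<close>)
  moreover have "(`) f ` Fpow L = {\<gamma>' \<in> finite_configs. \<gamma>' \<subseteq> \<gamma>}"
  proof (intro equalityI subsetI)
    fix \<gamma>' assume "\<gamma>' \<in> {\<gamma>' \<in> finite_configs. \<gamma>' \<subseteq> \<gamma>}"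
    then have "finite \<gamma>'" "\<gamma>' \<subseteq> f ` L"
      using assms by (auto simp: finite_configs_iff bij_betw_def)
    then obtain S where "S \<subseteq> L" "finite S" "\<gamma>' = f ` S"
      by (meson finite_subset_image)
    then show "\<gamma>' \<in> (`) f ` Fpow L" by (auto simp: Fpow_def)
  qed (use assms in \<open>auto simp: Fpow_def finite_configs_iff bij_betw_def\<close>)
  ultimately show ?thesis by (simp add: bij_betw_def)
qed

text \<open>The index family is left free because it is used in two ways: with the labelling, to
  make the energy measurable, and with the marking map, to compare marked and unmarked
  energies.\<close>

lemma energy_reindex:
  fixes f :: "'i \<Rightarrow> 'y::polish_space"
  assumes "bij_betw f L \<gamma>"
  shows "energy \<Phi> \<xi> \<gamma> =
    (if (\<forall>S\<in>Fpow L. \<bar>\<Phi> (\<xi> \<union> f ` S)\<bar> \<noteq> \<infinity>) \<and>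
        (\<lambda>S. \<bar>real_of_ereal (\<Phi> (\<xi> \<union> f ` S))\<bar>) summable_on Fpow L
     then ereal (\<Sum>\<^sub>\<infinity>S\<in>Fpow L. real_of_ereal (\<Phi> (\<xi> \<union> f ` S)))
     else \<infinity>)"
proof -
  note bij = bij_betw_image_finite_configs[OF assms]
  have "(\<forall>\<gamma>'\<in>{\<gamma>' \<in> finite_configs. \<gamma>' \<subseteq> \<gamma>}. \<bar>\<Phi> (\<xi> \<union> \<gamma>')\<bar> \<noteq> \<infinity>) \<longleftrightarrow>
      (\<forall>S\<in>Fpow L. \<bar>\<Phi> (\<xi> \<union> f ` S)\<bar> \<noteq> \<infinity>)"
    using bij by (metis (no_types, lifting) bij_betw_apply bij_betw_imp_surj_on imageE)
  then show ?thesis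
    unfolding energy_def Let_def
      summable_on_reindex_bij_betw[OF bij, of "\<lambda>\<gamma>'. \<bar>real_of_ereal (\<Phi> (\<xi> \<union> \<gamma>'))\<bar>", symmetric]
      infsum_reindex_bij_betw[OF bij, of "\<lambda>\<gamma>'. real_of_ereal (\<Phi> (\<xi> \<union> \<gamma>'))", symmetric]
    by simp
qed

text \<open>Binary expansion codes finite sets of labels by natural numbers, which turns sums over
  finite subconfigurations into ordinary series.\<close>

lemma bij_betw_set_decode: "bij_betw set_decode {k. set_decode k \<subseteq> L} (Fpow L)"
  by (rule bij_betwI[where g = set_encode]) (auto simp: Fpow_def)

lemma infsum_nat_eq_suminf:
  fixes f :: "nat \<Rightarrow> real"
  assumes "summable (\<lambda>n. \<bar>f n\<bar>)"
  shows "infsum f UNIV = suminf f"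
  using assms by (intro infsumI norm_summable_imp_has_sum)
    (auto intro: summable_rabs_cancel summable_sums)

text \<open>Expresses convergence through the value of a series in \<open>ennreal\<close>, hence as
  a measurable condition when the terms depend measurably on a parameter.\<close>

lemma summable_iff_suminf_ennreal:
  assumes "\<And>n. 0 \<le> f n"
  shows "summable f \<longleftrightarrow> (\<Sum>n. ennreal (f n)) \<noteq> \<top>"
proof
  assume "summable f"
  then have "(\<Sum>n. ennreal (f n)) = ennreal (\<Sum>n. f n)"
    using assms by (intro suminf_ennreal2)
  then show "(\<Sum>n. ennreal (f n)) \<noteq> \<top>" by simp
qed (use assms in \<open>rule summable_suminf_not_top\<close>)

text \<open>Codes that are not contained in the label set contribute zero terms, so both the
  convergence test and the sum run over all natural numbers and involve only countable
  operations.\<close>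

lemma energy_labels:
  fixes \<gamma> \<xi> :: "'y::polish_space set" and \<Phi> :: "'y set \<Rightarrow> ereal"
  assumes "\<gamma> \<in> configs"
  defines "b \<equiv> \<lambda>k. if set_decode k \<subseteq> labels \<gamma>
    then real_of_ereal (\<Phi> (\<xi> \<union> point \<gamma> ` set_decode k)) else 0"
  shows "energy \<Phi> \<xi> \<gamma> =
    (if (\<forall>k. set_decode k \<subseteq> labels \<gamma> \<longrightarrow> \<bar>\<Phi> (\<xi> \<union> point \<gamma> ` set_decode k)\<bar> \<noteq> \<infinity>) \<and>
        (\<Sum>k. ennreal \<bar>b k\<bar>) \<noteq> \<top>
     then ereal (\<Sum>k. b k) else \<infinity>)"
proof -
  let ?L = "{k. set_decode k \<subseteq> labels \<gamma>}"
  note bij = bij_betw_set_decode[of "labels \<gamma>"]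
  have fin: "(\<forall>S\<in>Fpow (labels \<gamma>). \<bar>\<Phi> (\<xi> \<union> point \<gamma> ` S)\<bar> \<noteq> \<infinity>) \<longleftrightarrow>
      (\<forall>k. set_decode k \<subseteq> labels \<gamma> \<longrightarrow> \<bar>\<Phi> (\<xi> \<union> point \<gamma> ` set_decode k)\<bar> \<noteq> \<infinity>)"
    using bij by (metis (no_types, lifting) bij_betw_apply bij_betw_imp_surj_on imageE mem_Collect_eq)
  have "(\<lambda>S. \<bar>real_of_ereal (\<Phi> (\<xi> \<union> point \<gamma> ` S))\<bar>) summable_on Fpow (labels \<gamma>) \<longleftrightarrow>
      (\<lambda>k. \<bar>real_of_ereal (\<Phi> (\<xi> \<union> point \<gamma> ` set_decode k))\<bar>) summable_on ?L"
    by (rule summable_on_reindex_bij_betw[OF bij, symmetric])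
  also have "\<dots> \<longleftrightarrow> (\<lambda>k. \<bar>b k\<bar>) summable_on UNIV"
    by (rule summable_on_cong_neutral) (auto simp: b_def)
  also have "\<dots> \<longleftrightarrow> summable (\<lambda>k. \<bar>b k\<bar>)"
    by (simp add: summable_on_UNIV_nonneg_real_iff)
  finally have summ: "(\<lambda>S. \<bar>real_of_ereal (\<Phi> (\<xi> \<union> point \<gamma> ` S))\<bar>) summable_on Fpow (labels \<gamma>) \<longleftrightarrow>
    summable (\<lambda>k. \<bar>b k\<bar>)" .
  have top: "summable (\<lambda>k. \<bar>b k\<bar>) \<longleftrightarrow> (\<Sum>k. ennreal \<bar>b k\<bar>) \<noteq> \<top>"
    by (rule summable_iff_suminf_ennreal) simp
  have "(\<Sum>\<^sub>\<infinity>S\<in>Fpow (labels \<gamma>). real_of_ereal (\<Phi> (\<xi> \<union> point \<gamma> ` S))) =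
      (\<Sum>\<^sub>\<infinity>k\<in>?L. real_of_ereal (\<Phi> (\<xi> \<union> point \<gamma> ` set_decode k)))"
    by (rule infsum_reindex_bij_betw[OF bij, symmetric])
  also have "\<dots> = infsum b UNIV"
    by (rule infsum_cong_neutral) (auto simp: b_def)
  finally have "(\<Sum>\<^sub>\<infinity>S\<in>Fpow (labels \<gamma>). real_of_ereal (\<Phi> (\<xi> \<union> point \<gamma> ` S))) = infsum b UNIV" .
  then show ?thesis
    unfolding energy_reindex[OF bij_betw_point[OF assms(1)]] fin summ
    using infsum_nat_eq_suminf[of b] by (simp add: top)
qed

lemma measurable_energy:
  fixes \<Phi> :: "'y::polish_space set \<Rightarrow> ereal"
  assumes "interaction_potential \<Phi>"
  shows "(\<lambda>(y, \<gamma>). energy \<Phi> {y} \<gamma>) \<in> borel_measurable (borel \<Otimes>\<^sub>M config_space)"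
proof -
  let ?M = "borel \<Otimes>\<^sub>M config_space :: ('y \<times> 'y set) measure"
  \<comment> \<open>Intersecting with the label set keeps the chosen points distinct for every
    configuration, as \<open>measurable_config_space_image\<close> demands, and changes nothing when
    the coded set consists of labels. Finiteness matters because \<open>\<Phi>\<close> is measurable
    only on finite configurations.\<close>
  define A where "A k \<omega> = insert (fst \<omega>) (point (snd \<omega>) ` (set_decode k \<inter> labels (snd \<omega>)))"
    for k and \<omega> :: "'y \<times> 'y set"
  have fin: "finite (A k \<omega>)" for k \<omega>
    by (simp add: A_def)
  have "(\<lambda>\<omega>. point (snd \<omega>) ` (set_decode k \<inter> labels (snd \<omega>))) \<in> ?M \<rightarrow>\<^sub>M config_space" for k
  proof (rule measurable_config_space_image)
    fix \<omega> assume "\<omega> \<in> space ?M"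
    then have "snd \<omega> \<in> configs" by (auto simp: space_pair_measure)
    then show "inj_on (point (snd \<omega>)) (set_decode k \<inter> labels (snd \<omega>))"
      by (intro inj_on_subset[OF inj_on_point]) auto
    show "point (snd \<omega>) ` (set_decode k \<inter> labels (snd \<omega>)) \<in> configs"
      by (simp add: finite_imp_configs)
  next
    fix m
    show "Measurable.pred ?M (\<lambda>\<omega>. m \<in> set_decode k \<inter> labels (snd \<omega>))"
      by simp
  qed measurable
  then have A: "A k \<in> ?M \<rightarrow>\<^sub>M config_space" for k
    using measurable_compose[OF measurable_Pair[OF measurable_fst] measurable_insert_config]
    unfolding A_def by simp
  have "A k \<in> ?M \<rightarrow>\<^sub>M restrict_space config_space finite_configs" for k
    by (rule measurable_restrict_space2[OF _ A]) (simp add: finite_configs_iff fin)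
  then have [measurable]: "(\<lambda>\<omega>. \<Phi> (A k \<omega>)) \<in> borel_measurable ?M" for k
    using assms measurable_compose unfolding interaction_potential_def by blast
  \<comment> \<open>Inclusion in the label set is written as a finite conjunction, so that it
    inherits measurability from \<open>pred_labels\<close>.\<close>
  define P where "P k \<omega> \<longleftrightarrow> (\<forall>m\<in>set_decode k. m \<in> labels (snd \<omega>))" for k and \<omega> :: "'y \<times> 'y set"
  have [measurable]: "Measurable.pred ?M (P k)" for k
    unfolding P_def by measurable
  let ?b = "\<lambda>\<omega> k. if P k \<omega> then real_of_ereal (\<Phi> (A k \<omega>)) else 0"
  have *: "(\<lambda>\<omega>. if (\<forall>k. P k \<omega> \<longrightarrow> \<bar>\<Phi> (A k \<omega>)\<bar> \<noteq> \<infinity>) \<and> (\<Sum>k. ennreal \<bar>?b \<omega> k\<bar>) \<noteq> \<top>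
    then ereal (\<Sum>k. ?b \<omega> k) else \<infinity>) \<in> borel_measurable ?M"
    by measurable
  show ?thesis
  proof (rule measurable_cong[THEN iffD1, OF _ *])
    fix \<omega> assume "\<omega> \<in> space ?M"
    then have \<gamma>: "snd \<omega> \<in> configs" by (auto simp: space_pair_measure)
    have P: "P k \<omega> \<longleftrightarrow> set_decode k \<subseteq> labels (snd \<omega>)" for k
      by (auto simp: P_def)
    have "A k \<omega> = {fst \<omega>} \<union> point (snd \<omega>) ` set_decode k" if "P k \<omega>" for k
      using that unfolding P A_def by (simp add: Int_absorb2)
    then show "(if (\<forall>k. P k \<omega> \<longrightarrow> \<bar>\<Phi> (A k \<omega>)\<bar> \<noteq> \<infinity>) \<and> (\<Sum>k. ennreal \<bar>?b \<omega> k\<bar>) \<noteq> \<top>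
      then ereal (\<Sum>k. ?b \<omega> k) else \<infinity>) = (case \<omega> of (y, \<gamma>) \<Rightarrow> energy \<Phi> {y} \<gamma>)"
      unfolding split_beta energy_labels[OF \<gamma>] P[symmetric] by (simp cong: if_cong)
  qed
qed

lemma measurable_exp_neg [measurable]: "exp_neg \<in> borel_measurable borel"
  unfolding exp_neg_def[abs_def] by measurable

lemma measurable_boltzmann:
  assumes "interaction_potential \<Phi>"
  shows "(\<lambda>(y, \<gamma>). exp_neg (energy \<Phi> {y} \<gamma>)) \<in> borel_measurable (borel \<Otimes>\<^sub>M config_space)"
  using measurable_compose[OF measurable_energy[OF assms] measurable_exp_neg] by (simp add: split_beta')

text \<open>The defining equation speaks of real-valued functions only, whereas an average over
  marks may be infinite. Truncation and monotone convergence on both sides close the gap.\<close>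

lemma nguyen_zessin_ennreal:
  fixes g :: "'y::polish_space set measure" and H :: "'y \<times> 'y set \<Rightarrow> ennreal"
  assumes g: "g \<in> gibbs_measures \<theta> \<Phi>"
    and H [measurable]: "H \<in> borel_measurable (borel \<Otimes>\<^sub>M config_space)"
  shows "(\<integral>\<^sup>+\<gamma>. (\<integral>\<^sup>+y. H (y, \<gamma>) \<partial>count_space \<gamma>) \<partial>g) =
    (\<integral>\<^sup>+\<gamma>. (\<integral>\<^sup>+y. H (y, insert y \<gamma>) * exp_neg (energy \<Phi> {y} \<gamma>) \<partial>\<theta>) \<partial>g)"
proof -
  have pot: "interaction_potential \<Phi>" and sets_g [measurable_cong]: "sets g = sets config_space"
    and sets_\<theta> [measurable_cong]: "sets \<theta> = sets borel"
    and sf: "sigma_finite_measure \<theta>" and nz: "nguyen_zessin \<theta> \<Phi> g"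
    using g by (auto simp: gibbs_measures_def reference_measure_def)
  interpret sigma_finite_measure \<theta> by (fact sf)
  have space_g: "space g = configs"
    using sets_eq_imp_space_eq[OF sets_g] by simp
  note [measurable] = measurable_boltzmann[OF pot]
  \<comment> \<open>Truncation at level \<open>k\<close> gives finite values that increase to
    \<open>H\<close> as \<open>k\<close> grows.\<close>
  define H' :: "nat \<Rightarrow> 'y \<times> 'y set \<Rightarrow> ennreal" where "H' k z = min (H z) (of_nat k)" for k z
  have H' [measurable]: "H' k \<in> borel_measurable (borel \<Otimes>\<^sub>M config_space)" for k
    unfolding H'_def[abs_def] by measurable
  have SUP: "(SUP k. H' k z) = H z" for z
    by (simp add: H'_def inf_min[symmetric] inf_SUP[symmetric] ennreal_SUP_of_nat_eq_top)
  have inc: "H' k z \<le> H' (Suc k) z" for k z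
    unfolding H'_def by (intro min.mono) auto
  have insert_H' [measurable]: "(\<lambda>(y, \<gamma>). H' k (y, insert y \<gamma>)) \<in> borel_measurable (borel \<Otimes>\<^sub>M config_space)" for k
    by measurable
  have eq: "(\<integral>\<^sup>+\<gamma>. (\<integral>\<^sup>+y. H' k (y, \<gamma>) \<partial>count_space \<gamma>) \<partial>g) =
    (\<integral>\<^sup>+\<gamma>. (\<integral>\<^sup>+y. H' k (y, insert y \<gamma>) * exp_neg (energy \<Phi> {y} \<gamma>) \<partial>\<theta>) \<partial>g)" for k
  proof -
    have "H' k z < \<top>" for z
      using le_less_trans[OF min.cobounded2 of_nat_less_top] by (simp add: H'_def)
    then have "ennreal (enn2real (H' k z)) = H' k z" for z
      by simp
    moreover have "(\<lambda>z. enn2real (H' k z)) \<in> borel_measurable (borel \<Otimes>\<^sub>M config_space)"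
      by measurable
    ultimately show ?thesis
      using nz[unfolded nguyen_zessin_def, rule_format, of "\<lambda>z. enn2real (H' k z)"] by simp
  qed
  have "(\<integral>\<^sup>+\<gamma>. (\<integral>\<^sup>+y. H (y, \<gamma>) \<partial>count_space \<gamma>) \<partial>g) =
      (\<integral>\<^sup>+\<gamma>. (SUP k. \<integral>\<^sup>+y. H' k (y, \<gamma>) \<partial>count_space \<gamma>) \<partial>g)"
    unfolding SUP[symmetric]
    by (intro nn_integral_cong nn_integral_monotone_convergence_SUP incseq_SucI le_funI inc) simp
  also have "\<dots> = (SUP k. \<integral>\<^sup>+\<gamma>. (\<integral>\<^sup>+y. H' k (y, \<gamma>) \<partial>count_space \<gamma>) \<partial>g)"
    using measurable_sum_points[OF H']
    by (intro nn_integral_monotone_convergence_SUP incseq_SucI le_funI nn_integral_mono inc)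
      (simp cong: measurable_cong_sets add: sets_g)
  also have "\<dots> = (SUP k. \<integral>\<^sup>+\<gamma>. (\<integral>\<^sup>+y. H' k (y, insert y \<gamma>) * exp_neg (energy \<Phi> {y} \<gamma>) \<partial>\<theta>) \<partial>g)"
    by (simp add: eq)
  also have "\<dots> = (\<integral>\<^sup>+\<gamma>. (SUP k. \<integral>\<^sup>+y. H' k (y, insert y \<gamma>) * exp_neg (energy \<Phi> {y} \<gamma>) \<partial>\<theta>) \<partial>g)"
  proof (intro nn_integral_monotone_convergence_SUP[symmetric] incseq_SucI le_funI nn_integral_mono
        mult_right_mono inc)
    fix k
    show "(\<lambda>\<gamma>. \<integral>\<^sup>+y. H' k (y, insert y \<gamma>) * exp_neg (energy \<Phi> {y} \<gamma>) \<partial>\<theta>) \<in> borel_measurable g"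
      by measurable
  qed simp
  also have "\<dots> = (\<integral>\<^sup>+\<gamma>. (\<integral>\<^sup>+y. (SUP k. H' k (y, insert y \<gamma>) * exp_neg (energy \<Phi> {y} \<gamma>)) \<partial>\<theta>) \<partial>g)"
  proof (intro nn_integral_cong nn_integral_monotone_convergence_SUP[symmetric] incseq_SucI le_funI
        mult_right_mono inc)
    fix \<gamma> k assume "\<gamma> \<in> space g"
    then have [measurable]: "(\<lambda>y. (y, \<gamma>)) \<in> \<theta> \<rightarrow>\<^sub>M borel \<Otimes>\<^sub>M config_space"
      by (auto simp: space_g)
    have "(\<lambda>y. case (y, \<gamma>) of (y, \<gamma>) \<Rightarrow> H' k (y, insert y \<gamma>) * exp_neg (energy \<Phi> {y} \<gamma>)) \<in> borel_measurable \<theta>"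
      by measurable
    then show "(\<lambda>y. H' k (y, insert y \<gamma>) * exp_neg (energy \<Phi> {y} \<gamma>)) \<in> borel_measurable \<theta>"
      by simp
  qed simp
  finally show ?thesis
    by (simp add: SUP SUP_mult_right_ennreal[symmetric])
qed

section \<open>Marked configurations\<close>

definition mark :: "'x set \<Rightarrow> ('x \<Rightarrow> 'v) \<Rightarrow> ('x \<times> 'v) set" where
  "mark \<gamma> u = (\<lambda>x. (x, u x)) ` \<gamma>"

lemma bij_betw_mark: "bij_betw (\<lambda>x. (x, u x)) \<gamma> (mark \<gamma> u)"
  unfolding mark_def by (intro bij_betw_imageI inj_onI) auto

text \<open>The projection of a compact set to the positions is compact and therefore meets
  \<open>\<gamma>\<close> in finitely many points, each of which carries a single mark. The marks
  themselves are arbitrary.\<close>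

lemma mark_in_configs:
  fixes \<gamma> :: "'x::polish_space set" and u :: "'x \<Rightarrow> 'v::polish_space"
  assumes "\<gamma> \<in> configs"
  shows "mark \<gamma> u \<in> configs"
  unfolding configs_iff
proof (intro conjI allI impI)
  show "countable (mark \<gamma> u)"
    using countable_configs[OF assms] by (simp add: mark_def)
  fix K :: "('x \<times> 'v) set" assume "compact K"
  then have "compact (fst ` K)"
    by (intro compact_continuous_image continuous_intros)
  then have "finite (\<gamma> \<inter> fst ` K)"
    using assms by (simp add: configs_iff)
  then show "finite (mark \<gamma> u \<inter> K)"
    by (rule finite_surj[where f = "\<lambda>x. (x, u x)"]) (force simp: mark_def)
qed

lemma proper_family_finite: "finite I \<Longrightarrow> proper_family I f \<longleftrightarrow> inj_on f I"
  by (simp add: proper_family_def countable_finite)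

lemma measurable_fst_point [measurable]:
  "(\<lambda>\<gamma> :: ('x::polish_space \<times> 'v::polish_space) set. fst (point \<gamma> m)) \<in> borel_measurable config_space"
  by (intro measurable_compose[OF measurable_point] borel_measurable_continuous_onI continuous_intros)

text \<open>Absence of multiple positions is a condition on all pairs of labels, hence a countable
  conjunction.\<close>

lemma pred_inj_on_fst [measurable]:
  "Measurable.pred config_space (\<lambda>\<gamma> :: ('x::polish_space \<times> 'v::polish_space) set. inj_on fst \<gamma>)"
proof -
  have [measurable]: "Measurable.pred config_space (\<lambda>\<gamma> :: ('x \<times> 'v) set.
      m \<in> labels \<gamma> \<and> k \<in> labels \<gamma> \<and> fst (point \<gamma> m) = fst (point \<gamma> k) \<longrightarrow> m = k)" for m k
    by (cases "m = k") simp_all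
  have *: "Measurable.pred config_space (\<lambda>\<gamma> :: ('x \<times> 'v) set. \<forall>m k.
      m \<in> labels \<gamma> \<and> k \<in> labels \<gamma> \<and> fst (point \<gamma> m) = fst (point \<gamma> k) \<longrightarrow> m = k)"
    by measurable
  have "(\<forall>m k. m \<in> labels \<gamma> \<and> k \<in> labels \<gamma> \<and> fst (point \<gamma> m) = fst (point \<gamma> k) \<longrightarrow> m = k) \<longleftrightarrow>
    inj_on fst \<gamma>" if "\<gamma> \<in> configs" for \<gamma> :: "('x \<times> 'v) set"
  proof -
    have "inj_on (fst \<circ> point \<gamma>) (labels \<gamma>) \<longleftrightarrow> inj_on fst \<gamma>"
      using comp_inj_on_iff[OF inj_on_point[OF that], of fst] by (simp add: image_point[OF that])
    then show ?thesis by (auto simp: inj_on_def)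
  qed
  then show ?thesis
    by (intro measurable_cong[THEN iffD1, OF _ *]) simp
qed

lemma interaction_potential_lifted:
  fixes \<Phi> :: "'x::polish_space set \<Rightarrow> ereal"
  assumes "interaction_potential \<Phi>"
  shows "interaction_potential (lifted_potential \<Phi>)"
  unfolding interaction_potential_def
proof (intro conjI ballI)
  let ?R = "restrict_space config_space finite_configs :: ('x \<times> 'x seqs) set measure"
  \<comment> \<open>Where two points share a position the label set is replaced by the empty set.
    The projected points are then distinct on the whole space, and the replaced value is overridden
    by \<infinity> in the lifted potential.\<close>
  define L where "L \<gamma> = (if inj_on fst \<gamma> then labels \<gamma> else {})" for \<gamma> :: "('x \<times> 'x seqs) set"
  have space_R: "space ?R = finite_configs"
    by (auto simp: space_restrict_space finite_configs_def)
  have [measurable]: "Measurable.pred ?R (\<lambda>\<gamma>. inj_on fst \<gamma>)"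
    by (rule measurable_restrict_space1) (rule pred_inj_on_fst)
  have [measurable]: "Measurable.pred ?R (\<lambda>\<gamma>. m \<in> labels \<gamma>)" for m
    by (rule measurable_restrict_space1) (rule pred_labels)
  have [measurable]: "(\<lambda>\<gamma>. fst (point \<gamma> m)) \<in> ?R \<rightarrow>\<^sub>M borel" for m
    by (rule measurable_restrict_space1) (rule measurable_fst_point)
  have img: "(\<lambda>m. fst (point \<gamma> m)) ` labels \<gamma> = fst ` \<gamma>" if "\<gamma> \<in> finite_configs"
    for \<gamma> :: "('x \<times> 'x seqs) set"
    using image_point[of \<gamma>] that by (metis finite_configs_def image_image mem_Collect_eq)
  have "(\<lambda>\<gamma>. (\<lambda>m. fst (point \<gamma> m)) ` L \<gamma>) \<in> ?R \<rightarrow>\<^sub>M config_space"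
  proof (rule measurable_config_space_image)
    fix \<gamma> assume "\<gamma> \<in> space ?R"
    then have \<gamma>: "\<gamma> \<in> finite_configs" by (simp add: space_R)
    then have fin: "finite \<gamma>" and conf: "\<gamma> \<in> configs" by (auto simp: finite_configs_def)
    show "(\<lambda>m. fst (point \<gamma> m)) ` L \<gamma> \<in> configs"
      using fin by (auto simp: L_def img[OF \<gamma>] intro: finite_imp_configs)
    have "inj_on (fst \<circ> point \<gamma>) (labels \<gamma>)" if "inj_on fst \<gamma>"
      using that comp_inj_on_iff[OF inj_on_point[OF conf], of fst] by (simp add: image_point[OF conf])
    then show "inj_on (\<lambda>m. fst (point \<gamma> m)) (L \<gamma>)"
      by (auto simp: L_def o_def)
  next
    fix m
    have "Measurable.pred ?R (\<lambda>\<gamma>. inj_on fst \<gamma> \<and> m \<in> labels \<gamma>)" by measurable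
    also have "(\<lambda>\<gamma> :: ('x \<times> 'x seqs) set. inj_on fst \<gamma> \<and> m \<in> labels \<gamma>) = (\<lambda>\<gamma>. m \<in> L \<gamma>)"
      by (auto simp: L_def)
    finally show "Measurable.pred ?R (\<lambda>\<gamma>. m \<in> L \<gamma>)" .
  qed measurable
  then have "(\<lambda>\<gamma>. (\<lambda>m. fst (point \<gamma> m)) ` L \<gamma>) \<in> ?R \<rightarrow>\<^sub>M restrict_space config_space finite_configs"
    by (rule measurable_restrict_space2[rotated])
      (auto simp: space_R finite_configs_iff L_def img)
  then have [measurable]: "(\<lambda>\<gamma>. \<Phi> ((\<lambda>m. fst (point \<gamma> m)) ` L \<gamma>)) \<in> borel_measurable ?R"
    using assms measurable_compose unfolding interaction_potential_def by blast
  have *: "(\<lambda>\<gamma>. if inj_on fst \<gamma> then \<Phi> ((\<lambda>m. fst (point \<gamma> m)) ` L \<gamma>) else \<infinity>) \<in> borel_measurable ?R"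
    by measurable
  show "lifted_potential \<Phi> \<in> borel_measurable ?R"
  proof (rule measurable_cong[THEN iffD1, OF _ *])
    fix \<gamma> assume "\<gamma> \<in> space ?R"
    then have \<gamma>: "\<gamma> \<in> finite_configs" by (simp add: space_R)
    show "(if inj_on fst \<gamma> then \<Phi> ((\<lambda>m. fst (point \<gamma> m)) ` L \<gamma>) else \<infinity>) = lifted_potential \<Phi> \<gamma>"
      using \<gamma> by (auto simp: lifted_potential_def L_def img[OF \<gamma>] proper_family_finite finite_configs_iff)
  qed
next
  fix \<gamma> :: "('x \<times> 'x seqs) set" assume "\<gamma> \<in> finite_configs"
  then show "lifted_potential \<Phi> \<gamma> \<noteq> - \<infinity>"
    using assms by (auto simp: lifted_potential_def interaction_potential_def finite_configs_iff)
next
  show "lifted_potential \<Phi> {} = 0"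
    using assms by (simp add: lifted_potential_def interaction_potential_def proper_family_finite)
qed

text \<open>A new position makes the projection injective on the added point together with any
  finite part of the marked configuration, so the lifted potential takes its finite-multiplicity
  branch and both energies are the same sum with the same convergence test. At an occupied position
  with \<open>v\<close> different from \<open>u x\<close> the pair of points over \<open>x\<close>
  would contribute an infinite term, so the hypothesis on \<open>x\<close> is essential.\<close>

lemma energy_lifted:
  fixes \<Phi> :: "'x::polish_space set \<Rightarrow> ereal"
  assumes "x \<notin> \<gamma>"
  shows "energy (lifted_potential \<Phi>) {(x, v)} (mark \<gamma> u) = energy \<Phi> {x} \<gamma>"
proof -
  have eq: "lifted_potential \<Phi> ({(x, v)} \<union> (\<lambda>x. (x, u x)) ` S) = \<Phi> ({x} \<union> (\<lambda>x. x) ` S)"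
    if "S \<in> Fpow \<gamma>" for S
  proof -
    have S: "finite S" "x \<notin> S" using that assms by (auto simp: Fpow_def)
    then have "inj_on fst ({(x, v)} \<union> (\<lambda>x. (x, u x)) ` S)"
      by (auto simp: inj_on_def)
    then have "proper_family ({(x, v)} \<union> (\<lambda>x. (x, u x)) ` S) fst"
      using S by (subst proper_family_finite) auto
    moreover have "fst ` ({(x, v)} \<union> (\<lambda>x. (x, u x)) ` S) = {x} \<union> (\<lambda>x. x) ` S"
      by (auto simp: image_image)
    ultimately show ?thesis
      by (simp only: lifted_potential_def if_True)
  qed
  \<comment> \<open>Reindexing the unmarked energy by the identity brings both energies into the
    form of sums over \<open>Fpow \<gamma>\<close>.\<close>
  have id: "bij_betw (\<lambda>x. x) \<gamma> \<gamma>" by (simp add: bij_betw_def)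
  show ?thesis
    unfolding energy_reindex[OF bij_betw_mark] energy_reindex[OF id]
    by (simp only: eq cong: ball_cong infsum_cong summable_on_cong)
qed

section \<open>Independent marks and the kernel of marked configurations\<close>

locale iid_marks = prob_space \<eta> for \<eta> :: "'v::polish_space measure" +
  assumes sets_mark [measurable_cong]: "sets \<eta> = sets borel"
begin

abbreviation marks :: "'i set \<Rightarrow> ('i \<Rightarrow> 'v) measure" where
  "marks I \<equiv> \<Pi>\<^sub>M i\<in>I. \<eta>"

abbreviation mark_kernel :: "'x::polish_space set \<Rightarrow> ('x \<times> 'v) set measure" where
  "mark_kernel \<gamma> \<equiv> distr (marks \<gamma>) config_space (mark \<gamma>)"

lemma prob_space_marks: "prob_space (marks I)"
  by (rule prob_space_PiM) (rule prob_space_axioms)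

lemma space_mark [simp]: "space \<eta> = UNIV"
  using sets_eq_imp_space_eq[OF sets_mark] by simp

lemma measurable_mark:
  fixes \<gamma> :: "'x::polish_space set"
  assumes "\<gamma> \<in> configs"
  shows "mark \<gamma> \<in> marks \<gamma> \<rightarrow>\<^sub>M config_space"
proof -
  \<comment> \<open>For an index that is not a label, \<open>point \<gamma> m\<close> may lie
    outside \<open>\<gamma>\<close>, where the product space has no coordinate; the constant default
    keeps \<open>p\<close> measurable in \<open>u\<close>.\<close>
  define p where "p u m = (if m \<in> labels \<gamma> then (point \<gamma> m, u (point \<gamma> m)) else undefined)"
    for u :: "'x \<Rightarrow> 'v" and m
  have eq: "p u ` labels \<gamma> = mark \<gamma> u" for u
  proof -
    have "p u ` labels \<gamma> = (\<lambda>x. (x, u x)) ` point \<gamma> ` labels \<gamma>"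
      unfolding image_image by (intro image_cong) (auto simp: p_def)
    then show ?thesis by (simp add: mark_def image_point[OF assms])
  qed
  have "(\<lambda>u. p u ` labels \<gamma>) \<in> marks \<gamma> \<rightarrow>\<^sub>M config_space"
  proof (rule measurable_config_space_image)
    fix u
    show "p u ` labels \<gamma> \<in> configs"
      unfolding eq using assms by (rule mark_in_configs)
    show "inj_on (p u) (labels \<gamma>)"
      using inj_on_point[OF assms] by (auto simp: inj_on_def p_def)
  next
    fix m
    show "(\<lambda>u. p u m) \<in> borel_measurable (marks \<gamma>)"
    proof (cases "m \<in> labels \<gamma>")
      case True
      then have "point \<gamma> m \<in> \<gamma>" using image_point[OF assms] by blast
      then have "(\<lambda>u. u (point \<gamma> m)) \<in> marks \<gamma> \<rightarrow>\<^sub>M \<eta>"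
        by (rule measurable_component_singleton)
      then have "(\<lambda>u. u (point \<gamma> m)) \<in> marks \<gamma> \<rightarrow>\<^sub>M borel"
        by (simp cong: measurable_cong_sets add: sets_mark)
      then have "(\<lambda>u. (point \<gamma> m, u (point \<gamma> m))) \<in> borel_measurable (marks \<gamma>)"
        by (intro borel_measurable_Pair) auto
      then show ?thesis using True by (simp add: p_def)
    qed (simp add: p_def)
  qed simp
  then show ?thesis by (simp add: eq)
qed

lemma nn_integral_mark_kernel:
  assumes "\<gamma> \<in> configs" and "f \<in> borel_measurable config_space"
  shows "(\<integral>\<^sup>+\<zeta>. f \<zeta> \<partial>mark_kernel \<gamma>) = (\<integral>\<^sup>+u. f (mark \<gamma> u) \<partial>marks \<gamma>)"
  using measurable_mark[OF assms(1)] assms(2) by (simp add: nn_integral_distr)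

text \<open>
  Joint measurability in the configuration and the marks is obtained by attaching the marks to
  the labels, so that the index set of the family of marks does not depend on the configuration.
\<close>

definition mark_labels :: "'x::polish_space set \<Rightarrow> (nat \<Rightarrow> 'v) \<Rightarrow> ('x \<times> 'v) set" where
  "mark_labels \<gamma> u = (\<lambda>m. (point \<gamma> m, u m)) ` labels \<gamma>"

lemma mark_labels_eq:
  assumes "\<gamma> \<in> configs"
  shows "mark_labels \<gamma> u = mark \<gamma> (\<lambda>x\<in>\<gamma>. u (inv_into (labels \<gamma>) (point \<gamma>) x))"
proof -
  have "mark \<gamma> (\<lambda>x\<in>\<gamma>. u (inv_into (labels \<gamma>) (point \<gamma>) x)) =
      (\<lambda>x. (x, u (inv_into (labels \<gamma>) (point \<gamma>) x))) ` point \<gamma> ` labels \<gamma>"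
    unfolding mark_def image_point[OF assms] by (intro image_cong) auto
  also have "\<dots> = mark_labels \<gamma> u"
    unfolding mark_labels_def image_image
    by (intro image_cong) (auto simp: inv_into_f_f[OF inj_on_point[OF assms]])
  finally show ?thesis by simp
qed

lemma measurable_mark_labels:
  "case_prod mark_labels \<in> (config_space :: 'x::polish_space set measure) \<Otimes>\<^sub>M marks UNIV \<rightarrow>\<^sub>M config_space"
proof -
  let ?M = "(config_space :: 'x set measure) \<Otimes>\<^sub>M (marks UNIV :: (nat \<Rightarrow> 'v) measure)"
  have "(\<lambda>\<omega>. (\<lambda>m. (point (fst \<omega>) m, snd \<omega> m)) ` labels (fst \<omega>)) \<in> ?M \<rightarrow>\<^sub>M config_space"
  proof (rule measurable_config_space_image)
    fix \<omega> assume "\<omega> \<in> space ?M"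
    then have \<gamma>: "fst \<omega> \<in> configs" by (auto simp: space_pair_measure)
    show "(\<lambda>m. (point (fst \<omega>) m, snd \<omega> m)) ` labels (fst \<omega>) \<in> configs"
      using mark_in_configs[OF \<gamma>] mark_labels_eq[OF \<gamma>] by (simp add: mark_labels_def)
    show "inj_on (\<lambda>m. (point (fst \<omega>) m, snd \<omega> m)) (labels (fst \<omega>))"
      using inj_on_point[OF \<gamma>] by (auto simp: inj_on_def)
  next
    fix m :: nat
    have "(\<lambda>\<omega>. snd \<omega> m) \<in> ?M \<rightarrow>\<^sub>M \<eta>" by measurable
    then have "(\<lambda>\<omega>. snd \<omega> m) \<in> ?M \<rightarrow>\<^sub>M borel"
      by (simp cong: measurable_cong_sets add: sets_mark)
    then show "(\<lambda>\<omega>. (point (fst \<omega>) m, snd \<omega> m)) \<in> borel_measurable ?M"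
      by (intro borel_measurable_Pair) measurable
  qed measurable
  then show ?thesis by (simp add: mark_labels_def split_beta')
qed

text \<open>Sending a point to its label is injective, and an i.i.d. sequence read along an
  injective map is again i.i.d.; hence marks attached to labels and marks attached to points have
  the same law.\<close>

lemma mark_kernel_eq:
  fixes \<gamma> :: "'x::polish_space set"
  assumes "\<gamma> \<in> configs"
  shows "mark_kernel \<gamma> = distr (marks UNIV) config_space (mark_labels \<gamma>)"
proof -
  let ?r = "\<lambda>u. \<lambda>x\<in>\<gamma>. u (inv_into (labels \<gamma>) (point \<gamma>) x)"
  have "inj_on (inv_into (labels \<gamma>) (point \<gamma>)) \<gamma>"
    by (rule inj_on_inv_into) (simp add: image_point[OF assms])
  then have "distr (marks UNIV) (marks \<gamma>) ?r = marks \<gamma>"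
    by (intro distr_PiM_reindex prob_space_axioms) auto
  then have "mark_kernel \<gamma> = distr (distr (marks UNIV) (marks \<gamma>) ?r) config_space (mark \<gamma>)"
    by simp
  also have "\<dots> = distr (marks UNIV) config_space (mark \<gamma> \<circ> ?r)"
    by (intro distr_distr measurable_mark assms) measurable
  also have "mark \<gamma> \<circ> ?r = mark_labels \<gamma>"
    by (simp add: fun_eq_iff mark_labels_eq[OF assms])
  finally show ?thesis .
qed

text \<open>In the labelled form the measure that is pushed forward is the same for all
  configurations; the dependence on \<open>\<gamma>\<close> sits entirely in a jointly measurable
  map.\<close>

lemma measurable_mark_kernel:
  "mark_kernel \<in> config_space \<rightarrow>\<^sub>M subprob_algebra config_space"
proof (subst measurable_cong)
  show "(\<lambda>\<gamma>. distr (marks UNIV) config_space (mark_labels \<gamma>)) \<in> config_space \<rightarrow>\<^sub>M subprob_algebra config_space"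
    by (intro measurable_distr2[OF measurable_mark_labels] measurable_const)
      (simp add: space_subprob_algebra prob_space_imp_subprob_space prob_space_marks)
qed (simp add: mark_kernel_eq)

lemma prob_space_mark_kernel: "\<gamma> \<in> configs \<Longrightarrow> prob_space (mark_kernel \<gamma>)"
  by (intro prob_space.prob_space_distr prob_space_marks measurable_mark)

end

section \<open>The Nguyen--Zessin equation for marked configurations\<close>

context iid_marks begin

text \<open>Independence of one mark from all the others, in the form of iterated integrals over a
  possibly infinite product.\<close>

lemma nn_integral_marks_insert:
  assumes "x \<in> \<gamma>" and [measurable]: "f \<in> borel_measurable (marks \<gamma>)"
  shows "(\<integral>\<^sup>+u. f u \<partial>marks \<gamma>) = (\<integral>\<^sup>+v. \<integral>\<^sup>+u. f (u(x := v)) \<partial>marks (\<gamma> - {x}) \<partial>\<eta>)"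
proof -
  interpret R: prob_space "marks (\<gamma> - {x})" by (rule prob_space_marks)
  have *: "insert x (\<gamma> - {x}) = \<gamma>" using assms(1) by auto
  have "distr (\<eta> \<Otimes>\<^sub>M marks (\<gamma> - {x})) (marks (insert x (\<gamma> - {x}))) (\<lambda>(v, u). u(x := v)) =
      marks (insert x (\<gamma> - {x}))"
    by (rule distr_pair_PiM_eq_PiM) (rule prob_space_axioms)+
  then have "(\<integral>\<^sup>+u. f u \<partial>marks \<gamma>) =
      (\<integral>\<^sup>+u. f u \<partial>distr (\<eta> \<Otimes>\<^sub>M marks (\<gamma> - {x})) (marks \<gamma>) (\<lambda>(v, u). u(x := v)))"
    unfolding * by simp
  also have [measurable]: "(\<lambda>(v, u). u(x := v)) \<in> \<eta> \<Otimes>\<^sub>M marks (\<gamma> - {x}) \<rightarrow>\<^sub>M marks \<gamma>"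
    using measurable_fun_upd[of \<gamma> "\<gamma> - {x}" x snd "\<eta> \<Otimes>\<^sub>M marks (\<gamma> - {x})" "\<lambda>_. \<eta>" fst] *
    by (auto simp: split_beta')
  have "(\<integral>\<^sup>+u. f u \<partial>distr (\<eta> \<Otimes>\<^sub>M marks (\<gamma> - {x})) (marks \<gamma>) (\<lambda>(v, u). u(x := v))) =
      (\<integral>\<^sup>+w. f ((\<lambda>(v, u). u(x := v)) w) \<partial>(\<eta> \<Otimes>\<^sub>M marks (\<gamma> - {x})))"
    by (rule nn_integral_distr) measurable
  also have "\<dots> = (\<integral>\<^sup>+v. \<integral>\<^sup>+u. f (u(x := v)) \<partial>marks (\<gamma> - {x}) \<partial>\<eta>)"
    by (subst R.nn_integral_fst[symmetric]) simp_all
  finally show ?thesis .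
qed

text \<open>For \<open>x \<notin> \<gamma>\<close> this is the conditional mean, given the
  positions, of \<open>H\<close> at the marked point over \<open>x\<close> in the marked
  configuration over \<open>insert x \<gamma>\<close>. The mark of \<open>x\<close> is integrated
  separately from the marks of \<open>\<gamma>\<close>, so the formula also matches the product
  structure of the new reference measure.\<close>

definition marked_mean ::
  "(('x::polish_space \<times> 'v) \<times> ('x \<times> 'v) set \<Rightarrow> ennreal) \<Rightarrow> 'x \<times> 'x set \<Rightarrow> ennreal" where
  "marked_mean H = (\<lambda>(x, \<gamma>). \<integral>\<^sup>+v. \<integral>\<^sup>+\<zeta>. H ((x, v), insert (x, v) \<zeta>) \<partial>mark_kernel \<gamma> \<partial>\<eta>)"

lemma measurable_marked_mean [measurable]:
  fixes H :: "('x::polish_space \<times> 'v) \<times> ('x \<times> 'v) set \<Rightarrow> ennreal"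
  assumes [measurable]: "H \<in> borel_measurable (borel \<Otimes>\<^sub>M config_space)"
  shows "marked_mean H \<in> borel_measurable (borel \<Otimes>\<^sub>M config_space)"
proof -
  let ?N = "config_space :: ('x \<times> 'v) set measure"
  let ?M = "(borel \<Otimes>\<^sub>M config_space) \<Otimes>\<^sub>M \<eta> :: (('x \<times> 'x set) \<times> 'v) measure"
  have [measurable]: "(\<lambda>\<omega>. (fst (fst (fst \<omega>)), snd (fst \<omega>))) \<in> ?M \<Otimes>\<^sub>M ?N \<rightarrow>\<^sub>M borel"
    by (rule borel_measurable_Pair) measurable
  have "(\<lambda>(\<omega>, \<zeta>). H ((fst (fst \<omega>), snd \<omega>), insert (fst (fst \<omega>), snd \<omega>) \<zeta>)) \<in> borel_measurable (?M \<Otimes>\<^sub>M ?N)"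
    unfolding split_beta' by measurable
  moreover have "(\<lambda>\<omega>. mark_kernel (snd (fst \<omega>))) \<in> ?M \<rightarrow>\<^sub>M subprob_algebra ?N"
    using measurable_compose[OF _ measurable_mark_kernel, of "\<lambda>\<omega>. snd (fst \<omega>)" ?M] by measurable
  ultimately have "(\<lambda>\<omega>. \<integral>\<^sup>+\<zeta>. H ((fst (fst \<omega>), snd \<omega>), insert (fst (fst \<omega>), snd \<omega>) \<zeta>)
      \<partial>mark_kernel (snd (fst \<omega>))) \<in> borel_measurable ?M"
    by (rule nn_integral_measurable_subprob_algebra2)
  then have "(\<lambda>\<omega>. \<integral>\<^sup>+v. \<integral>\<^sup>+\<zeta>. H ((fst \<omega>, v), insert (fst \<omega>, v) \<zeta>) \<partial>mark_kernel (snd \<omega>) \<partial>\<eta>)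
      \<in> borel_measurable (borel \<Otimes>\<^sub>M config_space)"
    by (intro borel_measurable_nn_integral) (simp add: split_beta')
  then show ?thesis by (simp add: marked_mean_def split_beta')
qed

lemma measurable_sections:
  fixes \<gamma> :: "'x::polish_space set"
  assumes \<gamma>: "\<gamma> \<in> configs" and [measurable]: "H \<in> borel_measurable (borel \<Otimes>\<^sub>M config_space)"
  shows "(\<lambda>\<omega>. H ((x, fst \<omega>), insert (x, fst \<omega>) (mark \<gamma> (snd \<omega>)))) \<in> borel_measurable (\<eta> \<Otimes>\<^sub>M marks \<gamma>)"
proof -
  note [measurable] = measurable_mark[OF \<gamma>]
  have [measurable]: "(\<lambda>\<omega>. (x, fst \<omega>)) \<in> \<eta> \<Otimes>\<^sub>M marks \<gamma> \<rightarrow>\<^sub>M borel"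
    by (rule borel_measurable_Pair) measurable
  show ?thesis by measurable
qed

lemma marked_mean_eq:
  fixes \<gamma> :: "'x::polish_space set"
  assumes \<gamma>: "\<gamma> \<in> configs" and H [measurable]: "H \<in> borel_measurable (borel \<Otimes>\<^sub>M config_space)"
  shows "marked_mean H (x, \<gamma>) =
    (\<integral>\<^sup>+v. \<integral>\<^sup>+u. H ((x, v), insert (x, v) (mark \<gamma> u)) \<partial>marks \<gamma> \<partial>\<eta>)"
proof -
  have "(\<lambda>\<zeta>. H ((x, v), insert (x, v) \<zeta>)) \<in> borel_measurable config_space" for v
    by measurable
  then show ?thesis
    unfolding marked_mean_def by (simp add: nn_integral_mark_kernel[OF \<gamma>])
qed

text \<open>The marked points are indexed by their positions, and this countable index set does not
  depend on the marks, so the sum can be exchanged with the mean. Splitting off the mark of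
  \<open>x\<close> then leaves independent marks on \<open>\<gamma> - {x}\<close>.\<close>

lemma sum_marked_points:
  fixes \<gamma> :: "'x::polish_space set"
  assumes \<gamma>: "\<gamma> \<in> configs" and H [measurable]: "H \<in> borel_measurable (borel \<Otimes>\<^sub>M config_space)"
  shows "(\<integral>\<^sup>+\<zeta>. (\<integral>\<^sup>+z. H (z, \<zeta>) \<partial>count_space \<zeta>) \<partial>mark_kernel \<gamma>) =
    (\<integral>\<^sup>+x. marked_mean H (x, \<gamma> - {x}) \<partial>count_space \<gamma>)"
proof -
  interpret P: prob_space "marks \<gamma>" by (rule prob_space_marks)
  interpret C: sigma_finite_measure "count_space \<gamma>"
    by (rule sigma_finite_measure_count_space_countable[OF countable_configs[OF \<gamma>]])
  interpret pair_sigma_finite "count_space \<gamma>" "marks \<gamma>" ..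
  note [measurable] = measurable_mark[OF \<gamma>]
  have meas [measurable]: "(\<lambda>u. H ((x, u x), mark \<gamma> u)) \<in> borel_measurable (marks \<gamma>)" if "x \<in> \<gamma>" for x
  proof -
    have "(\<lambda>u. u x) \<in> marks \<gamma> \<rightarrow>\<^sub>M \<eta>"
      using that by (rule measurable_component_singleton)
    then have [measurable]: "(\<lambda>u. u x) \<in> marks \<gamma> \<rightarrow>\<^sub>M borel"
      by (simp cong: measurable_cong_sets add: sets_mark)
    have [measurable]: "(\<lambda>u. (x, u x)) \<in> marks \<gamma> \<rightarrow>\<^sub>M borel"
      by (rule borel_measurable_Pair) measurable
    show ?thesis by measurable
  qed
  have "(\<integral>\<^sup>+\<zeta>. (\<integral>\<^sup>+z. H (z, \<zeta>) \<partial>count_space \<zeta>) \<partial>mark_kernel \<gamma>) =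
      (\<integral>\<^sup>+u. (\<integral>\<^sup>+z. H (z, mark \<gamma> u) \<partial>count_space (mark \<gamma> u)) \<partial>marks \<gamma>)"
    by (rule nn_integral_mark_kernel[OF \<gamma>]) (rule measurable_sum_points[OF H])
  also have "\<dots> = (\<integral>\<^sup>+u. (\<integral>\<^sup>+x. H ((x, u x), mark \<gamma> u) \<partial>count_space \<gamma>) \<partial>marks \<gamma>)"
    by (intro nn_integral_cong nn_integral_bij_count_space[OF bij_betw_mark, symmetric])
  also have "\<dots> = (\<integral>\<^sup>+x. (\<integral>\<^sup>+u. H ((x, u x), mark \<gamma> u) \<partial>marks \<gamma>) \<partial>count_space \<gamma>)"
    by (rule Fubini') (auto intro!: measurable_pair_measure_countable1 countable_configs[OF \<gamma>] meas)
  also have "\<dots> = (\<integral>\<^sup>+x. marked_mean H (x, \<gamma> - {x}) \<partial>count_space \<gamma>)"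
  proof (rule nn_integral_cong)
    fix x assume "x \<in> space (count_space \<gamma>)"
    then have x: "x \<in> \<gamma>" by simp
    \<comment> \<open>Changing the coordinate at \<open>x\<close> affects only the marked point over
      \<open>x\<close>; all other marked points are read off \<open>u\<close>.\<close>
    have "mark \<gamma> (u(x := v)) = insert (x, v) (mark (\<gamma> - {x}) u)" for u and v :: 'v
      using x by (auto simp: mark_def)
    then show "(\<integral>\<^sup>+u. H ((x, u x), mark \<gamma> u) \<partial>marks \<gamma>) = marked_mean H (x, \<gamma> - {x})"
      using configs_subset[OF \<gamma>, of "\<gamma> - {x}"]
      by (simp add: nn_integral_marks_insert[OF x meas[OF x]] marked_mean_eq)
  qed
  finally show ?thesis .
qed

lemma AE_notin_config:
  assumes "reference_measure \<theta>" "\<gamma> \<in> configs"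
  shows "AE x in \<theta>. x \<notin> \<gamma>"
proof -
  have [measurable_cong]: "sets \<theta> = sets borel" and "emeasure \<theta> {y} = 0" for y
    using assms(1) by (auto simp: reference_measure_def)
  then have "AE x in \<theta>. x \<noteq> y" for y
    by (intro AE_I[of _ _ "{y}"]) auto
  then have "AE x in \<theta>. \<forall>y\<in>\<gamma>. x \<noteq> y"
    by (subst AE_ball_countable[OF countable_configs[OF assms(2)]]) auto
  then show ?thesis by eventually_elim auto
qed

text \<open>For almost every position the energy does not depend on any mark, so the Boltzmann
  factor can be taken out of the integrals over \<open>\<eta>\<close> and over the marks of
  \<open>\<gamma>\<close>. What remains inside them is \<open>marked_mean\<close>. The agreement of
  energies is kept as a hypothesis, separate from the form of the marked potential.\<close>

lemma insert_marked_point: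
  fixes \<gamma> :: "'x::polish_space set" and \<Psi> :: "('x \<times> 'v) set \<Rightarrow> ereal"
  assumes \<gamma>: "\<gamma> \<in> configs" and H [measurable]: "H \<in> borel_measurable (borel \<Otimes>\<^sub>M config_space)"
    and \<theta>: "reference_measure \<theta>" and \<Phi>: "interaction_potential \<Phi>" and \<Psi>: "interaction_potential \<Psi>"
    and energy: "\<And>x v u. x \<notin> \<gamma> \<Longrightarrow> energy \<Psi> {(x, v)} (mark \<gamma> u) = energy \<Phi> {x} \<gamma>"
  shows "(\<integral>\<^sup>+\<zeta>. (\<integral>\<^sup>+z. H (z, insert z \<zeta>) * exp_neg (energy \<Psi> {z} \<zeta>) \<partial>(\<theta> \<Otimes>\<^sub>M \<eta>)) \<partial>mark_kernel \<gamma>) =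
    (\<integral>\<^sup>+x. marked_mean H (x, \<gamma>) * exp_neg (energy \<Phi> {x} \<gamma>) \<partial>\<theta>)"
proof -
  have sets_\<theta> [measurable_cong]: "sets \<theta> = sets borel" and "sigma_finite_measure \<theta>"
    using \<theta> by (auto simp: reference_measure_def)
  then interpret T: sigma_finite_measure \<theta> by simp
  interpret P: prob_space "marks \<gamma>" by (rule prob_space_marks)
  interpret TP: pair_sigma_finite \<theta> "marks \<gamma>" ..
  interpret EP: pair_sigma_finite \<eta> "marks \<gamma>" ..
  interpret TE: pair_sigma_finite \<theta> \<eta> ..
  note [measurable] = measurable_mark[OF \<gamma>] measurable_boltzmann[OF \<Phi>] measurable_boltzmann[OF \<Psi>]
  have sets_prod [measurable_cong]: "sets (\<theta> \<Otimes>\<^sub>M \<eta>) = sets borel"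
    using sets_pair_measure_cong[OF sets_\<theta> sets_mark] unfolding borel_prod .
  let ?e = "\<lambda>x. exp_neg (energy \<Phi> {x} \<gamma>)"
  have e [measurable]: "?e \<in> borel_measurable borel"
  proof -
    have "(\<lambda>x. (x, \<gamma>)) \<in> borel \<rightarrow>\<^sub>M borel \<Otimes>\<^sub>M config_space"
      by (rule measurable_Pair2') (simp add: \<gamma>)
    from measurable_compose[OF this measurable_boltzmann[OF \<Phi>]] show ?thesis by simp
  qed
  \<comment> \<open>This concerns the integrand with the original marked energy, as needed to pass
    from the kernel to the law of the marks. The simplified integrand, needed for Fubini, is treated
    in \<open>F\<close>.\<close>
  have J [measurable]: "(\<lambda>(\<zeta>, z). H (z, insert z \<zeta>) * exp_neg (energy \<Psi> {z} \<zeta>))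
      \<in> borel_measurable (config_space \<Otimes>\<^sub>M (\<theta> \<Otimes>\<^sub>M \<eta>))"
  proof -
    have "(\<lambda>(z, \<zeta>). H (z, insert z \<zeta>) * exp_neg (energy \<Psi> {z} \<zeta>)) \<in> borel_measurable (borel \<Otimes>\<^sub>M config_space)"
      by measurable
    then have "(\<lambda>(z, \<zeta>). H (z, insert z \<zeta>) * exp_neg (energy \<Psi> {z} \<zeta>)) \<in> borel_measurable ((\<theta> \<Otimes>\<^sub>M \<eta>) \<Otimes>\<^sub>M config_space)"
      by (simp cong: measurable_cong_sets add: sets_pair_measure_cong[OF sets_prod refl])
    from measurable_compose[OF measurable_pair_swap' this] show ?thesis
      by (simp add: split_beta')
  qed
  have F: "(\<lambda>((x, v), u). H ((x, v), insert (x, v) (mark \<gamma> u)) * ?e x)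
      \<in> borel_measurable ((\<theta> \<Otimes>\<^sub>M \<eta>) \<Otimes>\<^sub>M marks \<gamma>)"
  proof -
    have [measurable]: "(\<lambda>w. fst (fst w)) \<in> (\<theta> \<Otimes>\<^sub>M \<eta>) \<Otimes>\<^sub>M marks \<gamma> \<rightarrow>\<^sub>M borel"
      "(\<lambda>w. snd (fst w)) \<in> (\<theta> \<Otimes>\<^sub>M \<eta>) \<Otimes>\<^sub>M marks \<gamma> \<rightarrow>\<^sub>M borel"
      by (simp_all cong: measurable_cong_sets add: sets_\<theta>[symmetric] sets_mark[symmetric])
    have [measurable]: "(\<lambda>w. (fst (fst w), snd (fst w))) \<in> (\<theta> \<Otimes>\<^sub>M \<eta>) \<Otimes>\<^sub>M marks \<gamma> \<rightarrow>\<^sub>M borel"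
      by (rule borel_measurable_Pair) measurable
    show ?thesis unfolding split_beta' by measurable
  qed
  interpret SP: pair_sigma_finite "\<theta> \<Otimes>\<^sub>M \<eta>" "marks \<gamma>" ..
  have "(\<integral>\<^sup>+\<zeta>. (\<integral>\<^sup>+z. H (z, insert z \<zeta>) * exp_neg (energy \<Psi> {z} \<zeta>) \<partial>(\<theta> \<Otimes>\<^sub>M \<eta>)) \<partial>mark_kernel \<gamma>) =
      (\<integral>\<^sup>+u. (\<integral>\<^sup>+z. H (z, insert z (mark \<gamma> u)) * exp_neg (energy \<Psi> {z} (mark \<gamma> u)) \<partial>(\<theta> \<Otimes>\<^sub>M \<eta>)) \<partial>marks \<gamma>)"
    by (rule nn_integral_mark_kernel[OF \<gamma>]) (rule TE.P.borel_measurable_nn_integral[OF J])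
  also have "\<dots> = (\<integral>\<^sup>+u. (\<integral>\<^sup>+z. H (z, insert z (mark \<gamma> u)) * ?e (fst z) \<partial>(\<theta> \<Otimes>\<^sub>M \<eta>)) \<partial>marks \<gamma>)"
  proof (rule nn_integral_cong, rule nn_integral_cong_AE)
    fix u
    have "AE x in \<theta>. AE v in \<eta>. x \<notin> \<gamma>"
      using AE_notin_config[OF \<theta> \<gamma>] by eventually_elim auto
    \<comment> \<open>A configuration is countable, hence Borel; measurability of the exceptional
      set is what allows the null-set statement to pass to the product measure.\<close>
    moreover have "{z \<in> space (\<theta> \<Otimes>\<^sub>M \<eta>). fst z \<notin> \<gamma>} \<in> sets (\<theta> \<Otimes>\<^sub>M \<eta>)"
    proof -
      have "\<gamma> \<in> sets borel" by (rule sets.countable[OF _ countable_configs[OF \<gamma>]]) simp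
      then have "- \<gamma> \<in> sets \<theta>" by (simp add: sets_\<theta>)
      moreover have "{z \<in> space (\<theta> \<Otimes>\<^sub>M \<eta>). fst z \<notin> \<gamma>} = fst -` (- \<gamma>) \<inter> space (\<theta> \<Otimes>\<^sub>M \<eta>)" by auto
      ultimately show ?thesis using measurable_sets[OF measurable_fst] by metis
    qed
    ultimately have "AE z in \<theta> \<Otimes>\<^sub>M \<eta>. fst z \<notin> \<gamma>"
      by (intro TE.AE_pair_measure) auto
    then show "AE z in \<theta> \<Otimes>\<^sub>M \<eta>. H (z, insert z (mark \<gamma> u)) * exp_neg (energy \<Psi> {z} (mark \<gamma> u)) =
        H (z, insert z (mark \<gamma> u)) * ?e (fst z)"
    proof eventually_elim
      case (elim z)
      then show ?case using energy[of "fst z" "snd z" u] by simp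
    qed
  qed
  also have "\<dots> = (\<integral>\<^sup>+z. (\<integral>\<^sup>+u. H (z, insert z (mark \<gamma> u)) * ?e (fst z) \<partial>marks \<gamma>) \<partial>(\<theta> \<Otimes>\<^sub>M \<eta>))"
    by (rule SP.Fubini') (use F in \<open>simp add: split_beta'\<close>)
  also have "\<dots> = (\<integral>\<^sup>+x. (\<integral>\<^sup>+v. (\<integral>\<^sup>+u. H ((x, v), insert (x, v) (mark \<gamma> u)) * ?e x \<partial>marks \<gamma>) \<partial>\<eta>) \<partial>\<theta>)"
  proof (subst nn_integral_fst[symmetric])
    show "(\<lambda>z. \<integral>\<^sup>+u. H (z, insert z (mark \<gamma> u)) * ?e (fst z) \<partial>marks \<gamma>) \<in> borel_measurable (\<theta> \<Otimes>\<^sub>M \<eta>)"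
      by (rule P.borel_measurable_nn_integral) (use F in \<open>simp add: split_beta'\<close>)
  qed simp
  also have "\<dots> = (\<integral>\<^sup>+x. marked_mean H (x, \<gamma>) * ?e x \<partial>\<theta>)"
  proof (rule nn_integral_cong)
    fix x
    have "(\<lambda>u. H ((x, v), insert (x, v) (mark \<gamma> u))) \<in> borel_measurable (marks \<gamma>)" for v
      using measurable_Pair2[OF measurable_sections[OF \<gamma> H, of x], of v] by simp
    moreover have "(\<lambda>v. \<integral>\<^sup>+u. H ((x, v), insert (x, v) (mark \<gamma> u)) \<partial>marks \<gamma>) \<in> borel_measurable \<eta>"
      using P.borel_measurable_nn_integral[of "\<lambda>v u. H ((x, v), insert (x, v) (mark \<gamma> u))" \<eta>]
        measurable_sections[OF \<gamma> H, of x] by (simp add: split_beta')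
    ultimately show "(\<integral>\<^sup>+v. (\<integral>\<^sup>+u. H ((x, v), insert (x, v) (mark \<gamma> u)) * ?e x \<partial>marks \<gamma>) \<partial>\<eta>) =
        marked_mean H (x, \<gamma>) * ?e x"
      unfolding marked_mean_eq[OF \<gamma> H] by (simp add: nn_integral_multc)
  qed
  finally show ?thesis .
qed

text \<open>A singleton is a rectangle whose first side is a null set for \<open>\<theta>\<close>,
  so the product has no atoms even if \<open>\<eta>\<close> has some.\<close>

lemma reference_measure_pair:
  fixes \<theta> :: "'x::polish_space measure"
  assumes \<theta>: "reference_measure \<theta>"
  shows "reference_measure (\<theta> \<Otimes>\<^sub>M \<eta>)"
proof -
  have sets_\<theta> [measurable_cong]: "sets \<theta> = sets borel" and "sigma_finite_measure \<theta>"
    and atom: "emeasure \<theta> {x} = 0" for x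
    using \<theta> by (auto simp: reference_measure_def)
  then interpret T: sigma_finite_measure \<theta> by simp
  interpret TE: pair_sigma_finite \<theta> \<eta> ..
  have "emeasure (\<theta> \<Otimes>\<^sub>M \<eta>) {z} = 0" for z
    using emeasure_pair_measure_Times[of "{fst z}" \<theta> "{snd z}"] atom[of "fst z"] by simp
  moreover have "sets (\<theta> \<Otimes>\<^sub>M \<eta>) = sets borel"
    using sets_pair_measure_cong[OF sets_\<theta> sets_mark] unfolding borel_prod .
  ultimately show ?thesis
    by (simp add: reference_measure_def TE.P.sigma_finite_measure_axioms)
qed

section \<open>Mixtures of the mark kernel over a law of configurations\<close>

context
  fixes g :: "'x::polish_space set measure"
  assumes prob_g: "prob_space g" and sets_g: "sets g = sets config_space"
begin

abbreviation marked_distr :: "('x \<times> 'v) set measure" where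
  "marked_distr \<equiv> bind g mark_kernel"

lemma space_g: "space g = configs"
  using sets_eq_imp_space_eq[OF sets_g] by simp

lemma mark_kernel_g: "mark_kernel \<in> g \<rightarrow>\<^sub>M subprob_algebra config_space"
  using measurable_mark_kernel by (simp cong: measurable_cong_sets add: sets_g)

lemma sets_marked_distr: "sets marked_distr = sets config_space"
  by (rule sets_bind) (auto simp: prob_space.not_empty[OF prob_g])

lemma prob_space_marked_distr: "prob_space marked_distr"
  by (rule prob_space.prob_space_bind[OF prob_g _ mark_kernel_g])
    (auto simp: space_g intro!: AE_I2 prob_space_mark_kernel)

lemma nn_integral_marked_distr:
  assumes "f \<in> borel_measurable config_space"
  shows "(\<integral>\<^sup>+\<zeta>. f \<zeta> \<partial>marked_distr) = (\<integral>\<^sup>+\<gamma>. \<integral>\<^sup>+\<zeta>. f \<zeta> \<partial>mark_kernel \<gamma> \<partial>g)"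
  using assms mark_kernel_g by (rule nn_integral_bind)

end

text \<open>Conditioning on the positions turns each side of the equation for the marked law into a
  side of the equation for \<open>g\<close>: \<open>sum_marked_points\<close> does so for the sum
  over points and \<open>insert_marked_point\<close> for the integral over added points.\<close>

lemma marked_distr_gibbs:
  fixes \<Phi> :: "'x::polish_space set \<Rightarrow> ereal"
  assumes g: "g \<in> gibbs_measures \<theta> \<Phi>" and \<Psi>: "interaction_potential \<Psi>"
    and energy: "\<And>\<gamma> x v u. \<gamma> \<in> configs \<Longrightarrow> x \<notin> \<gamma> \<Longrightarrow> energy \<Psi> {(x, v)} (mark \<gamma> u) = energy \<Phi> {x} \<gamma>"
  shows "bind g mark_kernel \<in> gibbs_measures (\<theta> \<Otimes>\<^sub>M \<eta>) \<Psi>"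
proof -
  have \<theta>: "reference_measure \<theta>" and \<Phi>: "interaction_potential \<Phi>"
    and prob_g: "prob_space g" and sets_g: "sets g = sets config_space"
    using g by (auto simp: gibbs_measures_def)
  note space_g = space_g[OF prob_g sets_g]
  have "nguyen_zessin (\<theta> \<Otimes>\<^sub>M \<eta>) \<Psi> (bind g mark_kernel)"
    unfolding nguyen_zessin_def
  proof (intro allI impI)
    fix h :: "('x \<times> 'v) \<times> ('x \<times> 'v) set \<Rightarrow> real"
    assume h [measurable]: "h \<in> borel_measurable (borel \<Otimes>\<^sub>M config_space)"
    define H where "H z = ennreal (h z)" for z
    have H [measurable]: "H \<in> borel_measurable (borel \<Otimes>\<^sub>M config_space)"
      unfolding H_def[abs_def] by measurable
    interpret S: sigma_finite_measure "\<theta> \<Otimes>\<^sub>M \<eta>"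
      using reference_measure_pair[OF \<theta>] by (simp add: reference_measure_def)
    have sets_prod: "sets (\<theta> \<Otimes>\<^sub>M \<eta>) = sets borel"
      using reference_measure_pair[OF \<theta>] by (simp add: reference_measure_def)
    note [measurable] = measurable_boltzmann[OF \<Psi>]
    have "(\<lambda>(z, \<zeta>). H (z, insert z \<zeta>) * exp_neg (energy \<Psi> {z} \<zeta>)) \<in> borel_measurable (borel \<Otimes>\<^sub>M config_space)"
      by measurable
    then have "(\<lambda>(z, \<zeta>). H (z, insert z \<zeta>) * exp_neg (energy \<Psi> {z} \<zeta>)) \<in> borel_measurable ((\<theta> \<Otimes>\<^sub>M \<eta>) \<Otimes>\<^sub>M config_space)"
      by (simp cong: measurable_cong_sets add: sets_pair_measure_cong[OF sets_prod refl])
    from measurable_compose[OF measurable_pair_swap' this]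
    have "(\<lambda>(\<zeta>, z). H (z, insert z \<zeta>) * exp_neg (energy \<Psi> {z} \<zeta>)) \<in> borel_measurable (config_space \<Otimes>\<^sub>M (\<theta> \<Otimes>\<^sub>M \<eta>))"
      by (simp add: split_beta')
    then have J: "(\<lambda>\<zeta>. \<integral>\<^sup>+z. H (z, insert z \<zeta>) * exp_neg (energy \<Psi> {z} \<zeta>) \<partial>(\<theta> \<Otimes>\<^sub>M \<eta>)) \<in> borel_measurable config_space"
      by (rule S.borel_measurable_nn_integral)
    \<comment> \<open>The equation for \<open>g\<close> is applied to this function: in its sum
      \<open>x\<close> is a point of \<open>\<gamma>\<close> and must be removed before it is added
      again with a fresh mark.\<close>
    have H1 [measurable]: "(\<lambda>(x, \<gamma>). marked_mean H (x, \<gamma> - {x})) \<in> borel_measurable (borel \<Otimes>\<^sub>M config_space)"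
      by measurable
    have "(\<integral>\<^sup>+\<zeta>. (\<integral>\<^sup>+z. H (z, \<zeta>) \<partial>count_space \<zeta>) \<partial>bind g mark_kernel) =
        (\<integral>\<^sup>+\<gamma>. (\<integral>\<^sup>+x. marked_mean H (x, \<gamma> - {x}) \<partial>count_space \<gamma>) \<partial>g)"
      unfolding nn_integral_marked_distr[OF prob_g sets_g measurable_sum_points[OF H]]
      by (intro nn_integral_cong sum_marked_points H) (simp add: space_g)
    also have "\<dots> = (\<integral>\<^sup>+\<gamma>. (\<integral>\<^sup>+x. marked_mean H (x, insert x \<gamma> - {x}) * exp_neg (energy \<Phi> {x} \<gamma>) \<partial>\<theta>) \<partial>g)"
      using nguyen_zessin_ennreal[OF g H1] by simp
    \<comment> \<open>Inserting and then removing \<open>x\<close> restores \<open>\<gamma>\<close>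
      unless \<open>x\<close> was already present, which happens only on a
      \<open>\<theta>\<close>-null set.\<close>
    also have "\<dots> = (\<integral>\<^sup>+\<gamma>. (\<integral>\<^sup>+x. marked_mean H (x, \<gamma>) * exp_neg (energy \<Phi> {x} \<gamma>) \<partial>\<theta>) \<partial>g)"
    proof (rule nn_integral_cong, rule nn_integral_cong_AE)
      fix \<gamma> assume "\<gamma> \<in> space g"
      then have "AE x in \<theta>. x \<notin> \<gamma>"
        by (intro AE_notin_config[OF \<theta>]) (simp add: space_g)
      then show "AE x in \<theta>. marked_mean H (x, insert x \<gamma> - {x}) * exp_neg (energy \<Phi> {x} \<gamma>) =
          marked_mean H (x, \<gamma>) * exp_neg (energy \<Phi> {x} \<gamma>)"
        by eventually_elim simp
    qed
    also have "\<dots> = (\<integral>\<^sup>+\<zeta>. (\<integral>\<^sup>+z. H (z, insert z \<zeta>) * exp_neg (energy \<Psi> {z} \<zeta>) \<partial>(\<theta> \<Otimes>\<^sub>M \<eta>)) \<partial>bind g mark_kernel)"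
      unfolding nn_integral_marked_distr[OF prob_g sets_g J]
      by (intro nn_integral_cong insert_marked_point[OF _ H \<theta> \<Phi> \<Psi>, symmetric] energy)
        (simp_all add: space_g)
    finally show "(\<integral>\<^sup>+\<zeta>. (\<integral>\<^sup>+z. ennreal (h (z, \<zeta>)) \<partial>count_space \<zeta>) \<partial>bind g mark_kernel) =
      (\<integral>\<^sup>+\<zeta>. (\<integral>\<^sup>+z. ennreal (h (z, \<zeta> \<union> {z})) * exp_neg (energy \<Psi> {z} \<zeta>) \<partial>(\<theta> \<Otimes>\<^sub>M \<eta>)) \<partial>bind g mark_kernel)"
      by (simp add: H_def)
  qed
  then show ?thesis
    by (simp add: gibbs_measures_def reference_measure_pair[OF \<theta>] \<Psi>
        prob_space_marked_distr[OF prob_g sets_g] sets_marked_distr[OF prob_g sets_g])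
qed

end

section \<open>Sums over finite subsets\<close>

lemma PiE_UNIV_eq [simp]: "I \<rightarrow>\<^sub>E UNIV = extensional I"
  by (auto simp: PiE_def)

lemma Hausdorff_power: "Hausdorff_space (power_topology n :: (nat \<Rightarrow> 'y::metric_space) topology)"
  by (simp add: Hausdorff_space_product_topology Hausdorff_space_euclidean)

abbreviation subsets_of_card :: "nat \<Rightarrow> 'a set \<Rightarrow> 'a set set" where
  "subsets_of_card n A \<equiv> {\<xi>. \<xi> \<subseteq> A \<and> finite \<xi> \<and> card \<xi> = n}"

definition symmetric_fun :: "nat \<Rightarrow> ((nat \<Rightarrow> 'y) \<Rightarrow> 'b) \<Rightarrow> bool" where
  "symmetric_fun n \<phi> \<longleftrightarrow>
    (\<forall>\<pi>. \<pi> permutes {..<n} \<longrightarrow> (\<forall>y\<in>extensional {..<n}. \<phi> (y \<circ> \<pi>) = \<phi> y))"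

lemma symmetric_funD:
  "symmetric_fun n \<phi> \<Longrightarrow> \<pi> permutes {..<n} \<Longrightarrow> y \<in> extensional {..<n} \<Longrightarrow> \<phi> (y \<circ> \<pi>) = \<phi> y"
  by (simp add: symmetric_fun_def)

lemma symmetric_fun_comp: "symmetric_fun n \<phi> \<Longrightarrow> symmetric_fun n (\<lambda>y. p (\<phi> y))"
  by (simp add: symmetric_fun_def)

lemma enumeration:
  assumes "finite \<xi>" "card \<xi> = n"
  shows "enumeration n \<xi> \<in> extensional {..<n}" "bij_betw (enumeration n \<xi>) {..<n} \<xi>"
proof -
  obtain h where h: "bij_betw h {..<n} \<xi>"
    using ex_bij_betw_nat_finite[OF assms(1)] assms(2) by (auto simp: lessThan_atLeast0)
  then have "bij_betw (restrict h {..<n}) {..<n} \<xi>"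
    by (subst bij_betw_cong[of _ _ h]) auto
  then have "\<exists>y. y \<in> extensional {..<n} \<and> bij_betw y {..<n} \<xi>"
    by (intro exI[of _ "restrict h {..<n}"]) simp
  then have "enumeration n \<xi> \<in> extensional {..<n} \<and> bij_betw (enumeration n \<xi>) {..<n} \<xi>"
    unfolding enumeration_def by (rule someI_ex)
  then show "enumeration n \<xi> \<in> extensional {..<n}" "bij_betw (enumeration n \<xi>) {..<n} \<xi>"
    by auto
qed

text \<open>Two enumerations of a set differ by a permutation of the indices. Thus the arbitrary
  choice in \<open>enumeration\<close> may be replaced by any convenient one.\<close>

lemma symmetric_fun_enumeration:
  assumes \<phi>: "symmetric_fun n \<phi>" and y: "y \<in> extensional {..<n}" "bij_betw y {..<n} \<xi>"
  shows "\<phi> (enumeration n \<xi>) = \<phi> y"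
proof -
  have "finite \<xi>" "card \<xi> = n"
    using bij_betw_finite[OF y(2)] bij_betw_same_card[OF y(2)] by auto
  note e = enumeration[OF this]
  define e where "e = enumeration n \<xi>"
  \<comment> \<open>The permutation takes an index to the place of its \<open>y\<close>-value in the
    chosen enumeration. It fixes all other indices, where both enumerations have the default value
    of extensional functions.\<close>
  define \<pi> where "\<pi> i = (if i \<in> {..<n} then inv_into {..<n} e (y i) else i)" for i
  have "bij_betw (inv_into {..<n} e \<circ> y) {..<n} {..<n}"
    using y(2) bij_betw_inv_into[OF e(2)] unfolding e_def by (rule bij_betw_trans)
  then have "bij_betw \<pi> {..<n} {..<n}"
    by (subst bij_betw_cong[of _ _ "inv_into {..<n} e \<circ> y"]) (auto simp: \<pi>_def)
  then have \<pi>: "\<pi> permutes {..<n}"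
    by (rule bij_imp_permutes) (simp add: \<pi>_def)
  have "e \<circ> \<pi> = y"
  proof
    fix i show "(e \<circ> \<pi>) i = y i"
    proof (cases "i < n")
      case True
      then have "y i \<in> e ` {..<n}"
        using y(2) e(2) by (auto simp: bij_betw_def e_def)
      then show ?thesis using True by (simp add: \<pi>_def f_inv_into_f)
    next
      case False
      then show ?thesis using e(1) y(1) by (simp add: \<pi>_def e_def extensional_def)
    qed
  qed
  then show ?thesis
    using symmetric_funD[OF \<phi> \<pi> e(1)] by (simp add: e_def)
qed

lemma bij_betw_subsets_of_card:
  assumes "bij_betw f L \<gamma>"
  shows "bij_betw ((`) f) (subsets_of_card n L) (subsets_of_card n \<gamma>)"
proof -
  have inj: "inj_on f L" and img: "f ` L = \<gamma>" using assms by (auto simp: bij_betw_def)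
  have card: "finite (f ` S) \<longleftrightarrow> finite S" "card (f ` S) = card S" if "S \<subseteq> L" for S
    using inj_on_subset[OF inj that] by (simp_all add: finite_image_iff card_image)
  have "inj_on ((`) f) (subsets_of_card n L)"
    by (rule inj_on_subset[OF inj_on_image_Pow[OF inj]]) auto
  moreover have "(`) f ` subsets_of_card n L = subsets_of_card n \<gamma>"
  proof (intro equalityI subsetI)
    fix \<xi> assume \<xi>: "\<xi> \<in> subsets_of_card n \<gamma>"
    then obtain S where "S \<subseteq> L" "\<xi> = f ` S"
      unfolding img[symmetric] by (auto simp: subset_image_iff)
    then show "\<xi> \<in> (`) f ` subsets_of_card n L" using \<xi> card[of S] by auto
  qed (use card img in auto)
  ultimately show ?thesis by (simp add: bij_betw_def)
qed

lemma countable_subsets_of_card: "countable A \<Longrightarrow> countable (subsets_of_card n A)"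
  by (rule countable_subset[OF _ countable_Fpow]) (auto simp: Fpow_def)

text \<open>The extended-valued version of \<open>sum_over_subsets\<close>, for which countable sums
  and integrals may be exchanged before finiteness is known.\<close>

definition nn_sum_over_subsets :: "nat \<Rightarrow> ((nat \<Rightarrow> 'y) \<Rightarrow> ennreal) \<Rightarrow> 'y set \<Rightarrow> ennreal" where
  "nn_sum_over_subsets n f \<gamma> = (\<integral>\<^sup>+\<xi>. f (enumeration n \<xi>) \<partial>count_space (subsets_of_card n \<gamma>))"

text \<open>The image of a chosen enumeration need not be the chosen enumeration of the image;
  symmetry of \<open>f\<close> absorbs the difference.\<close>

lemma nn_sum_over_subsets_reindex:
  assumes f: "symmetric_fun n f" and h: "bij_betw h L \<gamma>"
  shows "nn_sum_over_subsets n f \<gamma> =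
    (\<integral>\<^sup>+S. f (\<lambda>i\<in>{..<n}. h (enumeration n S i)) \<partial>count_space (subsets_of_card n L))"
proof -
  have "nn_sum_over_subsets n f \<gamma> = (\<integral>\<^sup>+S. f (enumeration n (h ` S)) \<partial>count_space (subsets_of_card n L))"
    unfolding nn_sum_over_subsets_def
    by (rule nn_integral_bij_count_space[OF bij_betw_subsets_of_card[OF h], symmetric])
  also have "\<dots> = (\<integral>\<^sup>+S. f (\<lambda>i\<in>{..<n}. h (enumeration n S i)) \<partial>count_space (subsets_of_card n L))"
  proof (rule nn_integral_cong)
    fix S assume "S \<in> space (count_space (subsets_of_card n L))"
    then have S: "S \<subseteq> L" "finite S" "card S = n" by auto
    have "bij_betw h S (h ` S)"
      by (rule bij_betw_subset[OF h S(1) refl])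
    then have "bij_betw (h \<circ> enumeration n S) {..<n} (h ` S)"
      by (rule bij_betw_trans[OF enumeration(2)[OF S(2,3)]])
    then have "bij_betw (\<lambda>i\<in>{..<n}. h (enumeration n S i)) {..<n} (h ` S)"
      by (subst bij_betw_cong[of _ _ "h \<circ> enumeration n S"]) auto
    then show "f (enumeration n (h ` S)) = f (\<lambda>i\<in>{..<n}. h (enumeration n S i))"
      by (intro symmetric_fun_enumeration[OF f]) auto
  qed
  finally show ?thesis .
qed

text \<open>After reindexing, the arbitrary enumerations are those of fixed finite sets of labels.
  They do not vary with \<open>\<gamma>\<close>, so the choice operator does not interfere with
  measurability.\<close>

lemma measurable_nn_sum_over_subsets:
  fixes f :: "(nat \<Rightarrow> 'y::polish_space) \<Rightarrow> ennreal"
  assumes f: "symmetric_fun n f" and [measurable]: "f \<in> borel_measurable (\<Pi>\<^sub>M i\<in>{..<n}. borel)"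
  shows "nn_sum_over_subsets n f \<in> borel_measurable config_space"
proof -
  let ?F = "\<lambda>\<gamma> S. f (\<lambda>i\<in>{..<n}. point \<gamma> (enumeration n S i))"
  have *: "(\<lambda>\<gamma>. \<Sum>k. if (\<forall>m\<in>set_decode k. m \<in> labels \<gamma>) \<and> card (set_decode k) = n then ?F \<gamma> (set_decode k) else 0)
      \<in> borel_measurable config_space"
    by measurable
  show ?thesis
  proof (rule measurable_cong[THEN iffD1, OF _ *])
    fix \<gamma> :: "'y set" assume "\<gamma> \<in> space config_space"
    then have \<gamma>: "\<gamma> \<in> configs" by simp
    let ?A = "{k. (\<forall>m\<in>set_decode k. m \<in> labels \<gamma>) \<and> card (set_decode k) = n}"
    have "bij_betw set_decode ?A (subsets_of_card n (labels \<gamma>))"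
      by (rule bij_betwI[where g = set_encode]) auto
    then have "(\<integral>\<^sup>+S. ?F \<gamma> S \<partial>count_space (subsets_of_card n (labels \<gamma>))) =
        (\<integral>\<^sup>+k. ?F \<gamma> (set_decode k) \<partial>count_space ?A)"
      by (rule nn_integral_bij_count_space[symmetric])
    also have "\<dots> = (\<integral>\<^sup>+k. ?F \<gamma> (set_decode k) * indicator ?A k \<partial>count_space UNIV)"
      by (rule nn_integral_count_space_indicator) simp
    also have "\<dots> = (\<Sum>k. ?F \<gamma> (set_decode k) * indicator ?A k)"
      by (rule nn_integral_count_space_nat)
    also have "\<dots> = (\<Sum>k. if (\<forall>m\<in>set_decode k. m \<in> labels \<gamma>) \<and> card (set_decode k) = n
        then ?F \<gamma> (set_decode k) else 0)"
      by (intro arg_cong[where f=suminf] ext) simp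
    finally show "(\<Sum>k. if (\<forall>m\<in>set_decode k. m \<in> labels \<gamma>) \<and> card (set_decode k) = n
        then ?F \<gamma> (set_decode k) else 0) = nn_sum_over_subsets n f \<gamma>"
      by (simp add: nn_sum_over_subsets_reindex[OF f bij_betw_point[OF \<gamma>]])
  qed
qed

section \<open>Symmetric test functions with compact support\<close>

abbreviation power_support :: "nat \<Rightarrow> ((nat \<Rightarrow> 'y::topological_space) \<Rightarrow> real) \<Rightarrow> (nat \<Rightarrow> 'y) set" where
  "power_support n \<phi> \<equiv> power_topology n closure_of {y \<in> topspace (power_topology n). \<phi> y \<noteq> 0}"

lemma symmetric_C0_iff:
  "\<phi> \<in> symmetric_C0 n \<longleftrightarrow> continuous_map (power_topology n) euclidean \<phi> \<and>
    compactin (power_topology n) (power_support n \<phi>) \<and> symmetric_fun n \<phi>"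
  by (simp add: symmetric_C0_def symmetric_fun_def)

lemma mem_power_support:
  "y \<in> extensional {..<n} \<Longrightarrow> \<phi> y \<noteq> 0 \<Longrightarrow> y \<in> power_support n \<phi>"
  using closure_of_subset[of "{y \<in> topspace (power_topology n). \<phi> y \<noteq> 0}" "power_topology n"]
  by auto

text \<open>A compact set in a Hausdorff space is closed, so any compact set containing the nonzero
  points also contains their closure.\<close>

lemma compactin_power_supportI:
  fixes \<phi> :: "(nat \<Rightarrow> 'y::metric_space) \<Rightarrow> real"
  assumes K: "compactin (power_topology n) K"
    and "\<And>y. y \<in> extensional {..<n} \<Longrightarrow> \<phi> y \<noteq> 0 \<Longrightarrow> y \<in> K"
  shows "compactin (power_topology n) (power_support n \<phi>)"
proof (rule closed_compactin[OF K])
  show "power_support n \<phi> \<subseteq> K"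
    using assms by (intro closure_of_minimal compactin_imp_closedin Hausdorff_power) auto
qed (rule closedin_closure_of)

lemma symmetric_C0_comp:
  assumes \<phi>: "\<phi> \<in> symmetric_C0 n" and p: "continuous_on UNIV p" "p 0 = 0"
  shows "(\<lambda>y. p (\<phi> y)) \<in> symmetric_C0 n"
  unfolding symmetric_C0_iff
proof (intro conjI)
  show "continuous_map (power_topology n) euclidean (\<lambda>y. p (\<phi> y))"
    using \<phi> p(1) continuous_map_compose[of "power_topology n" euclidean \<phi> euclidean p]
    by (simp add: symmetric_C0_iff o_def)
  show "compactin (power_topology n) (power_support n (\<lambda>y. p (\<phi> y)))"
  proof (rule compactin_power_supportI)
    show "compactin (power_topology n) (power_support n \<phi>)"
      using \<phi> by (simp add: symmetric_C0_iff)
    fix y :: "nat \<Rightarrow> 'a" assume "y \<in> extensional {..<n}" "p (\<phi> y) \<noteq> 0"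
    then show "y \<in> power_support n \<phi>"
      using p(2) by (intro mem_power_support) auto
  qed
  show "symmetric_fun n (\<lambda>y. p (\<phi> y))"
    by (rule symmetric_fun_comp) (use \<phi> in \<open>simp add: symmetric_C0_iff\<close>)
qed

lemma symmetric_C0_bounded:
  assumes "\<phi> \<in> symmetric_C0 n"
  obtains C where "\<And>y. y \<in> extensional {..<n} \<Longrightarrow> \<bar>\<phi> y\<bar> \<le> C"
proof -
  have "compactin euclidean (\<phi> ` power_support n \<phi>)"
    using assms by (intro image_compactin[of "power_topology n"]) (auto simp: symmetric_C0_iff)
  then have "bounded (\<phi> ` power_support n \<phi>)"
    by (simp add: compact_imp_bounded)
  then obtain C where C: "\<And>y. y \<in> power_support n \<phi> \<Longrightarrow> \<bar>\<phi> y\<bar> \<le> C"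
    unfolding bounded_iff by auto
  \<comment> \<open>The maximum with 0 covers points off the support, since a bound on an empty
    support could be negative.\<close>
  have "\<bar>\<phi> y\<bar> \<le> max C 0" if "y \<in> extensional {..<n}" for y
    using C[of y] mem_power_support[OF that, of \<phi>] by (cases "\<phi> y = 0") auto
  then show ?thesis by (rule that)
qed

text \<open>Open sets of the finite power are traces of open sets of the full sequence space, whose
  Borel sets form the product sigma-algebra by second countability.\<close>

lemma measurable_continuous_map_power:
  fixes \<phi> :: "(nat \<Rightarrow> 'y::second_countable_topology) \<Rightarrow> 'b::topological_space"
  assumes "continuous_map (power_topology n) euclidean \<phi>"
  shows "\<phi> \<in> borel_measurable (\<Pi>\<^sub>M i\<in>{..<n}. borel)"
proof (rule borel_measurableI)
  let ?P = "\<Pi>\<^sub>M i\<in>{..<n}. (borel :: 'y measure)"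
  fix U :: "'b set" assume "open U"
  then have "openin (power_topology n) {y \<in> topspace (power_topology n). \<phi> y \<in> U}"
    using openin_continuous_map_preimage[OF assms] by simp
  then obtain T where T: "open T" "{y \<in> topspace (power_topology n). \<phi> y \<in> U} = T \<inter> extensional {..<n}"
    unfolding openin_product_extensional by blast
  \<comment> \<open>Extensional functions embed measurably into all sequences because their
    coordinates from \<open>n\<close> on are constant.\<close>
  have id: "(\<lambda>y. y) \<in> ?P \<rightarrow>\<^sub>M (\<Pi>\<^sub>M i\<in>UNIV. borel)"
  proof (rule measurable_PiM_single')
    fix i :: nat
    show "(\<lambda>y. y i) \<in> ?P \<rightarrow>\<^sub>M borel"
    proof (cases "i < n")
      case False
      then have "(\<lambda>y. y i) \<in> ?P \<rightarrow>\<^sub>M borel \<longleftrightarrow> (\<lambda>y. undefined) \<in> ?P \<rightarrow>\<^sub>M (borel :: 'y measure)"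
        by (intro measurable_cong) (auto simp: space_PiM PiE_def extensional_def)
      then show ?thesis by simp
    qed (rule measurable_component_singleton, simp)
  qed (simp add: space_PiM)
  have "T \<in> sets (\<Pi>\<^sub>M i\<in>UNIV. borel)"
    using T(1) unfolding sets_PiM_equal_borel by (rule borel_open)
  from measurable_sets[OF id this] have "T \<inter> space ?P \<in> sets ?P"
    by simp
  also have "T \<inter> space ?P = \<phi> -` U \<inter> space ?P"
    using T(2) by (auto simp: space_PiM PiE_def)
  finally show "\<phi> -` U \<inter> space ?P \<in> sets ?P" .
qed

lemma symmetric_C0_finite:
  fixes \<phi> :: "(nat \<Rightarrow> 'y::polish_space) \<Rightarrow> real"
  assumes \<phi>: "\<phi> \<in> symmetric_C0 n" and \<gamma>: "\<gamma> \<in> configs"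
  shows "finite {\<xi> \<in> subsets_of_card n \<gamma>. \<phi> (enumeration n \<xi>) \<noteq> 0}"
proof -
  \<comment> \<open>The union of the coordinate projections of the support is compact. A subset with
    a nonzero term lies in \<open>\<gamma> \<inter> K\<close>, which is finite and so has only
    finitely many subsets.\<close>
  define K where "K = (\<Union>i<n. (\<lambda>y. y i) ` power_support n \<phi>)"
  have "compact ((\<lambda>y. y i) ` power_support n \<phi>)" if "i < n" for i
    using \<phi> that image_compactin[of "power_topology n" "power_support n \<phi>" euclidean "\<lambda>y. y i"]
    by (auto simp: symmetric_C0_iff intro: continuous_map_product_projection)
  then have "compact K" unfolding K_def by (intro compact_UN) auto
  then have "finite (Pow (\<gamma> \<inter> K))" using \<gamma> unfolding configs_iff finite_Pow_iff by blast
  moreover have "\<xi> \<subseteq> K" if "finite \<xi>" "card \<xi> = n" "\<phi> (enumeration n \<xi>) \<noteq> 0" for \<xi>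
  proof -
    note e = enumeration[OF that(1,2)]
    have "enumeration n \<xi> \<in> power_support n \<phi>"
      using e(1) that(3) by (rule mem_power_support)
    then have "enumeration n \<xi> ` {..<n} \<subseteq> K" by (auto simp: K_def)
    then show ?thesis using e(2) by (simp add: bij_betw_def)
  qed
  ultimately show ?thesis
    by (elim finite_subset[rotated]) auto
qed

lemma ennreal_sum_over_subsets:
  fixes \<phi> :: "(nat \<Rightarrow> 'y::polish_space) \<Rightarrow> real"
  assumes \<phi>: "\<phi> \<in> symmetric_C0 n" and nonneg: "\<And>y. 0 \<le> \<phi> y" and \<gamma>: "\<gamma> \<in> configs"
  shows "ennreal (sum_over_subsets n \<phi> \<gamma>) = nn_sum_over_subsets n (\<lambda>y. ennreal (\<phi> y)) \<gamma>"
proof -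
  let ?A = "{\<xi> \<in> subsets_of_card n \<gamma>. \<phi> (enumeration n \<xi>) \<noteq> 0}"
  note fin = symmetric_C0_finite[OF \<phi> \<gamma>]
  have "sum_over_subsets n \<phi> \<gamma> = (\<Sum>\<^sub>\<infinity>\<xi>\<in>?A. \<phi> (enumeration n \<xi>))"
    unfolding sum_over_subsets_def by (rule infsum_cong_neutral) auto
  also have "\<dots> = (\<Sum>\<xi>\<in>?A. \<phi> (enumeration n \<xi>))"
    using fin by (rule infsum_finite)
  finally have "ennreal (sum_over_subsets n \<phi> \<gamma>) = (\<Sum>\<xi>\<in>?A. ennreal (\<phi> (enumeration n \<xi>)))"
    using nonneg by simp
  also have "\<dots> = nn_sum_over_subsets n (\<lambda>y. ennreal (\<phi> y)) \<gamma>"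
    unfolding nn_sum_over_subsets_def
    by (rule nn_integral_count_space'[OF fin, symmetric]) auto
  finally show ?thesis .
qed

lemma sum_over_subsets_nonneg: "(\<And>y. 0 \<le> \<phi> y) \<Longrightarrow> 0 \<le> sum_over_subsets n \<phi> \<gamma>"
  unfolding sum_over_subsets_def by (rule infsum_nonneg)

lemma measurable_sum_over_subsets:
  fixes \<phi> :: "(nat \<Rightarrow> 'y::polish_space) \<Rightarrow> real"
  assumes \<phi>: "\<phi> \<in> symmetric_C0 n" and nonneg: "\<And>y. 0 \<le> \<phi> y"
  shows "sum_over_subsets n \<phi> \<in> borel_measurable config_space"
proof -
  have [measurable]: "\<phi> \<in> borel_measurable (\<Pi>\<^sub>M i\<in>{..<n}. borel)"
    using \<phi> by (intro measurable_continuous_map_power) (simp add: symmetric_C0_iff)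
  have "symmetric_fun n (\<lambda>y. ennreal (\<phi> y))"
    by (rule symmetric_fun_comp) (use \<phi> in \<open>simp add: symmetric_C0_iff\<close>)
  then have "nn_sum_over_subsets n (\<lambda>y. ennreal (\<phi> y)) \<in> borel_measurable config_space"
    by (rule measurable_nn_sum_over_subsets) measurable
  then have *: "(\<lambda>\<gamma>. enn2real (nn_sum_over_subsets n (\<lambda>y. ennreal (\<phi> y)) \<gamma>)) \<in> borel_measurable config_space"
    by measurable
  show ?thesis
    by (rule measurable_cong[THEN iffD1, OF _ *])
      (simp add: ennreal_sum_over_subsets[OF \<phi> nonneg, symmetric] sum_over_subsets_nonneg[OF nonneg])
qed

lemma sum_over_subsets_diff:
  fixes \<phi> \<psi> :: "(nat \<Rightarrow> 'y::polish_space) \<Rightarrow> real"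
  assumes "\<phi> \<in> symmetric_C0 n" "\<psi> \<in> symmetric_C0 n" "\<gamma> \<in> configs"
  shows "sum_over_subsets n (\<lambda>y. \<phi> y - \<psi> y) \<gamma> = sum_over_subsets n \<phi> \<gamma> - sum_over_subsets n \<psi> \<gamma>"
proof -
  let ?f = "\<lambda>\<xi>. \<phi> (enumeration n \<xi>)" and ?g = "\<lambda>\<xi>. \<psi> (enumeration n \<xi>)"
  have "?f summable_on subsets_of_card n \<gamma>" "?g summable_on subsets_of_card n \<gamma>"
    by (rule finite_nonzero_values_imp_summable_on symmetric_C0_finite[OF assms(1,3)]
        symmetric_C0_finite[OF assms(2,3)])+
  then show ?thesis
    using infsum_add[of ?f "subsets_of_card n \<gamma>" "\<lambda>\<xi>. - ?g \<xi>"]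
    by (simp add: sum_over_subsets_def summable_on_uminus infsum_uminus)
qed

section \<open>Averages over marks\<close>

definition zip_fun :: "nat \<Rightarrow> (nat \<Rightarrow> 'x) \<Rightarrow> (nat \<Rightarrow> 'v) \<Rightarrow> nat \<Rightarrow> 'x \<times> 'v" where
  "zip_fun n x v = (\<lambda>i\<in>{..<n}. (x i, v i))"

lemma zip_fun_extensional [simp]: "zip_fun n x v \<in> extensional {..<n}"
  by (simp add: zip_fun_def)

lemma measurable_zip_fun:
  assumes "x \<in> M \<rightarrow>\<^sub>M (\<Pi>\<^sub>M i\<in>{..<n}. A)" "v \<in> M \<rightarrow>\<^sub>M (\<Pi>\<^sub>M i\<in>{..<n}. B)"
  shows "(\<lambda>\<omega>. zip_fun n (x \<omega>) (v \<omega>)) \<in> M \<rightarrow>\<^sub>M (\<Pi>\<^sub>M i\<in>{..<n}. A \<Otimes>\<^sub>M B)"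
  unfolding zip_fun_def
proof (rule measurable_restrict)
  fix i assume "i \<in> {..<n}"
  then show "(\<lambda>\<omega>. (x \<omega> i, v \<omega> i)) \<in> M \<rightarrow>\<^sub>M A \<Otimes>\<^sub>M B"
    using assms by (intro measurable_Pair)
      (auto intro: measurable_compose[OF assms(1) measurable_component_singleton]
        measurable_compose[OF assms(2) measurable_component_singleton])
qed

text \<open>The power of a product is the product of the powers, up to the rearrangement
  \<open>zip_fun\<close>. It suffices to compare the measures on boxes, where the iterated integrals
  factor over the coordinates.\<close>

lemma PiM_pair_measure:
  fixes \<theta> :: "'x measure" and \<eta> :: "'v measure"
  assumes "sigma_finite_measure \<theta>" "sigma_finite_measure \<eta>"
  shows "distr ((\<Pi>\<^sub>M i\<in>{..<n}. \<theta>) \<Otimes>\<^sub>M (\<Pi>\<^sub>M i\<in>{..<n}. \<eta>)) (\<Pi>\<^sub>M i\<in>{..<n}. \<theta> \<Otimes>\<^sub>M \<eta>)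
      (\<lambda>(x, v). zip_fun n x v) = (\<Pi>\<^sub>M i\<in>{..<n}. \<theta> \<Otimes>\<^sub>M \<eta>)"
proof -
  interpret T: sigma_finite_measure \<theta> by fact
  interpret E: sigma_finite_measure \<eta> by fact
  interpret TE: pair_sigma_finite \<theta> \<eta> ..
  interpret PT: product_sigma_finite "\<lambda>_::nat. \<theta>" ..
  interpret PE: product_sigma_finite "\<lambda>_::nat. \<eta>" ..
  interpret PP: product_sigma_finite "\<lambda>_::nat. \<theta> \<Otimes>\<^sub>M \<eta>" ..
  interpret FT: finite_product_sigma_finite "\<lambda>_::nat. \<theta>" "{..<n}" by standard simp
  interpret FE: finite_product_sigma_finite "\<lambda>_::nat. \<eta>" "{..<n}" by standard simp
  let ?Q = "(\<Pi>\<^sub>M i\<in>{..<n}. \<theta>) \<Otimes>\<^sub>M (\<Pi>\<^sub>M i\<in>{..<n}. \<eta>)"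
  have zip: "(\<lambda>(x, v). zip_fun n x v) \<in> ?Q \<rightarrow>\<^sub>M (\<Pi>\<^sub>M i\<in>{..<n}. \<theta> \<Otimes>\<^sub>M \<eta>)"
    unfolding split_beta' by (intro measurable_zip_fun measurable_fst measurable_snd)
  show ?thesis
  proof (rule PP.PiM_eqI)
    fix A :: "nat \<Rightarrow> ('x \<times> 'v) set"
    assume A [measurable]: "\<And>i. i \<in> {..<n} \<Longrightarrow> A i \<in> sets (\<theta> \<Otimes>\<^sub>M \<eta>)"
    have box: "Pi\<^sub>E {..<n} A \<in> sets (\<Pi>\<^sub>M i\<in>{..<n}. \<theta> \<Otimes>\<^sub>M \<eta>)"
      by (rule sets_PiM_I_finite) (use A in auto)
    have ind: "indicator (Pi\<^sub>E {..<n} A) (zip_fun n x v) = (\<Prod>i<n. indicator (A i) (x i, v i) :: ennreal)" for x v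
      by (auto simp: zip_fun_def indicator_def PiE_iff prod_zero_iff)
    have meas: "(\<lambda>w. indicator (Pi\<^sub>E {..<n} A) (zip_fun n (fst w) (snd w)) :: ennreal) \<in> borel_measurable ?Q"
      using measurable_compose[OF zip borel_measurable_indicator[OF box]] by (simp add: split_beta')
    have "emeasure (distr ?Q (\<Pi>\<^sub>M i\<in>{..<n}. \<theta> \<Otimes>\<^sub>M \<eta>) (\<lambda>(x, v). zip_fun n x v)) (Pi\<^sub>E {..<n} A) =
        (\<integral>\<^sup>+z. indicator (Pi\<^sub>E {..<n} A) z \<partial>distr ?Q (\<Pi>\<^sub>M i\<in>{..<n}. \<theta> \<Otimes>\<^sub>M \<eta>) (\<lambda>(x, v). zip_fun n x v))"
      using box by simp
    also have "\<dots> = (\<integral>\<^sup>+w. indicator (Pi\<^sub>E {..<n} A) (zip_fun n (fst w) (snd w)) \<partial>?Q)"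
      by (subst nn_integral_distr[OF zip]) (use box in \<open>auto simp: split_beta'\<close>)
    also have "\<dots> = (\<integral>\<^sup>+x. \<integral>\<^sup>+v. indicator (Pi\<^sub>E {..<n} A) (zip_fun n x v) \<partial>Pi\<^sub>M {..<n} (\<lambda>_. \<eta>) \<partial>Pi\<^sub>M {..<n} (\<lambda>_. \<theta>))"
      by (subst FE.nn_integral_fst[symmetric]) (use meas in simp_all)
    also have "\<dots> = (\<integral>\<^sup>+x. (\<Prod>i<n. \<integral>\<^sup>+b. indicator (A i) (x i, b) \<partial>\<eta>) \<partial>Pi\<^sub>M {..<n} (\<lambda>_. \<theta>))"
    proof (rule nn_integral_cong)
      fix x assume x: "x \<in> space (Pi\<^sub>M {..<n} (\<lambda>_. \<theta>))"
      have "(\<lambda>b. indicator (A i) (x i, b) :: ennreal) \<in> borel_measurable \<eta>" if "i \<in> {..<n}" for i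
      proof -
        have "x i \<in> space \<theta>" using x that by (auto simp: space_PiM)
        from measurable_compose[OF measurable_Pair1'[OF this] borel_measurable_indicator[OF A[OF that]]]
        show ?thesis .
      qed
      then show "(\<integral>\<^sup>+v. indicator (Pi\<^sub>E {..<n} A) (zip_fun n x v) \<partial>Pi\<^sub>M {..<n} (\<lambda>_. \<eta>)) =
          (\<Prod>i<n. \<integral>\<^sup>+b. indicator (A i) (x i, b) \<partial>\<eta>)"
        unfolding ind by (intro PE.product_nn_integral_prod[of "{..<n}" "\<lambda>i b. indicator (A i) (x i, b)"]) auto
    qed
    also have "\<dots> = (\<Prod>i<n. \<integral>\<^sup>+a. \<integral>\<^sup>+b. indicator (A i) (a, b) \<partial>\<eta> \<partial>\<theta>)"
      by (intro PT.product_nn_integral_prod[of "{..<n}" "\<lambda>i a. \<integral>\<^sup>+b. indicator (A i) (a, b) \<partial>\<eta>"]) auto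
    also have "\<dots> = (\<Prod>i\<in>{..<n}. emeasure (\<theta> \<Otimes>\<^sub>M \<eta>) (A i))"
      by (intro prod.cong refl E.emeasure_pair_measure[symmetric] A)
    finally show "emeasure (distr ?Q (\<Pi>\<^sub>M i\<in>{..<n}. \<theta> \<Otimes>\<^sub>M \<eta>) (\<lambda>(x, v). zip_fun n x v)) (Pi\<^sub>E {..<n} A) =
        (\<Prod>i\<in>{..<n}. emeasure (\<theta> \<Otimes>\<^sub>M \<eta>) (A i))" .
  qed simp_all
qed

lemma nn_integral_PiM_pair:
  assumes "sigma_finite_measure \<theta>" "sigma_finite_measure \<eta>"
    and f: "f \<in> borel_measurable (\<Pi>\<^sub>M i\<in>{..<n}. \<theta> \<Otimes>\<^sub>M \<eta>)"
  shows "(\<integral>\<^sup>+z. f z \<partial>(\<Pi>\<^sub>M i\<in>{..<n}. \<theta> \<Otimes>\<^sub>M \<eta>)) =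
    (\<integral>\<^sup>+x. \<integral>\<^sup>+v. f (zip_fun n x v) \<partial>(\<Pi>\<^sub>M i\<in>{..<n}. \<eta>) \<partial>(\<Pi>\<^sub>M i\<in>{..<n}. \<theta>))"
proof -
  interpret E: sigma_finite_measure \<eta> by fact
  interpret PE: product_sigma_finite "\<lambda>_::nat. \<eta>" ..
  interpret FE: finite_product_sigma_finite "\<lambda>_::nat. \<eta>" "{..<n}" by standard simp
  let ?Q = "(\<Pi>\<^sub>M i\<in>{..<n}. \<theta>) \<Otimes>\<^sub>M (\<Pi>\<^sub>M i\<in>{..<n}. \<eta>)"
  have zip: "(\<lambda>(x, v). zip_fun n x v) \<in> ?Q \<rightarrow>\<^sub>M (\<Pi>\<^sub>M i\<in>{..<n}. \<theta> \<Otimes>\<^sub>M \<eta>)"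
    unfolding split_beta' by (intro measurable_zip_fun measurable_fst measurable_snd)
  have "(\<integral>\<^sup>+z. f z \<partial>(\<Pi>\<^sub>M i\<in>{..<n}. \<theta> \<Otimes>\<^sub>M \<eta>)) = (\<integral>\<^sup>+w. f (zip_fun n (fst w) (snd w)) \<partial>?Q)"
    by (subst PiM_pair_measure[OF assms(1,2), symmetric], subst nn_integral_distr[OF zip])
      (use f in \<open>auto simp: split_beta'\<close>)
  also have "\<dots> = (\<integral>\<^sup>+x. \<integral>\<^sup>+v. f (zip_fun n x v) \<partial>(\<Pi>\<^sub>M i\<in>{..<n}. \<eta>) \<partial>(\<Pi>\<^sub>M i\<in>{..<n}. \<theta>))"
    by (subst FE.nn_integral_fst[symmetric])
      (use measurable_compose[OF zip f] in \<open>simp_all add: split_beta'\<close>)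
  finally show ?thesis .
qed

section \<open>Averages over the marks of finitely many points and the correlation function\<close>

context iid_marks begin

lemma measurable_zip_fun_borel:
  fixes x :: "nat \<Rightarrow> 'x::polish_space"
  shows "zip_fun n x \<in> marks {..<n} \<rightarrow>\<^sub>M (\<Pi>\<^sub>M i\<in>{..<n}. borel)"
  unfolding zip_fun_def
proof (rule measurable_restrict)
  fix i assume "i \<in> {..<n}"
  then have "(\<lambda>v. v i) \<in> marks {..<n} \<rightarrow>\<^sub>M \<eta>"
    by (rule measurable_component_singleton)
  then have "(\<lambda>v. v i) \<in> marks {..<n} \<rightarrow>\<^sub>M borel"
    by (simp cong: measurable_cong_sets add: sets_mark)
  then show "(\<lambda>v. (x i, v i)) \<in> marks {..<n} \<rightarrow>\<^sub>M borel"
    by (intro borel_measurable_Pair) auto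
qed

lemma nn_integral_marks_reindex:
  assumes h: "inj_on h I" "h \<in> I \<rightarrow> K" and f: "f \<in> borel_measurable (marks I)"
  shows "(\<integral>\<^sup>+u. f (\<lambda>i\<in>I. u (h i)) \<partial>marks K) = (\<integral>\<^sup>+v. f v \<partial>marks I)"
proof -
  have r: "(\<lambda>u. \<lambda>i\<in>I. u (h i)) \<in> marks K \<rightarrow>\<^sub>M marks I"
    using h(2) by (intro measurable_restrict measurable_component_singleton) auto
  have "distr (marks K) (marks I) (\<lambda>u. \<lambda>i\<in>I. u (h i)) = marks I"
    using h by (intro distr_PiM_reindex prob_space_axioms)
  then have "(\<integral>\<^sup>+v. f v \<partial>marks I) = (\<integral>\<^sup>+v. f v \<partial>distr (marks K) (marks I) (\<lambda>u. \<lambda>i\<in>I. u (h i)))"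
    by simp
  also have "\<dots> = (\<integral>\<^sup>+u. f (\<lambda>i\<in>I. u (h i)) \<partial>marks K)"
    by (rule nn_integral_distr[OF r]) (use f in simp)
  finally show ?thesis by simp
qed

text \<open>The countable family of subsets of positions is independent of the marks, so sum and
  mean commute. Each subset has \<open>n\<close> distinct positions, whose marks form
  \<open>n\<close> independent copies.\<close>

lemma nn_sum_over_subsets_mark_kernel:
  fixes \<gamma> :: "'x::polish_space set" and f :: "(nat \<Rightarrow> 'x \<times> 'v) \<Rightarrow> ennreal"
  assumes \<gamma>: "\<gamma> \<in> configs" and f: "symmetric_fun n f" "f \<in> borel_measurable (\<Pi>\<^sub>M i\<in>{..<n}. borel)"
  shows "(\<integral>\<^sup>+\<zeta>. nn_sum_over_subsets n f \<zeta> \<partial>mark_kernel \<gamma>) =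
    nn_sum_over_subsets n (\<lambda>x. \<integral>\<^sup>+v. f (zip_fun n x v) \<partial>marks {..<n}) \<gamma>"
proof -
  let ?S = "subsets_of_card n \<gamma>"
  have count: "countable ?S"
    by (rule countable_subsets_of_card[OF countable_configs[OF \<gamma>]])
  interpret P: prob_space "marks \<gamma>" by (rule prob_space_marks)
  interpret C: sigma_finite_measure "count_space ?S"
    by (rule sigma_finite_measure_count_space_countable[OF count])
  interpret pair_sigma_finite "count_space ?S" "marks \<gamma>" ..
  \<comment> \<open>The inner restriction exhibits the term as a function of the marks indexed by
    \<open>{..<n}\<close>, the form required by \<open>nn_integral_marks_reindex\<close>.\<close>
  let ?z = "\<lambda>\<xi> u. zip_fun n (enumeration n \<xi>) (\<lambda>i\<in>{..<n}. u (enumeration n \<xi> i))"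
  have z: "(\<lambda>i\<in>{..<n}. (\<lambda>x. (x, u x)) (enumeration n \<xi> i)) = ?z \<xi> u" for \<xi> and u :: "'x \<Rightarrow> 'v"
    by (auto simp: zip_fun_def)
  have e: "enumeration n \<xi> \<in> {..<n} \<rightarrow> \<gamma>" "inj_on (enumeration n \<xi>) {..<n}" if "\<xi> \<in> ?S" for \<xi>
    using that enumeration(2)[of \<xi> n] by (auto simp: bij_betw_def)
  have fz: "(\<lambda>v. f (zip_fun n x v)) \<in> borel_measurable (marks {..<n})" for x
    by (rule measurable_compose[OF measurable_zip_fun_borel f(2)])
  have meas: "(\<lambda>u. f (?z \<xi> u)) \<in> borel_measurable (marks \<gamma>)" if "\<xi> \<in> ?S" for \<xi>
  proof -
    have "(\<lambda>u. \<lambda>i\<in>{..<n}. u (enumeration n \<xi> i)) \<in> marks \<gamma> \<rightarrow>\<^sub>M marks {..<n}"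
      using e(1)[OF that] by (intro measurable_restrict measurable_component_singleton) auto
    then show ?thesis by (rule measurable_compose) (rule fz)
  qed
  have "(\<integral>\<^sup>+\<zeta>. nn_sum_over_subsets n f \<zeta> \<partial>mark_kernel \<gamma>) =
      (\<integral>\<^sup>+u. nn_sum_over_subsets n f (mark \<gamma> u) \<partial>marks \<gamma>)"
    by (rule nn_integral_mark_kernel[OF \<gamma> measurable_nn_sum_over_subsets[OF f]])
  also have "\<dots> = (\<integral>\<^sup>+u. (\<integral>\<^sup>+\<xi>. f (?z \<xi> u) \<partial>count_space ?S) \<partial>marks \<gamma>)"
    unfolding nn_sum_over_subsets_reindex[OF f(1) bij_betw_mark] z ..
  also have "\<dots> = (\<integral>\<^sup>+\<xi>. (\<integral>\<^sup>+u. f (?z \<xi> u) \<partial>marks \<gamma>) \<partial>count_space ?S)"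
    by (rule Fubini') (use meas in \<open>auto intro!: measurable_pair_measure_countable1 count\<close>)
  also have "\<dots> = (\<integral>\<^sup>+\<xi>. (\<integral>\<^sup>+v. f (zip_fun n (enumeration n \<xi>) v) \<partial>marks {..<n}) \<partial>count_space ?S)"
    by (intro nn_integral_cong nn_integral_marks_reindex fz) (use e in auto)
  finally show ?thesis by (simp add: nn_sum_over_subsets_def)
qed

definition mark_average :: "nat \<Rightarrow> ((nat \<Rightarrow> 'x \<times> 'v) \<Rightarrow> real) \<Rightarrow> (nat \<Rightarrow> 'x) \<Rightarrow> real" where
  "mark_average n \<phi> x = (\<integral>v. \<phi> (zip_fun n x v) \<partial>marks {..<n})"

text \<open>Continuity follows by dominated convergence, with a constant bound since the law of the
  marks is a probability. The average vanishes off the projection of the support to the positions.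
  Symmetry of \<open>\<phi>\<close> carries over because independent identically distributed marks
  may be permuted.\<close>

lemma mark_average_C0:
  fixes \<phi> :: "(nat \<Rightarrow> 'x::polish_space \<times> 'v) \<Rightarrow> real"
  assumes \<phi>: "\<phi> \<in> symmetric_C0 n"
  shows "mark_average n \<phi> \<in> symmetric_C0 n"
  unfolding symmetric_C0_iff
proof (intro conjI)
  interpret P: prob_space "marks {..<n}" by (rule prob_space_marks)
  have cont: "continuous_map (power_topology n) euclidean \<phi>" and sym: "symmetric_fun n \<phi>"
    and comp: "compactin (power_topology n) (power_support n \<phi>)"
    using \<phi> by (auto simp: symmetric_C0_iff)
  have meas: "(\<lambda>v. \<phi> (zip_fun n x v)) \<in> borel_measurable (marks {..<n})" for x
    by (rule measurable_compose[OF measurable_zip_fun_borel measurable_continuous_map_power[OF cont]])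
  obtain C where C: "\<And>z. z \<in> extensional {..<n} \<Longrightarrow> \<bar>\<phi> z\<bar> \<le> C"
    using symmetric_C0_bounded[OF \<phi>] by blast
  \<comment> \<open>Continuity is shown on the full sequence space, since \<open>zip_fun\<close>
    reads only the first \<open>n\<close> coordinates. This space is metrizable, so sequences
    suffice, and the result restricts to the finite power through
    \<open>openin_product_extensional\<close>.\<close>
  have "continuous_on UNIV (\<lambda>x. \<phi> (zip_fun n x v))" for v
  proof -
    have "continuous_map euclidean (power_topology n) (\<lambda>x :: nat \<Rightarrow> 'x. zip_fun n x v)"
      unfolding continuous_map_componentwise
    proof (intro conjI ballI)
      fix i assume "i \<in> {..<n}"
      then show "continuous_map euclidean euclidean (\<lambda>x :: nat \<Rightarrow> 'x. zip_fun n x v i)"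
        by (auto simp: zip_fun_def intro!: continuous_intros
            continuous_on_product_then_coordinatewise[OF continuous_on_id])
    qed auto
    from continuous_map_compose[OF this cont] show ?thesis
      by (simp add: o_def)
  qed
  then have "isCont (\<lambda>x. \<phi> (zip_fun n x v)) x" for x v
    by (simp add: continuous_on_eq_continuous_at)
  then have lim: "(\<lambda>k. \<phi> (zip_fun n (u k) v)) \<longlonglongrightarrow> \<phi> (zip_fun n x v)" if "u \<longlonglongrightarrow> x" for u x v
    using that by (rule isCont_tendsto_compose)
  have "continuous_on UNIV (mark_average n \<phi>)"
  proof (rule continuous_on_sequentiallyI)
    fix u :: "nat \<Rightarrow> nat \<Rightarrow> 'x" and x assume "u \<longlonglongrightarrow> x"
    then show "(\<lambda>k. mark_average n \<phi> (u k)) \<longlonglongrightarrow> mark_average n \<phi> x"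
      unfolding mark_average_def
      by (intro integral_dominated_convergence[where w = "\<lambda>_. C"] meas) (auto intro: lim C intro!: AE_I2)
  qed
  then have open_vimage: "open (mark_average n \<phi> -` U)" if "open U" for U
    using that by (simp add: continuous_on_open_vimage)
  show "continuous_map (power_topology n) euclidean (mark_average n \<phi>)"
    unfolding continuous_map_def
  proof (intro conjI allI impI)
    fix U :: "real set" assume "openin euclidean U"
    then show "openin (power_topology n) {x \<in> topspace (power_topology n). mark_average n \<phi> x \<in> U}"
      unfolding openin_product_extensional by (intro exI[of _ "mark_average n \<phi> -` U"]) (auto intro: open_vimage)
  qed auto
  show "compactin (power_topology n) (power_support n (mark_average n \<phi>))"
  proof (rule compactin_power_supportI)
    \<comment> \<open>The projection to the positions maps the compact support to a compact set. A
      nonzero average forces \<open>\<phi>\<close> to be nonzero somewhere on the fibre over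
      \<open>x\<close>.\<close>
    let ?p = "\<lambda>z :: nat \<Rightarrow> 'x \<times> 'v. \<lambda>i\<in>{..<n}. fst (z i)"
    have "continuous_map (power_topology n) (power_topology n) ?p"
      unfolding continuous_map_componentwise
    proof (intro conjI ballI)
      fix i assume i: "i \<in> {..<n}"
      have "continuous_map (power_topology n) euclidean (fst \<circ> (\<lambda>z :: nat \<Rightarrow> 'x \<times> 'v. z i))"
        using continuous_map_product_projection[OF i]
        by (rule continuous_map_compose) (auto intro!: continuous_intros)
      then show "continuous_map (power_topology n) euclidean (\<lambda>z. ?p z i)"
        using i by (simp add: o_def)
    qed auto
    with comp show "compactin (power_topology n) (?p ` power_support n \<phi>)"
      by (rule image_compactin)
    fix x :: "nat \<Rightarrow> 'x" assume x: "x \<in> extensional {..<n}" "mark_average n \<phi> x \<noteq> 0"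
    have "\<exists>v. \<phi> (zip_fun n x v) \<noteq> 0"
    proof (rule ccontr)
      assume "\<nexists>v. \<phi> (zip_fun n x v) \<noteq> 0"
      then have "mark_average n \<phi> x = 0" by (simp add: mark_average_def)
      with x(2) show False by simp
    qed
    then obtain v where "\<phi> (zip_fun n x v) \<noteq> 0" by blast
    then have "zip_fun n x v \<in> power_support n \<phi>"
      by (rule mem_power_support[OF zip_fun_extensional])
    moreover have "x = ?p (zip_fun n x v)"
      using x(1) by (auto simp: zip_fun_def extensional_def)
    ultimately show "x \<in> ?p ` power_support n \<phi>" by (rule rev_image_eqI[where f = ?p])
  qed
  show "symmetric_fun n (mark_average n \<phi>)"
    unfolding symmetric_fun_def
  proof (intro allI impI ballI)
    fix \<pi> and x :: "nat \<Rightarrow> 'x" assume \<pi>: "\<pi> permutes {..<n}"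
    have inj: "inj_on \<pi> {..<n}" and img: "\<pi> i < n \<longleftrightarrow> i < n" for i
      using permutes_inj_on[OF \<pi>] permutes_in_image[OF \<pi>, of i] by auto
    have r: "(\<lambda>v. \<lambda>i\<in>{..<n}. v (\<pi> i)) \<in> marks {..<n} \<rightarrow>\<^sub>M marks {..<n}"
      by (intro measurable_restrict measurable_component_singleton) (simp add: img)
    \<comment> \<open>The permutation applied to the positions is matched by the same permutation of
      the marks, which preserves their law; only then does the symmetry of \<open>\<phi>\<close>
      apply.\<close>
    have "distr (marks {..<n}) (marks {..<n}) (\<lambda>v. \<lambda>i\<in>{..<n}. v (\<pi> i)) = marks {..<n}"
      using inj img by (intro distr_PiM_reindex prob_space_axioms) auto
    then have "mark_average n \<phi> (x \<circ> \<pi>) =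
        (\<integral>v. \<phi> (zip_fun n (x \<circ> \<pi>) v) \<partial>distr (marks {..<n}) (marks {..<n}) (\<lambda>v. \<lambda>i\<in>{..<n}. v (\<pi> i)))"
      by (simp add: mark_average_def)
    also have "\<dots> = (\<integral>v. \<phi> (zip_fun n (x \<circ> \<pi>) (\<lambda>i\<in>{..<n}. v (\<pi> i))) \<partial>marks {..<n})"
      by (rule integral_distr[OF r meas])
    also have "\<dots> = (\<integral>v. \<phi> (zip_fun n x v \<circ> \<pi>) \<partial>marks {..<n})"
      by (intro Bochner_Integration.integral_cong refl arg_cong[where f=\<phi>]) (auto simp: zip_fun_def img)
    also have "\<dots> = mark_average n \<phi> x"
      by (simp add: mark_average_def symmetric_funD[OF sym \<pi>])
    finally show "mark_average n \<phi> (x \<circ> \<pi>) = mark_average n \<phi> x" .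
  qed
qed

lemma ennreal_mark_average:
  fixes \<phi> :: "(nat \<Rightarrow> 'x::polish_space \<times> 'v) \<Rightarrow> real"
  assumes \<phi>: "\<phi> \<in> symmetric_C0 n" and nonneg: "\<And>z. 0 \<le> \<phi> z"
  shows "(\<integral>\<^sup>+v. ennreal (\<phi> (zip_fun n x v)) \<partial>marks {..<n}) = ennreal (mark_average n \<phi> x)"
  unfolding mark_average_def
proof (rule nn_integral_eq_integral)
  interpret P: prob_space "marks {..<n}" by (rule prob_space_marks)
  have cont: "continuous_map (power_topology n) euclidean \<phi>"
    using \<phi> by (simp add: symmetric_C0_iff)
  obtain C where "\<And>z. z \<in> extensional {..<n} \<Longrightarrow> \<bar>\<phi> z\<bar> \<le> C"
    using symmetric_C0_bounded[OF \<phi>] by blast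
  then show "integrable (marks {..<n}) (\<lambda>v. \<phi> (zip_fun n x v))"
    by (intro P.integrable_const_bound[where B = C]
        measurable_compose[OF measurable_zip_fun_borel measurable_continuous_map_power[OF cont]]) auto
qed (simp add: nonneg)

lemma mark_average_nonneg: "(\<And>z. 0 \<le> \<phi> z) \<Longrightarrow> 0 \<le> mark_average n \<phi> x"
  by (simp add: mark_average_def)

text \<open>For nonnegative \<open>\<phi>\<close> the two extended-valued integrals coincide, so
  integrability under the marked law is inherited from that of the averaged test function under
  \<open>g\<close>.\<close>

lemma marked_sum_over_subsets:
  fixes g :: "'x::polish_space set measure"
  assumes prob_g: "prob_space g" and sets_g: "sets g = sets config_space"
    and \<phi>: "\<phi> \<in> symmetric_C0 n" and nonneg: "\<And>z. 0 \<le> \<phi> z"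
    and int: "integrable g (sum_over_subsets n (mark_average n \<phi>))"
  shows "has_bochner_integral (bind g mark_kernel) (sum_over_subsets n \<phi>)
    (\<integral>\<gamma>. sum_over_subsets n (mark_average n \<phi>) \<gamma> \<partial>g)"
proof (rule has_bochner_integral_nn_integral)
  note space_g = space_g[OF prob_g sets_g]
  note sets_m = sets_marked_distr[OF prob_g sets_g]
  have space_m: "space (bind g mark_kernel) = configs"
    using sets_eq_imp_space_eq[OF sets_m] by simp
  show "sum_over_subsets n \<phi> \<in> borel_measurable (bind g mark_kernel)"
    using measurable_sum_over_subsets[OF \<phi> nonneg] by (simp cong: measurable_cong_sets add: sets_m)
  show "AE \<zeta> in bind g mark_kernel. 0 \<le> sum_over_subsets n \<phi> \<zeta>"
    by (simp add: sum_over_subsets_nonneg nonneg)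
  show "0 \<le> (\<integral>\<gamma>. sum_over_subsets n (mark_average n \<phi>) \<gamma> \<partial>g)"
    by (intro integral_nonneg_AE AE_I2 sum_over_subsets_nonneg mark_average_nonneg nonneg)
  let ?f = "\<lambda>z. ennreal (\<phi> z)"
  have sym: "symmetric_fun n ?f"
    by (rule symmetric_fun_comp) (use \<phi> in \<open>simp add: symmetric_C0_iff\<close>)
  have "\<phi> \<in> borel_measurable (\<Pi>\<^sub>M i\<in>{..<n}. borel)"
    using \<phi> by (intro measurable_continuous_map_power) (simp add: symmetric_C0_iff)
  then have f: "?f \<in> borel_measurable (\<Pi>\<^sub>M i\<in>{..<n}. borel)" by measurable
  have "(\<integral>\<^sup>+\<zeta>. ennreal (sum_over_subsets n \<phi> \<zeta>) \<partial>bind g mark_kernel) =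
      (\<integral>\<^sup>+\<zeta>. nn_sum_over_subsets n ?f \<zeta> \<partial>bind g mark_kernel)"
    by (intro nn_integral_cong ennreal_sum_over_subsets[OF \<phi> nonneg]) (simp add: space_m)
  also have "\<dots> = (\<integral>\<^sup>+\<gamma>. \<integral>\<^sup>+\<zeta>. nn_sum_over_subsets n ?f \<zeta> \<partial>mark_kernel \<gamma> \<partial>g)"
    by (rule nn_integral_marked_distr[OF prob_g sets_g measurable_nn_sum_over_subsets[OF sym f]])
  also have "\<dots> = (\<integral>\<^sup>+\<gamma>. ennreal (sum_over_subsets n (mark_average n \<phi>) \<gamma>) \<partial>g)"
  proof (rule nn_integral_cong)
    fix \<gamma> assume "\<gamma> \<in> space g"
    then have \<gamma>: "\<gamma> \<in> configs" by (simp add: space_g)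
    show "(\<integral>\<^sup>+\<zeta>. nn_sum_over_subsets n ?f \<zeta> \<partial>mark_kernel \<gamma>) =
        ennreal (sum_over_subsets n (mark_average n \<phi>) \<gamma>)"
      using ennreal_sum_over_subsets[OF mark_average_C0[OF \<phi>] mark_average_nonneg[OF nonneg] \<gamma>]
      by (simp add: nn_sum_over_subsets_mark_kernel[OF \<gamma> sym f] ennreal_mark_average[OF \<phi> nonneg])
  qed
  also have "\<dots> = ennreal (\<integral>\<gamma>. sum_over_subsets n (mark_average n \<phi>) \<gamma> \<partial>g)"
    using int by (rule nn_integral_eq_integral)
      (simp add: sum_over_subsets_nonneg mark_average_nonneg nonneg)
  finally show "(\<integral>\<^sup>+\<zeta>. ennreal (sum_over_subsets n \<phi> \<zeta>) \<partial>bind g mark_kernel) =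
    ennreal (\<integral>\<gamma>. sum_over_subsets n (mark_average n \<phi>) \<gamma> \<partial>g)" .
qed

lemma measurable_power_fst:
  "(\<lambda>z. \<lambda>i\<in>{..<n}. fst (z i)) \<in> (\<Pi>\<^sub>M i\<in>{..<n}. \<theta> \<Otimes>\<^sub>M \<eta>) \<rightarrow>\<^sub>M (\<Pi>\<^sub>M i\<in>{..<n}. \<theta>)"
proof (rule measurable_restrict)
  fix i assume "i \<in> {..<n}"
  then have "(\<lambda>z. z i) \<in> (\<Pi>\<^sub>M i\<in>{..<n}. \<theta> \<Otimes>\<^sub>M \<eta>) \<rightarrow>\<^sub>M \<theta> \<Otimes>\<^sub>M \<eta>"
    by (rule measurable_component_singleton)
  then show "(\<lambda>z. fst (z i)) \<in> (\<Pi>\<^sub>M i\<in>{..<n}. \<theta> \<Otimes>\<^sub>M \<eta>) \<rightarrow>\<^sub>M \<theta>"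
    by (rule measurable_compose) (rule measurable_fst)
qed

text \<open>The lifted correlation function is constant along the marks and therefore leaves the
  inner integral, which turns \<open>\<phi>\<close> into its average.\<close>

lemma integral_lifted_correlation:
  fixes \<theta> :: "'x::polish_space measure"
  assumes \<theta>: "reference_measure \<theta>"
    and \<phi>: "\<phi> \<in> symmetric_C0 n" and nonneg: "\<And>z. 0 \<le> \<phi> z"
    and \<kappa> [measurable]: "\<kappa> \<in> borel_measurable (\<Pi>\<^sub>M i\<in>{..<n}. \<theta>)"
    and \<kappa>_nonneg: "\<And>x. x \<in> space (\<Pi>\<^sub>M i\<in>{..<n}. \<theta>) \<Longrightarrow> 0 \<le> \<kappa> x"
    and int: "integrable (\<Pi>\<^sub>M i\<in>{..<n}. \<theta>) (\<lambda>x. mark_average n \<phi> x * \<kappa> x)"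
  shows "has_bochner_integral (\<Pi>\<^sub>M i\<in>{..<n}. \<theta> \<Otimes>\<^sub>M \<eta>) (\<lambda>z. \<phi> z * \<kappa> (\<lambda>i\<in>{..<n}. fst (z i)))
    (\<integral>x. mark_average n \<phi> x * \<kappa> x \<partial>(\<Pi>\<^sub>M i\<in>{..<n}. \<theta>))"
proof (rule has_bochner_integral_nn_integral)
  let ?T = "\<Pi>\<^sub>M i\<in>{..<n}. \<theta>" and ?S = "\<Pi>\<^sub>M i\<in>{..<n}. \<theta> \<Otimes>\<^sub>M \<eta>"
  have "sigma_finite_measure \<theta>" using \<theta> by (simp add: reference_measure_def)
  have "sets ?S = sets (\<Pi>\<^sub>M i\<in>{..<n}. borel)"
    using reference_measure_pair[OF \<theta>] by (intro sets_PiM_cong) (auto simp: reference_measure_def)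
  moreover have "\<phi> \<in> borel_measurable (\<Pi>\<^sub>M i\<in>{..<n}. borel)"
    using \<phi> by (intro measurable_continuous_map_power) (simp add: symmetric_C0_iff)
  ultimately have "\<phi> \<in> borel_measurable ?S"
    by (simp cong: measurable_cong_sets)
  then show meas: "(\<lambda>z. \<phi> z * \<kappa> (\<lambda>i\<in>{..<n}. fst (z i))) \<in> borel_measurable ?S"
    using measurable_compose[OF measurable_power_fst \<kappa>] by (rule borel_measurable_times)
  have "(\<lambda>i\<in>{..<n}. fst (z i)) \<in> space ?T" if "z \<in> space ?S" for z
    using measurable_power_fst that by (rule measurable_space)
  then show "AE z in ?S. 0 \<le> \<phi> z * \<kappa> (\<lambda>i\<in>{..<n}. fst (z i))"
    by (intro AE_I2 mult_nonneg_nonneg nonneg \<kappa>_nonneg)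
  have avg_nonneg: "0 \<le> mark_average n \<phi> x * \<kappa> x" if "x \<in> space ?T" for x
    using that by (intro mult_nonneg_nonneg mark_average_nonneg nonneg \<kappa>_nonneg)
  then show "0 \<le> (\<integral>x. mark_average n \<phi> x * \<kappa> x \<partial>?T)"
    by (intro integral_nonneg_AE AE_I2)
  have "(\<integral>\<^sup>+z. ennreal (\<phi> z * \<kappa> (\<lambda>i\<in>{..<n}. fst (z i))) \<partial>?S) =
      (\<integral>\<^sup>+x. \<integral>\<^sup>+v. ennreal (\<phi> (zip_fun n x v) * \<kappa> (\<lambda>i\<in>{..<n}. fst (zip_fun n x v i))) \<partial>marks {..<n} \<partial>?T)"
    by (rule nn_integral_PiM_pair[OF \<open>sigma_finite_measure \<theta>\<close> sigma_finite_measure_axioms])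
      (use meas in measurable)
  also have "\<dots> = (\<integral>\<^sup>+x. ennreal (mark_average n \<phi> x * \<kappa> x) \<partial>?T)"
  proof (rule nn_integral_cong)
    fix x assume x: "x \<in> space ?T"
    \<comment> \<open>Extensionality of \<open>x\<close> matters here: restricting the projected
      tuple returns \<open>x\<close> itself, including its default values.\<close>
    then have "(\<lambda>i\<in>{..<n}. fst (zip_fun n x v i)) = x" for v :: "nat \<Rightarrow> 'v"
      by (auto simp: zip_fun_def space_PiM PiE_iff extensional_def)
    then have "(\<integral>\<^sup>+v. ennreal (\<phi> (zip_fun n x v) * \<kappa> (\<lambda>i\<in>{..<n}. fst (zip_fun n x v i))) \<partial>marks {..<n}) =
        (\<integral>\<^sup>+v. ennreal (\<phi> (zip_fun n x v)) * ennreal (\<kappa> x) \<partial>marks {..<n})"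
      using \<kappa>_nonneg[OF x] by (simp add: ennreal_mult nonneg)
    also have "\<dots> = (\<integral>\<^sup>+v. ennreal (\<phi> (zip_fun n x v)) \<partial>marks {..<n}) * ennreal (\<kappa> x)"
      by (intro nn_integral_multc measurable_compose[OF _ measurable_ennreal]
          measurable_compose[OF measurable_zip_fun_borel \<open>\<phi> \<in> borel_measurable (\<Pi>\<^sub>M i\<in>{..<n}. borel)\<close>])
    also have "\<dots> = ennreal (mark_average n \<phi> x * \<kappa> x)"
      using \<kappa>_nonneg[OF x] by (simp add: ennreal_mark_average[OF \<phi> nonneg] ennreal_mult mark_average_nonneg nonneg)
    finally show "(\<integral>\<^sup>+v. ennreal (\<phi> (zip_fun n x v) * \<kappa> (\<lambda>i\<in>{..<n}. fst (zip_fun n x v i))) \<partial>marks {..<n}) =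
      ennreal (mark_average n \<phi> x * \<kappa> x)" .
  qed
  also have "\<dots> = ennreal (\<integral>x. mark_average n \<phi> x * \<kappa> x \<partial>?T)"
    using int avg_nonneg by (intro nn_integral_eq_integral AE_I2)
  finally show "(\<integral>\<^sup>+z. ennreal (\<phi> z * \<kappa> (\<lambda>i\<in>{..<n}. fst (z i))) \<partial>?S) =
    ennreal (\<integral>x. mark_average n \<phi> x * \<kappa> x \<partial>?T)" .
qed

lemma marked_distr_correlation:
  fixes g :: "'x::polish_space set measure"
  assumes prob_g: "prob_space g" and sets_g: "sets g = sets config_space"
    and \<theta>: "reference_measure \<theta>" and corr: "is_correlation_function n \<theta> g \<kappa>"
  shows "is_correlation_function n (\<theta> \<Otimes>\<^sub>M \<eta>) (bind g mark_kernel) (\<lambda>z. \<kappa> (\<lambda>i\<in>{..<n}. fst (z i)))"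
proof -
  let ?T = "\<Pi>\<^sub>M i\<in>{..<n}. \<theta>" and ?S = "\<Pi>\<^sub>M i\<in>{..<n}. \<theta> \<Otimes>\<^sub>M \<eta>"
  let ?\<kappa> = "\<lambda>z :: nat \<Rightarrow> 'x \<times> 'v. \<kappa> (\<lambda>i\<in>{..<n}. fst (z i))" and ?G = "bind g mark_kernel"
  have \<kappa>: "\<kappa> \<in> borel_measurable ?T" and \<kappa>_nonneg: "\<And>x. x \<in> space ?T \<Longrightarrow> 0 \<le> \<kappa> x"
    and \<kappa>_eq: "\<And>\<psi>. \<psi> \<in> symmetric_C0 n \<Longrightarrow> integrable g (sum_over_subsets n \<psi>) \<and>
      integrable ?T (\<lambda>x. \<psi> x * \<kappa> x) \<and>
      (\<integral>\<gamma>. sum_over_subsets n \<psi> \<gamma> \<partial>g) = 1 / fact n * (\<integral>x. \<psi> x * \<kappa> x \<partial>?T)"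
    using corr by (auto simp: is_correlation_function_def Let_def)
  have space_m: "space ?G = configs"
    using sets_eq_imp_space_eq[OF sets_marked_distr[OF prob_g sets_g]] by simp
  have pos: "integrable ?G (sum_over_subsets n \<phi>) \<and> integrable ?S (\<lambda>z. \<phi> z * ?\<kappa> z) \<and>
      (\<integral>\<zeta>. sum_over_subsets n \<phi> \<zeta> \<partial>?G) = 1 / fact n * (\<integral>z. \<phi> z * ?\<kappa> z \<partial>?S)"
    if \<phi>: "\<phi> \<in> symmetric_C0 n" and nonneg: "\<And>z. 0 \<le> \<phi> z" for \<phi> :: "(nat \<Rightarrow> 'x \<times> 'v) \<Rightarrow> real"
  proof -
    note avg = \<kappa>_eq[OF mark_average_C0[OF \<phi>]]
    have "has_bochner_integral ?G (sum_over_subsets n \<phi>) (\<integral>\<gamma>. sum_over_subsets n (mark_average n \<phi>) \<gamma> \<partial>g)"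
      by (rule marked_sum_over_subsets[OF prob_g sets_g \<phi> nonneg]) (use avg in simp)
    moreover have "has_bochner_integral ?S (\<lambda>z. \<phi> z * ?\<kappa> z) (\<integral>x. mark_average n \<phi> x * \<kappa> x \<partial>?T)"
      by (rule integral_lifted_correlation[OF \<theta> \<phi> nonneg \<kappa> \<kappa>_nonneg]) (use avg in simp_all)
    ultimately show ?thesis
      using avg by (simp add: has_bochner_integral_iff)
  qed
  have "integrable ?G (sum_over_subsets n \<phi>) \<and> integrable ?S (\<lambda>z. \<phi> z * ?\<kappa> z) \<and>
      (\<integral>\<zeta>. sum_over_subsets n \<phi> \<zeta> \<partial>?G) = 1 / fact n * (\<integral>z. \<phi> z * ?\<kappa> z \<partial>?S)"
    if \<phi>: "\<phi> \<in> symmetric_C0 n" for \<phi> :: "(nat \<Rightarrow> 'x \<times> 'v) \<Rightarrow> real"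
  proof -
    \<comment> \<open>Positive and negative parts are compositions of \<open>\<phi>\<close> with
      continuous functions vanishing at 0, so they remain symmetric test functions with compact
      support. The identity then extends by linearity.\<close>
    define p q where "p z = max 0 (\<phi> z)" and "q z = max 0 (- \<phi> z)" for z
    have C0: "p \<in> symmetric_C0 n" "q \<in> symmetric_C0 n"
      unfolding p_def[abs_def] q_def[abs_def]
      by (rule symmetric_C0_comp[OF \<phi>]; auto intro!: continuous_intros)+
    have nonneg: "0 \<le> p z" "0 \<le> q z" for z by (simp_all add: p_def q_def)
    note P = pos[OF C0(1) nonneg(1)] and Q = pos[OF C0(2) nonneg(2)]
    have \<phi>_eq: "\<phi> = (\<lambda>z. p z - q z)"
      by (auto simp: p_def q_def max_def fun_eq_iff)
    have sum_eq: "sum_over_subsets n \<phi> \<zeta> = sum_over_subsets n p \<zeta> - sum_over_subsets n q \<zeta>"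
      if "\<zeta> \<in> space ?G" for \<zeta>
      using that unfolding \<phi>_eq space_m by (rule sum_over_subsets_diff[OF C0])
    have prod_eq: "(\<lambda>z. \<phi> z * ?\<kappa> z) = (\<lambda>z. p z * ?\<kappa> z - q z * ?\<kappa> z)"
      by (simp add: \<phi>_eq left_diff_distrib)
    have "integrable ?G (\<lambda>\<zeta>. sum_over_subsets n p \<zeta> - sum_over_subsets n q \<zeta>)"
      using P Q by (intro Bochner_Integration.integrable_diff) auto
    then have "integrable ?G (sum_over_subsets n \<phi>)"
      using sum_eq by (subst Bochner_Integration.integrable_cong[OF refl]) auto
    moreover have "integrable ?S (\<lambda>z. \<phi> z * ?\<kappa> z)"
      unfolding prod_eq using P Q by (intro Bochner_Integration.integrable_diff) auto
    moreover have "(\<integral>\<zeta>. sum_over_subsets n \<phi> \<zeta> \<partial>?G) =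
        (\<integral>\<zeta>. sum_over_subsets n p \<zeta> - sum_over_subsets n q \<zeta> \<partial>?G)"
      by (rule Bochner_Integration.integral_cong[OF refl sum_eq])
    moreover have "\<dots> = (\<integral>\<zeta>. sum_over_subsets n p \<zeta> \<partial>?G) - (\<integral>\<zeta>. sum_over_subsets n q \<zeta> \<partial>?G)"
      using P Q by (intro Bochner_Integration.integral_diff) auto
    moreover have "(\<integral>z. \<phi> z * ?\<kappa> z \<partial>?S) = (\<integral>z. p z * ?\<kappa> z \<partial>?S) - (\<integral>z. q z * ?\<kappa> z \<partial>?S)"
      unfolding prod_eq using P Q by (intro Bochner_Integration.integral_diff) auto
    ultimately show ?thesis
      using P Q by (simp add: right_diff_distrib)
  qed
  moreover have "0 \<le> ?\<kappa> z" if "z \<in> space ?S" for z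
    using measurable_space[OF measurable_power_fst that] by (rule \<kappa>_nonneg)
  ultimately show ?thesis
    using measurable_compose[OF measurable_power_fst \<kappa>] by (simp add: is_correlation_function_def Let_def)
qed

end

theorem theorem2p5:
  fixes \<theta> :: "'x::{real_vector, polish_space} measure"
    and \<eta> :: "'x seqs measure"
    and \<Phi> :: "'x set \<Rightarrow> ereal"
    and g :: "'x set measure"
  assumes "prob_space \<eta>" and "sets \<eta> = sets borel" and "symmetric_measure \<eta>"
    and "g \<in> gibbs_measures \<theta> \<Phi>"
  shows "marked_measure \<eta> g \<in> gibbs_measures (\<theta> \<Otimes>\<^sub>M \<eta>) (lifted_potential \<Phi>) \<and>
    (\<forall>n\<ge>1. \<forall>\<kappa>. is_correlation_function n \<theta> g \<kappa> \<longrightarrow>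
      is_correlation_function n (\<theta> \<Otimes>\<^sub>M \<eta>) (marked_measure \<eta> g)
        (\<lambda>z. \<kappa> (\<lambda>i\<in>{..<n}. fst (z i))))"
proof -
  interpret prob_space \<eta> by fact
  interpret iid_marks \<eta> by standard fact
  have g: "reference_measure \<theta>" "interaction_potential \<Phi>" "prob_space g" "sets g = sets config_space"
    using assms(4) by (auto simp: gibbs_measures_def)
  have eq: "marked_measure \<eta> g = bind g mark_kernel"
    by (simp add: marked_measure_def mark_def[abs_def])
  have "marked_measure \<eta> g \<in> gibbs_measures (\<theta> \<Otimes>\<^sub>M \<eta>) (lifted_potential \<Phi>)"
    unfolding eq using assms(4) interaction_potential_lifted[OF g(2)]
    by (rule marked_distr_gibbs) (rule energy_lifted)
  then show ?thesis
    unfolding eq using marked_distr_correlation[OF g(3,4,1)] by blast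
qed

end
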